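(* Let $n\ge 5$, $F=\{5,\dots,n\}$, and let $G=\langle x_{1,\{f\}}: f\in F\rangle\le\mathrm{Out}^0(W_n)$ (so $G\cong\mathbb{Z}_2^{\,n-4}$), acting on $K_n$ by simplicial automorphisms. Then the fixed point set of $G$ in $K_n$ is exactly the union of the simplices spanned by the vertices $[\alpha,\widetilde\Theta]$ with $\alpha\in\mathrm{Out}^0(W_4)$ (embedded in $\mathrm{Out}^0(W_n)$ via $y_{i,D}\mapsto x_{i,D}$) and $\widetilde\Theta\in\widetilde{\mathcal{HT}_4}$; and this subcomplex is simplicially isomorphic to $K_4$, via $[\alpha,\Theta]\mapsto[\alpha,\widetilde\Theta]$, compatibly with the action of $\mathrm{Out}^0(W_4)$.
   Context: $W_n=\langle a_1,\dots,a_n\mid a_i^2=1\rangle$, $[n]=\{1,\dots,n\}$. For $i\in[n]$ and nonempty $D\subseteq[n]\setminus\{i\}$, the partial conjugation $x_{i,D}$ sends $a_j\mapsto a_ia_ja_i$ for $j\in D$ and fixes the others. $\mathrm{Out}^0(W_n)=\mathrm{Aut}^0(W_n)/\mathrm{Inn}(W_n)$ with $\mathrm{Aut}^0(W_n)$ the automorphisms sending each $a_j$ to a conjugate of itself. Partial conjugations of $W_4$ are denoted $y_{i,D}$; $y_{i,D}\mapsto x_{i,D}$ (with $D\subseteq[4]$) defines an injective homomorphism $\mathrm{Out}^0(W_4)\to\mathrm{Out}^0(W_n)$, whose image is denoted $\mathrm{Out}^0(W_4)$. A hypertree on $[n]$ is a set of subsets (hyperedges) of $[n]$ of size $\ge2$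 such that any two vertices are joined by a unique simple walk (alternating sequence of distinct vertices and distinct hyperedges, consecutive vertices in the intervening hyperedge); $\mathcal{HT}_n$ is the set of them. $\Theta\le\Lambda$ if $\Theta$ is obtained from $\Lambda$ by finitely many folds (replacing two intersecting distinct hyperedges by their union). $\Theta$ carries $x_{i,D}$ if for every $d\in D$, $j\in[n]\setminus(D\cup\{i\})$ the simple walk from $d$ to $j$ visits $i$; $\alpha$ is carried by $\Theta$ if it is a product of partial conjugations carried by $\Theta$. For $\Theta\in\mathcal{HT}_4$, $\widetilde\Theta\in\mathcal{HT}_n$ is the hypertree on $[n]$ whose hyperedges are those of $\Theta$ together with $\{1,f\}$ for each $f\in F$; $\widetilde{\mathcal{HT}_4}=\{\widetilde\Theta:\Theta\in\mathcal{HT}_4\}$. McCullough–Miller space $K_n$: on $\mathrm{Out}^0(W_n)\times\mathcal{HT}_n$ set $(\alpha,\Theta)\sim(\beta,\Lambda)$ iff $\Theta=\Lambda$ and $\alpha^{-1}\beta$ is carried by $\Theta$, classes $[\alpha,\Theta]$, ordered by $[\alpha,\Theta]\le[\beta,\Lambda]$ iff $\Theta\le\Lambda$ and $\alpha^{-1}\beta$ is carried by $\Lambda$; $K_n$ is the order complex of this poset. $\mathrm{Out}^0(W_n)$ acts by $\varphi\cdot[\alpha,\Theta]=[\varphi\alpha,\Theta]$.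
   Formalization: y_{i,D}↦x_{i,D} is ill-defined on Out^0(W_4) (y_{1,{2,3,4}} is inner, x_{1,{2,3,4}} is not); instead α is extended by conjugating each a_f, f∈F, by the shortest element conjugating a_1, a homomorphism up to x_{1,F}. The remark that G≅Z_2^{n-4} is omitted. *)

theory Defs
  imports Complex_Main
begin

text \<open>Elements of W_n = <a_1,...,a_n | a_i^2 = 1> are represented by their unique
reduced words: lists of letters in {1..n} with no two equal adjacent letters.
The letter j stands for the generator a_j.\<close>

type_synonym word = "nat list"

fun red :: "word \<Rightarrow> word" where
  "red [] = []"
| "red (x # xs) = (case red xs of [] \<Rightarrow> [x]
                     | y # ys \<Rightarrow> (if x = y then ys else x # y # ys))"

definition Wn :: "nat \<Rightarrow> word set" where
  "Wn n = {w. set w \<subseteq> {1..n} \<and> red w = w}"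

text \<open>An endomorphism is represented by the images of the generators.
Product in W_n is red (u @ v), inverse is rev.\<close>

type_synonym endo = "nat \<Rightarrow> word"

definition ext :: "endo \<Rightarrow> word \<Rightarrow> word" where
  "ext e w = red (concat (map e w))"

definition comp :: "endo \<Rightarrow> endo \<Rightarrow> endo" where
  "comp \<phi> \<psi> = (\<lambda>j. ext \<phi> (\<psi> j))"

definition idE :: endo where
  "idE = (\<lambda>j. [j])"

definition conjw :: "word \<Rightarrow> nat \<Rightarrow> word" where
  "conjw c j = red (rev c @ [j] @ c)"

definition Aut0 :: "nat \<Rightarrow> endo set" where
  "Aut0 n = {e. (\<forall>j. j \<notin> {1..n} \<longrightarrow> e j = [j])
              \<and> (\<forall>j\<in>{1..n}. \<exists>c. set c \<subseteq> {1..n} \<and> e j = conjw c j)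
              \<and> bij_betw (ext e) (Wn n) (Wn n)}"

definition pconj :: "nat \<Rightarrow> nat set \<Rightarrow> endo" where
  "pconj i D = (\<lambda>j. if j \<in> D then [i, j, i] else [j])"

definition PC :: "nat \<Rightarrow> (nat \<times> nat set) set" where
  "PC n = {(i, D). i \<in> {1..n} \<and> D \<noteq> {} \<and> D \<subseteq> {1..n} - {i}}"

text \<open>Subgroup generated by a set of involutive automorphisms (all generators
used below are involutions, so the generated monoid is the generated group).\<close>
inductive_set gen :: "endo set \<Rightarrow> endo set" for S where
  gen_id: "idE \<in> gen S"
| gen_step: "a \<in> S \<Longrightarrow> g \<in> gen S \<Longrightarrow> comp a g \<in> gen S"

definition simple_walk :: "nat set set \<Rightarrow> nat list \<Rightarrow> nat set list \<Rightarrow> bool" where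
  "simple_walk \<Theta> vs es \<longleftrightarrow> length vs = Suc (length es) \<and> distinct vs \<and> distinct es
     \<and> set es \<subseteq> \<Theta> \<and> (\<forall>m < length es. vs ! m \<in> es ! m \<and> vs ! Suc m \<in> es ! m)"

definition HT :: "nat \<Rightarrow> nat set set set" where
  "HT n = {\<Theta>. (\<forall>E\<in>\<Theta>. E \<subseteq> {1..n} \<and> card E \<ge> 2)
        \<and> (\<forall>u\<in>{1..n}. \<forall>w\<in>{1..n}.
             \<exists>!p. simple_walk \<Theta> (fst p) (snd p) \<and> hd (fst p) = u \<and> last (fst p) = w)}"

definition fold_step :: "nat set set \<Rightarrow> nat set set \<Rightarrow> bool" where
  "fold_step \<Lambda> \<Theta> \<longleftrightarrow> (\<exists>E1\<in>\<Lambda>. \<exists>E2\<in>\<Lambda>. E1 \<noteq> E2 \<and> E1 \<inter> E2 \<noteq> {}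
        \<and> \<Theta> = (\<Lambda> - {E1, E2}) \<union> {E1 \<union> E2})"

definition ht_le :: "nat set set \<Rightarrow> nat set set \<Rightarrow> bool" where
  "ht_le \<Theta> \<Lambda> \<longleftrightarrow> fold_step\<^sup>*\<^sup>* \<Lambda> \<Theta>"

definition carries :: "nat \<Rightarrow> nat set set \<Rightarrow> nat \<Rightarrow> nat set \<Rightarrow> bool" where
  "carries n \<Theta> i D \<longleftrightarrow> (\<forall>d\<in>D. \<forall>j\<in>{1..n} - (D \<union> {i}). \<forall>vs es.
       simple_walk \<Theta> vs es \<and> hd vs = d \<and> last vs = j \<longrightarrow> i \<in> set vs)"

text \<open>Automorphisms that are products of partial conjugations carried by Theta.
It contains Inn(W_n) (x_{i,[n]-{i}} is conjugation by a_i and is carried by every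
hypertree), so "alpha^{-1} beta carried by Theta in Out^0" is
"beta = alpha o pi for some pi in CarG n Theta" at the level of representatives.\<close>
definition CarG :: "nat \<Rightarrow> nat set set \<Rightarrow> endo set" where
  "CarG n \<Theta> = gen {pconj i D | i D. (i, D) \<in> PC n \<and> carries n \<Theta> i D}"

text \<open>The vertex [alpha, Theta] is the equivalence class of (alpha, Theta) with
alpha taken as an automorphism representative.\<close>
definition cls :: "nat \<Rightarrow> endo \<Rightarrow> nat set set \<Rightarrow> (endo \<times> nat set set) set" where
  "cls n \<alpha> \<Theta> = {(comp \<alpha> \<pi>, \<Theta>) | \<pi>. \<pi> \<in> CarG n \<Theta>}"

definition VK :: "nat \<Rightarrow> (endo \<times> nat set set) set set" where
  "VK n = {cls n \<alpha> \<Theta> | \<alpha> \<Theta>. \<alpha> \<in> Aut0 n \<and> \<Theta> \<in> HT n}"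

definition leK :: "nat \<Rightarrow> (endo \<times> nat set set) set \<Rightarrow> (endo \<times> nat set set) set \<Rightarrow> bool" where
  "leK n u v \<longleftrightarrow> (\<exists>\<alpha> \<Theta> \<beta> \<Lambda>. \<alpha> \<in> Aut0 n \<and> \<beta> \<in> Aut0 n \<and> \<Theta> \<in> HT n \<and> \<Lambda> \<in> HT n
      \<and> u = cls n \<alpha> \<Theta> \<and> v = cls n \<beta> \<Lambda> \<and> ht_le \<Theta> \<Lambda>
      \<and> (\<exists>\<pi>\<in>CarG n \<Lambda>. \<beta> = comp \<alpha> \<pi>))"

definition actK :: "endo \<Rightarrow> (endo \<times> nat set set) set \<Rightarrow> (endo \<times> nat set set) set" where
  "actK \<phi> v = (\<lambda>(\<psi>, \<Theta>). (comp \<phi> \<psi>, \<Theta>)) ` v"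

definition is_simplex :: "'v set \<Rightarrow> ('v \<Rightarrow> 'v \<Rightarrow> bool) \<Rightarrow> 'v set \<Rightarrow> bool" where
  "is_simplex V le S \<longleftrightarrow> finite S \<and> S \<noteq> {} \<and> S \<subseteq> V \<and> (\<forall>u\<in>S. \<forall>w\<in>S. le u w \<or> le w u)"

definition realiz :: "'v set \<Rightarrow> ('v \<Rightarrow> 'v \<Rightarrow> bool) \<Rightarrow> ('v \<Rightarrow> real) set" where
  "realiz V le = {p. (\<forall>v. 0 \<le> p v) \<and> is_simplex V le {v. p v \<noteq> 0}
                    \<and> (\<Sum>v\<in>{v. p v \<noteq> 0}. p v) = 1}"

definition Gsub :: "nat \<Rightarrow> endo set" where
  "Gsub n = gen {pconj 1 {f} | f. f \<in> {5..n}}"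

definition tildeHT :: "nat \<Rightarrow> nat set set \<Rightarrow> nat set set" where
  "tildeHT n \<Theta> = \<Theta> \<union> {{1, f} | f. f \<in> {5..n}}"

text \<open>Embedding Out^0(W_4) -> Out^0(W_n) at the level of representatives:
alpha acts as before on a_1..a_4, and a_f (f >= 5) is conjugated by the same
(shortest) element c that conjugates a_1, where alpha(a_1) = rev c @ [1] @ c.
On partial conjugations with 1 not in D this is y_{i,D} |-> x_{i,D}.\<close>
definition iota :: "nat \<Rightarrow> endo \<Rightarrow> endo" where
  "iota n \<alpha> = (\<lambda>j. if j \<in> {5..n} then conjw (drop (length (\<alpha> 1) div 2 + 1) (\<alpha> 1)) j
                   else \<alpha> j)"

definition Vsub :: "nat \<Rightarrow> (endo \<times> nat set set) set set" where
  "Vsub n = {cls n (iota n \<alpha>) (tildeHT n \<Theta>) | \<alpha> \<Theta>. \<alpha> \<in> Aut0 4 \<and> \<Theta> \<in> HT 4}"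

end

theory Submission
  imports Defs
begin

text \<open>An automorphism \<open>\<pi>\<close> carried by a hypertree conjugates all generators \<open>a\<^sub>j\<close> in a common
  hyperedge by the same element. Hence, if \<open>[\<alpha>, \<Lambda>]\<close> is fixed by \<open>\<tau> = x\<^sub>1\<^sub>,\<^sub>{\<^sub>f\<^sub>}\<close> and \<open>r\<^sub>j = \<alpha>(a\<^sub>j)\<close>, then on
  every hyperedge of \<open>\<Lambda>\<close> there is a \<open>v\<close> with \<open>\<tau>(r\<^sub>j) = v\<^sup>-\<^sup>1 r\<^sub>j v\<close> for all \<open>j\<close> in it. As the
  centralizer of \<open>a\<^sub>j\<close> is \<open>{1, a\<^sub>j}\<close>, counting letters modulo 2 determines \<open>v\<close> well enough. First,
  a hyperedge containing \<open>f\<close> must be \<open>{1, f}\<close>, so that \<open>\<Lambda>\<close> is an extended hypertree. Second, after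
  normalizing \<open>r\<^sub>1 = a\<^sub>1\<close> by an inner automorphism, \<open>r\<^sub>f\<close> lies in the infinite dihedral group
  \<open>\<langle>a\<^sub>1, a\<^sub>f\<rangle>\<close>; surjectivity of \<open>\<alpha>\<close> leaves only \<open>a\<^sub>f\<close> and \<open>a\<^sub>1 a\<^sub>f a\<^sub>1\<close>, and one can pass to \<open>a\<^sub>f\<close>.
  Third, if \<open>r\<^sub>j\<close> avoids the letter \<open>f\<close>, then \<open>v = 1\<close> for the hyperedges at \<open>j\<close>, and the property
  spreads along the hypertree because the fixed subgroup of \<open>\<tau>\<close> consists of the words without \<open>f\<close>.
  So \<open>\<alpha>\<close> now comes from an automorphism of \<open>W\<^sub>4\<close>. For the isomorphism with \<open>K\<^sub>4\<close>,
  the map \<open>iota\<close> is multiplicative only up to \<open>x\<^sub>1\<^sub>,\<^sub>F\<close>, which is carried by every extended hypertree,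
  and killing the generators \<open>a\<^sub>f\<close> gives a left inverse on carried automorphisms.\<close>

section \<open>The group of reduced words\<close>

lemma distinct_adj_red: "distinct_adj (red w)"
  by (induction w) (auto split: list.splits simp: distinct_adj_Cons)

lemma red_eq_self_iff: "red w = w \<longleftrightarrow> distinct_adj w"
proof
  show "red w = w" if "distinct_adj w"
    using that by (induction w) (auto split: list.splits simp: distinct_adj_Cons)
qed (metis distinct_adj_red)

lemma red_red [simp]: "red (red w) = red w"
  by (simp add: red_eq_self_iff distinct_adj_red)

lemma red_append_red_right [simp]: "red (u @ red v) = red (u @ v)"
  by (induction u) auto

lemma red_Cons_Cons [simp]: "red (x # x # w) = red w"
proof -
  have "distinct_adj (red w)" by (rule distinct_adj_red)
  then show ?thesis by (auto split: list.splits simp: distinct_adj_Cons)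
qed

text \<open>The critical case is a cancellation of \<open>x\<close> against the head of
  \<open>red u\<close>, and this pair cancels just as well in front of \<open>v\<close>. Together
  with \<open>red_append_red_right\<close> this gives associativity of the product below.\<close>

lemma red_append_red_left [simp]: "red (red u @ v) = red (u @ v)"
proof (induction u)
  case (Cons x u)
  have *: "red (x # u @ v) = red (x # red u @ v)"
    using Cons.IH by simp
  show ?case
  proof (cases "red u")
    case Nil
    then show ?thesis using * by simp
  next
    case (Cons y ys)
    then show ?thesis
      using * red_Cons_Cons[of x "ys @ v"] by (auto simp del: red.simps(2) simp: red.simps(2)[of x u])
  qed
qed simp

lemma red_rev_append [simp]: "red (rev u @ u) = []"
proof (induction u)
  case (Cons x u)
  have "red (rev u @ x # x # u) = red (rev u @ u)"
    by (metis red_Cons_Cons red_append_red_right)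
  then show ?case using Cons.IH by simp
qed simp

lemma set_red_subset: "set (red w) \<subseteq> set w"
  by (induction w) (auto split: list.splits if_splits)

lemma even_count_red: "even (count_list (red w) i) \<longleftrightarrow> even (count_list w i)"
  by (induction w) (auto split: list.splits)

text \<open>The free product of groups of order two, one for each natural number. With all letters
  in one type, each W_n is the subgroup \<open>WS {1..n}\<close>, and the non-commutative class
  \<open>group_add\<close> supplies the group calculus.\<close>

typedef wgrp = "{w :: word. red w = w}"
  by (rule exI[of _ "[]"]) simp

setup_lifting type_definition_wgrp

lift_definition el :: "word \<Rightarrow> wgrp" is red by simp

abbreviation rep :: "wgrp \<Rightarrow> word" where "rep \<equiv> Rep_wgrp"

instantiation wgrp :: group_add
begin

lift_definition zero_wgrp :: wgrp is "[]" by simp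
lift_definition plus_wgrp :: "wgrp \<Rightarrow> wgrp \<Rightarrow> wgrp" is "\<lambda>u v. red (u @ v)" by simp
lift_definition uminus_wgrp :: "wgrp \<Rightarrow> wgrp" is rev
  by (simp add: red_eq_self_iff)
definition minus_wgrp :: "wgrp \<Rightarrow> wgrp \<Rightarrow> wgrp" where "minus_wgrp x y = x + - y"

instance
proof
  fix x y z :: wgrp
  show "x + y + z = x + (y + z)" by transfer simp
  show "0 + x = x" by transfer simp
  show "- x + x = 0" by transfer simp
  show "x + - y = x - y" by (simp add: minus_wgrp_def)
  show "x + 0 = x" by transfer simp
qed

end

lemma red_rep [simp]: "red (rep x) = rep x"
  using Rep_wgrp by blast

lemma el_rep [simp]: "el (rep x) = x"
  by transfer simp

lemma rep_el: "rep (el w) = red w"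
  by transfer simp

lemma el_eq_iff: "el u = el v \<longleftrightarrow> red u = red v"
  by transfer simp

lemma el_red [simp]: "el (red w) = el w"
  by transfer simp

lemma el_append: "el (u @ v) = el u + el v"
  by transfer simp

lemma el_Nil [simp]: "el [] = 0"
  by transfer simp

lemma el_rev: "el (rev w) = - el w"
  by (metis add_eq_0_iff2 el_Nil el_append el_red red_rev_append)

definition gn :: "nat \<Rightarrow> wgrp" where "gn j = el [j]"

lemma gn_gn [simp]: "gn j + gn j = 0"
  by (metis append_Cons append_Nil el_Nil el_append el_red gn_def red.simps(1) red_Cons_Cons)

lemma minus_gn [simp]: "- gn j = gn j"
  using gn_gn minus_unique by blast

lemma gn_gn_left [simp]: "gn j + (gn j + x) = x"
  by (simp add: add.assoc [symmetric])

lemma el_Cons: "el (j # w) = gn j + el w"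
  using el_append[of "[j]" w] by (simp add: gn_def)

lemma rep_gn [simp]: "rep (gn j) = [j]"
  by (simp add: gn_def rep_el)

lemma gn_neq_0 [simp]: "gn j \<noteq> 0"
  by (metis el_Nil el_eq_iff gn_def list.distinct(1) red.simps(1) rep_el rep_gn)

lemma wgrp_induct [case_names zero gen]:
  assumes "P 0" "\<And>j x. P x \<Longrightarrow> P (gn j + x)"
  shows "P x"
proof -
  have "P (el w)" for w
    by (induction w) (auto simp: el_Cons assms)
  then show ?thesis by (metis el_rep)
qed

subsection \<open>Subgroups on a set of letters\<close>

definition WS :: "nat set \<Rightarrow> wgrp set" where "WS S = {x. set (rep x) \<subseteq> S}"

lemma el_in_WS: "set w \<subseteq> S \<Longrightarrow> el w \<in> WS S"
  using set_red_subset[of w] by (auto simp: WS_def rep_el)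

lemma WS_rep: "x \<in> WS S \<Longrightarrow> set (rep x) \<subseteq> S"
  by (simp add: WS_def)

lemma WS_0 [simp]: "0 \<in> WS S"
  using el_in_WS[of "[]"] by simp

lemma WS_gn [simp]: "gn j \<in> WS S \<longleftrightarrow> j \<in> S"
  by (simp add: WS_def)

lemma WS_add [intro]: "x \<in> WS S \<Longrightarrow> y \<in> WS S \<Longrightarrow> x + y \<in> WS S"
  by (metis WS_rep el_append el_in_WS el_rep le_sup_iff set_append)

lemma WS_minus [intro]: "x \<in> WS S \<Longrightarrow> - x \<in> WS S"
  by (metis WS_rep el_in_WS el_rep el_rev set_rev)

lemma WS_mono: "S \<subseteq> T \<Longrightarrow> WS S \<subseteq> WS T"
  by (auto simp: WS_def)

lemma WS_induct [consumes 1, case_names zero gen]: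
  assumes "x \<in> WS S" "P 0"
    "\<And>j x. j \<in> S \<Longrightarrow> x \<in> WS S \<Longrightarrow> P x \<Longrightarrow> P (gn j + x)"
  shows "P x"
proof -
  have "set w \<subseteq> S \<Longrightarrow> P (el w)" for w
    by (induction w) (auto simp: el_Cons assms(2) intro!: assms(3) el_in_WS)
  then show ?thesis by (metis assms(1) WS_rep el_rep)
qed

lemma Wn_eq: "Wn n = rep ` WS {1..n}"
proof
  show "Wn n \<subseteq> rep ` WS {1..n}"
  proof
    fix w assume "w \<in> Wn n"
    then have "w = rep (el w)" "el w \<in> WS {1..n}"
      by (auto simp: Wn_def rep_el intro: el_in_WS)
    then show "w \<in> rep ` WS {1..n}" by blast
  qed
qed (auto simp: Wn_def WS_def)

subsection \<open>Parity of a letter\<close>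

text \<open>A homomorphism to the group of order two. It ignores the order of the factors, so it can
  be evaluated on expressions with unknown conjugators.\<close>

definition par :: "nat \<Rightarrow> wgrp \<Rightarrow> bool" where "par i x = odd (count_list (rep x) i)"

lemma par_el: "par i (el w) = odd (count_list w i)"
  by (simp add: par_def rep_el even_count_red)

lemma par_add [simp]: "par i (x + y) \<longleftrightarrow> par i x \<noteq> par i y"
  by (metis el_append el_rep par_el count_list_append even_add)

lemma par_0 [simp]: "\<not> par i 0"
  using par_el[of i "[]"] by simp

lemma par_minus [simp]: "par i (- x) = par i x"
  by (metis par_0 par_add add.right_inverse)

lemma par_gn [simp]: "par i (gn j) \<longleftrightarrow> i = j"
  by (auto simp: par_def)

subsection \<open>Centralizers of generators\<close>

text \<open>If the word of \<open>v\<close> is nonempty and does not begin with \<open>j\<close>,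
  prepending \<open>j\<close> keeps it reduced, whereas appending \<open>j\<close> either shortens
  it or leaves its first letter in front; the two results differ. A leading \<open>j\<close> is
  stripped off first.\<close>

lemma centralizer_gn:
  assumes "v + gn j = gn j + v"
  shows "v = 0 \<or> v = gn j"
proof -
  have *: "v = 0" if v: "v + gn j = gn j + v" and hd: "rep v = [] \<or> hd (rep v) \<noteq> j" for v
  proof (rule ccontr)
    assume "v \<noteq> 0"
    then have ne: "rep v \<noteq> []" by (metis el_Nil el_rep)
    have da: "distinct_adj (rep v)" by (simp flip: red_eq_self_iff)
    have "el (rep v @ [j]) = el (j # rep v)"
      using v by (simp add: el_append el_Cons)
    then have eq: "red (rep v @ [j]) = j # rep v"
      using da hd ne by (metis distinct_adj_Cons el_eq_iff red_eq_self_iff)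
    show False
    proof (cases "last (rep v) = j")
      case True
      then have "rep v @ [j] = butlast (rep v) @ j # j # []"
        using ne by (metis append.assoc append_Cons append_Nil append_butlast_last_id)
      then have "red (rep v @ [j]) = red (butlast (rep v))"
        by (metis append_Nil2 red.simps(1) red_Cons_Cons red_append_red_right)
      also have "\<dots> = butlast (rep v)"
        using da by (metis append_butlast_last_id distinct_adj_appendD1 ne red_eq_self_iff)
      finally have "length (butlast (rep v)) = length (j # rep v)" using eq by simp
      then show False by simp
    next
      case False
      then have "distinct_adj (rep v @ [j])"
        using da by (auto simp: distinct_adj_append_iff)
      then show False using eq hd ne by (metis hd_append2 list.sel(1) red_eq_self_iff)
    qed
  qed
  show ?thesis
  proof (cases "rep v = [] \<or> hd (rep v) \<noteq> j")
    case True
    then show ?thesis using * assms by blast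
  next
    case False
    then obtain u where u: "rep v = j # u" by (metis list.exhaust_sel)
    then have da: "distinct_adj (j # u)" by (metis red_eq_self_iff red_rep)
    then have repu: "rep (el u) = u"
      by (metis distinct_adj_ConsD red_eq_self_iff rep_el)
    have v: "v = gn j + el u" using u by (metis el_Cons el_rep)
    then have "gn j + (gn j + el u + gn j) = gn j + (gn j + (gn j + el u))" using assms by simp
    then have "el u + gn j = gn j + el u" by (simp add: add.assoc)
    then have "el u = 0" using * da repu by (auto simp: distinct_adj_Cons)
    then show ?thesis using v by simp
  qed
qed

lemma conj_gn_eqD:
  assumes "- u + gn j + u = - v + gn j + v"
  shows "u + - v = 0 \<or> u + - v = gn j"
proof (rule centralizer_gn)
  have "u + (- u + gn j + u) + - v = u + (- v + gn j + v) + - v" using assms by simp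
  then show "u + - v + gn j = gn j + (u + - v)"
    by (simp add: add.assoc del: add_uminus_conv_diff)
qed

text \<open>A leading \<open>j\<close> of the conjugating word is absorbed by the middle letter, and
  what remains is a reduced palindrome. Its second half is the shortest conjugator, which
  \<open>iota\<close> reads off from the word.\<close>

lemma conj_reduced_form:
  "\<exists>d. distinct_adj (rev d @ [j] @ d) \<and> set d \<subseteq> set c \<and> conjw c j = rev d @ [j] @ d"
proof -
  have "red (rev (red c) @ [j] @ red c) = conjw c j"
  proof -
    have "el (rev (red c) @ [j] @ red c) = el (rev c @ [j] @ c)"
      by (simp add: el_append el_rev del: append_Cons append.simps)
    then show ?thesis by (simp add: el_eq_iff conjw_def)
  qed
  moreover have "\<exists>d. distinct_adj (rev d @ [j] @ d) \<and> set d \<subseteq> set u \<and>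
      red (rev u @ [j] @ u) = rev d @ [j] @ d" if da: "distinct_adj u" for u
  proof (cases "u = [] \<or> hd u \<noteq> j")
    case True
    then have "distinct_adj (rev u @ [j] @ u)"
      using da by (auto simp: distinct_adj_append_iff distinct_adj_Cons last_rev)
    then show ?thesis using red_eq_self_iff by blast
  next
    case False
    then obtain d where u: "u = j # d" by (metis list.exhaust_sel)
    then have "distinct_adj (rev d @ [j] @ d)"
      using da by (auto simp: distinct_adj_append_iff distinct_adj_Cons last_rev)
    moreover have "red (rev u @ [j] @ u) = red (rev d @ [j] @ d)"
      by (simp add: u el_append el_Cons flip: el_eq_iff)
    ultimately show ?thesis using u by (auto simp: red_eq_self_iff intro!: exI[of _ d])
  qed
  ultimately show ?thesis
    using distinct_adj_red[of c] set_red_subset[of c] by (metis order_trans)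
qed

section \<open>Endomorphisms\<close>

text \<open>The relations a_j^2 = 1, imposed on the images of the generators; they make
  \<open>hm e\<close> below a homomorphism whose value can be computed from any word.\<close>

definition adm :: "endo \<Rightarrow> bool" where "adm e \<longleftrightarrow> (\<forall>j. el (e j) + el (e j) = 0)"

definition hm :: "endo \<Rightarrow> wgrp \<Rightarrow> wgrp" where "hm e x = el (concat (map e (rep x)))"

lemma rep_0 [simp]: "rep 0 = []"
  by (metis el_Nil red.simps(1) rep_el)

lemma hm_el:
  assumes "adm e"
  shows "hm e (el w) = el (concat (map e w))"
proof (induction w)
  case (Cons x w)
  have *: "el (e y) + (el (e y) + z) = z" for y z
    using assms by (simp add: adm_def flip: add.assoc)
  have IH: "el (concat (map e (red w))) = el (concat (map e w))"
    using Cons.IH by (simp add: hm_def rep_el)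
  then show ?case
    by (auto simp: hm_def rep_el el_append * IH[symmetric] split: list.split simp del: el_red)
qed (simp add: hm_def)

lemma hm_0 [simp]: "hm e 0 = 0"
  by (simp add: hm_def rep_0)

lemma hm_gn [simp]: "hm e (gn j) = el (e j)"
  by (simp add: hm_def)

lemma hm_add: "adm e \<Longrightarrow> hm e (x + y) = hm e x + hm e y"
  using hm_el[of e "rep x @ rep y"] hm_el[of e "rep x"] hm_el[of e "rep y"]
  by (simp add: el_append)

lemma hm_minus: "adm e \<Longrightarrow> hm e (- x) = - hm e x"
  using hm_add[of e x "- x"] minus_unique[of "hm e x" "hm e (- x)"] by simp

lemma ext_eq: "adm e \<Longrightarrow> ext e w = rep (hm e (el w))"
  by (simp add: ext_def hm_el rep_el)

lemma el_comp: "adm \<phi> \<Longrightarrow> el (comp \<phi> \<psi> j) = hm \<phi> (el (\<psi> j))"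
  by (simp add: comp_def ext_eq)

lemma adm_comp: "adm \<phi> \<Longrightarrow> adm \<psi> \<Longrightarrow> adm (comp \<phi> \<psi>)"
  by (simp add: adm_def[of "comp \<phi> \<psi>"] el_comp flip: hm_add) (simp add: adm_def)

text \<open>Stated for plain functions, so that it also covers composites and conjugated maps that
  are not literally of the form \<open>hm e\<close>.\<close>

lemma additive_eqI:
  fixes f g :: "wgrp \<Rightarrow> wgrp"
  assumes "f 0 = 0" "g 0 = 0" "\<And>x y. f (x + y) = f x + f y" "\<And>x y. g (x + y) = g x + g y"
    and "x \<in> WS S" "\<And>j. j \<in> S \<Longrightarrow> f (gn j) = g (gn j)"
  shows "f x = g x"
  using assms(5) by (induction rule: WS_induct) (simp_all add: assms)

lemma in_WS_UNIV: "x \<in> WS UNIV"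
  by (simp add: WS_def)

lemma hm_comp:
  assumes "adm \<phi>" "adm \<psi>"
  shows "hm (comp \<phi> \<psi>) x = hm \<phi> (hm \<psi> x)"
  by (rule additive_eqI[OF _ _ _ _ in_WS_UNIV])
    (use assms in \<open>simp_all add: hm_add adm_comp el_comp\<close>)

text \<open>With reduced values, equality of functions amounts to equality of the induced
  homomorphisms, so identities in the automorphism group can be written as equations between
  functions.\<close>

definition nice :: "endo \<Rightarrow> bool" where "nice e \<longleftrightarrow> adm e \<and> (\<forall>j. red (e j) = e j)"

lemma nice_adm: "nice e \<Longrightarrow> adm e"
  by (simp add: nice_def)

lemma nice_eq: "nice e \<Longrightarrow> e j = rep (el (e j))"
  by (simp add: nice_def rep_el)

lemma nice_eqI: "nice e \<Longrightarrow> nice e' \<Longrightarrow> (\<And>j. el (e j) = el (e' j)) \<Longrightarrow> e = e'"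
  by (rule HOL.ext) (metis nice_eq)

lemma nice_comp: "nice \<phi> \<Longrightarrow> nice \<psi> \<Longrightarrow> nice (comp \<phi> \<psi>)"
  by (simp add: nice_def adm_comp) (simp add: comp_def ext_def)

lemma comp_assoc:
  assumes "nice a" "nice b" "nice c"
  shows "comp (comp a b) c = comp a (comp b c)"
  by (rule nice_eqI) (use assms in \<open>auto simp: nice_comp nice_adm adm_comp el_comp hm_comp\<close>)

lemma el_idE [simp]: "el (idE j) = gn j"
  by (simp add: idE_def gn_def)

lemma nice_idE [simp]: "nice idE"
  by (simp add: nice_def adm_def) (simp add: idE_def)

lemma hm_idE [simp]: "hm idE x = x"
  by (rule additive_eqI[OF _ _ _ _ in_WS_UNIV]) (simp_all add: hm_add nice_adm)

lemma comp_idE_left [simp]: "nice e \<Longrightarrow> comp idE e = e"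
  by (rule nice_eqI) (auto simp: nice_comp el_comp nice_adm)

lemma comp_idE_right [simp]: "nice e \<Longrightarrow> comp e idE = e"
  by (rule nice_eqI) (auto simp: nice_comp el_comp nice_adm)

section \<open>Partial conjugations and the words they fix\<close>

lemma el_pconj: "el (pconj i D j) = (if j \<in> D then gn i + gn j + gn i else gn j)"
  by (simp add: pconj_def el_Cons gn_def[symmetric] add.assoc)

lemma adm_pconj: "adm (pconj i D)"
  by (simp add: adm_def el_pconj add.assoc)

lemma nice_pconj: "i \<notin> D \<Longrightarrow> nice (pconj i D)"
  by (auto simp: nice_def adm_pconj) (auto simp: pconj_def)

lemma pconj_involution: "i \<notin> D \<Longrightarrow> comp (pconj i D) (pconj i D) = idE"
  by (rule nice_eqI)
    (auto simp: nice_pconj nice_comp adm_pconj el_comp el_pconj hm_add add.assoc)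

lemma hm_pconj_fix: "x \<in> WS (- D) \<Longrightarrow> hm (pconj i D) x = x"
  by (induction rule: WS_induct) (auto simp: hm_add adm_pconj el_pconj)

lemma par_hm_pconj: "par k (hm (pconj i D) x) = par k x"
  by (induction x rule: wgrp_induct) (auto simp: hm_add adm_pconj el_pconj)

lemma split_first_in:
  assumes "\<not> set w \<subseteq> - D"
  obtains p d u where "w = p @ d # u" "set p \<subseteq> - D" "d \<in> D"
proof -
  have "\<exists>x\<in>set w. x \<in> D" using assms by auto
  from split_list_first_prop[OF this] show ?thesis using that by blast
qed

lemma distinct_adj_join:
  assumes "set p \<subseteq> - D" "d \<in> D" "distinct_adj p" "distinct_adj (d # z)"
  shows "distinct_adj (p @ d # z)"
proof -
  have "last p \<noteq> d" if "p \<noteq> []"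
    using assms(1,2) last_in_set[OF that] by blast
  then show ?thesis using assms by (auto simp: distinct_adj_append_iff)
qed

text \<open>A first letter from \<open>D\<close> survives the partial conjugation, but the syllable in front of it
  is multiplied by \<open>a\<^sub>i\<close>.\<close>

lemma hm_pconj_prefix:
  assumes "i \<notin> D" "distinct_adj (p @ d # w)" "set p \<subseteq> - D" "d \<in> D"
  shows "\<exists>z. rep (hm (pconj i D) (el (p @ d # w))) = red (p @ [i]) @ d # z"
  using assms(2-4)
proof (induction w arbitrary: p d rule: length_induct)
  case (1 w)
  let ?h = "hm (pconj i D)"
  have da: "distinct_adj (d # w)" using 1(2) by auto
  \<comment> \<open>This is the tail behind \<open>d\<close> after the map; as it does not begin
    with \<open>d\<close>, that letter is not cancelled from the right. A nonempty tail starts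
    outside \<open>D\<close>, or with the next letter of \<open>w\<close> from \<open>D\<close>,
    which then was adjacent to \<open>d\<close> and differs from it.\<close>
  have "\<exists>z. rep (gn i + ?h (el w)) = z \<and> (z = [] \<or> hd z \<noteq> d)"
  proof (cases "set w \<subseteq> - D")
    case True
    then have "?h (el w) = el w" by (simp add: hm_pconj_fix el_in_WS)
    then have "gn i + ?h (el w) \<in> WS (- D)"
      using True assms(1) by (auto intro: el_in_WS)
    then show ?thesis using 1(4) by (metis Compl_iff WS_rep hd_in_set subset_iff)
  next
    case False
    then obtain q d' w' where w: "w = q @ d' # w'" and q: "set q \<subseteq> - D" "d' \<in> D"
      by (rule split_first_in)
    have "distinct_adj (q @ d' # w')" using da w by (metis distinct_adj_ConsD)
    then obtain z where z: "rep (?h (el w)) = red (q @ [i]) @ d' # z"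
      using 1(1)[rule_format, of w' q d'] w q by auto
    have "gn i + ?h (el w) = el (i # q @ i # d' # z)"
      by (metis z el_rep el_Cons el_append el_red append_assoc append_Cons append_Nil)
    moreover have "red (i # q @ i # d' # z) = red (red (i # q @ [i]) @ (d' # z))"
      by (simp only: red_append_red_left append_Cons append_assoc append_Nil)
    moreover have dz: "distinct_adj (d' # z)"
      using z by (metis distinct_adj_appendD2 red_eq_self_iff red_rep)
    have *: "set (red (i # q @ [i])) \<subseteq> - D"
      using set_red_subset[of "i # q @ [i]"] q assms(1) by auto
    then have "distinct_adj (red (i # q @ [i]) @ (d' # z))"
      using dz distinct_adj_red q(2) by (intro distinct_adj_join)
    ultimately have eq: "rep (gn i + ?h (el w)) = red (i # q @ [i]) @ d' # z"
      by (metis red_eq_self_iff rep_el)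
    show ?thesis
    proof (cases "red (i # q @ [i]) = []")
      case True
      have "q = []"
      proof (rule ccontr)
        assume "q \<noteq> []"
        have "el q = gn i + el (i # q @ [i]) + gn i"
          by (simp add: el_Cons el_append add.assoc gn_def[symmetric])
        also have "el (i # q @ [i]) = 0"
          by (metis True el_Nil el_red)
        finally have "el q = 0" by simp
        then have "red q = []" by (metis el_Nil rep_el red.simps(1))
        moreover have "red q = q"
          using da w by (metis distinct_adj_ConsD distinct_adj_appendD1 red_eq_self_iff)
        ultimately show False using \<open>q \<noteq> []\<close> by simp
      qed
      then have "d \<noteq> d'" using da w by simp
      then show ?thesis unfolding eq True by simp
    next
      case False
      then show ?thesis using eq * 1(4) by (metis Compl_iff hd_append2 hd_in_set subset_iff)
    qed
  qed
  then obtain z where z: "rep (gn i + ?h (el w)) = z" "z = [] \<or> hd z \<noteq> d" by blast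
  have z1: "gn i + ?h (el w) = el z" using z(1) by (metis el_rep)
  have "?h (el (p @ d # w)) = el p + (gn i + gn d + (gn i + ?h (el w)))"
    using 1(3,4) by (simp add: el_append el_Cons hm_add adm_pconj el_pconj hm_pconj_fix el_in_WS add.assoc)
  also have "\<dots> = el (red (p @ [i]) @ d # z)"
    by (simp add: el_append el_Cons add.assoc gn_def[symmetric] z1)
  finally have "rep (?h (el (p @ d # w))) = red (red (p @ [i]) @ d # z)"
    by (simp add: rep_el)
  moreover have "distinct_adj (red (p @ [i]) @ d # z)"
  proof -
    have "set (red (p @ [i])) \<subseteq> - D"
      using set_red_subset[of "p @ [i]"] 1(3) assms(1) by auto
    moreover have "distinct_adj z" using z(1) by (metis red_eq_self_iff red_rep)
    ultimately show ?thesis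
      using z(2) 1(4) distinct_adj_red by (intro distinct_adj_join) (auto simp: distinct_adj_Cons)
  qed
  ultimately show ?case by (metis red_eq_self_iff)
qed

text \<open>If \<open>x\<close> contained a letter of \<open>D\<close>, the part \<open>p\<close> in
  front of the first one would be multiplied by a_i on the right and would still have to equal
  \<open>p\<close>. With \<open>hm_pconj_fix\<close> this determines the fixed subgroup.\<close>

lemma hm_pconj_fixD:
  assumes "i \<notin> D" "hm (pconj i D) x = x"
  shows "x \<in> WS (- D)"
proof (rule ccontr)
  assume "x \<notin> WS (- D)"
  then have "\<not> set (rep x) \<subseteq> - D" by (simp add: WS_def)
  then obtain p d w where x: "rep x = p @ d # w" and p: "set p \<subseteq> - D" "d \<in> D"
    by (rule split_first_in)
  have "distinct_adj (p @ d # w)" by (metis x red_eq_self_iff red_rep)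
  then obtain z where z: "p @ d # w = red (p @ [i]) @ d # z"
    using hm_pconj_prefix[OF assms(1) _ p] assms(2) x by (metis el_rep)
  have "set (red (p @ [i])) \<subseteq> - D"
    using set_red_subset[of "p @ [i]"] p assms(1) by auto
  \<comment> \<open>The part in front of the first letter from \<open>D\<close> is read off on both
    sides.\<close>
  then have "takeWhile (\<lambda>x. x \<notin> D) (red (p @ [i]) @ d # z) = red (p @ [i])"
    using p(2) by (subst takeWhile_append2) auto
  moreover have "takeWhile (\<lambda>x. x \<notin> D) (p @ d # w) = p"
    using p by (subst takeWhile_append2) auto
  ultimately have "p = red (p @ [i])" using z by simp
  then have "el p = el p + gn i"
    by (metis el_append el_red gn_def)
  then have "- el p + el p = - el p + (el p + gn i)" by simp
  then have "0 = gn i" by (simp only: minus_add_cancel left_minus)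
  then show False by simp
qed

section \<open>Generated groups of automorphisms\<close>

lemma gen_nice: "g \<in> gen S \<Longrightarrow> (\<And>a. a \<in> S \<Longrightarrow> nice a) \<Longrightarrow> nice g"
  by (induction rule: gen.induct) (auto intro: nice_comp)

lemma gen_comp:
  assumes "a \<in> gen S" "b \<in> gen S" "\<And>a. a \<in> S \<Longrightarrow> nice a"
  shows "comp a b \<in> gen S"
  using assms(1)
proof (induction rule: gen.induct)
  case gen_id
  then show ?case using assms gen_nice by (metis comp_idE_left)
next
  case (gen_step a g)
  then show ?case using assms gen_nice by (metis comp_assoc gen.gen_step)
qed

lemma gen_incl: "a \<in> S \<Longrightarrow> nice a \<Longrightarrow> a \<in> gen S"
  using gen.gen_step[OF _ gen.gen_id, of a S] by simp

lemma gen_inverse: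
  assumes "g \<in> gen S" "\<And>a. a \<in> S \<Longrightarrow> nice a" "\<And>a. a \<in> S \<Longrightarrow> comp a a = idE"
  shows "\<exists>h\<in>gen S. comp g h = idE \<and> comp h g = idE"
  using assms(1)
proof (induction rule: gen.induct)
  case gen_id
  show ?case by (rule bexI[of _ idE]) (auto intro: gen.gen_id)
next
  case (gen_step a g)
  then obtain h where h: "h \<in> gen S" "comp g h = idE" "comp h g = idE" by blast
  have n: "nice a" "nice g" "nice h" using assms gen_step h gen_nice by blast+
  have "comp (comp a g) (comp h a) = comp a (comp (comp g h) a)"
    using n by (simp add: comp_assoc nice_comp)
  moreover have "comp (comp h a) (comp a g) = comp h (comp (comp a a) g)"
    using n by (simp add: comp_assoc nice_comp)
  ultimately have "comp (comp a g) (comp h a) = idE" "comp (comp h a) (comp a g) = idE"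
    using n h assms(3) gen_step(1) by simp_all
  moreover have "comp h a \<in> gen S"
    using gen_comp[OF h(1) gen_incl] gen_step(1) n assms(2) by blast
  ultimately show ?case by blast
qed

text \<open>Conjugates stay sums such as \<open>x + y + - x\<close>, which \<open>add.assoc\<close>
  can rearrange, instead of turning into differences.\<close>

declare add_uminus_conv_diff [simp del]

subsection \<open>Automorphisms mapping generators to conjugates\<close>

text \<open>\<open>Aut0\<close> without bijectivity: membership can be checked on the generators
  before an inverse is known.\<close>

definition EN :: "nat \<Rightarrow> endo set" where
  "EN n = {e. (\<forall>j. j \<notin> {1..n} \<longrightarrow> e j = [j])
            \<and> (\<forall>j\<in>{1..n}. \<exists>c. set c \<subseteq> {1..n} \<and> e j = conjw c j)}"

lemma el_conjw: "el (conjw c j) = - el c + gn j + el c"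
  by (simp add: conjw_def el_append el_rev el_Cons add.assoc)

lemma EN_out: "e \<in> EN n \<Longrightarrow> j \<notin> {1..n} \<Longrightarrow> el (e j) = gn j"
  by (simp add: EN_def gn_def)

lemma EN_conj: "e \<in> EN n \<Longrightarrow> j \<in> {1..n} \<Longrightarrow> \<exists>c\<in>WS {1..n}. el (e j) = - c + gn j + c"
proof -
  assume "e \<in> EN n" "j \<in> {1..n}"
  then obtain c where "set c \<subseteq> {1..n}" "e j = conjw c j" unfolding EN_def by blast
  then show ?thesis using el_in_WS el_conjw by metis
qed

lemma conj_involution: "- c + gn j + c + (- c + gn j + c) = 0"
  by (simp add: add.assoc)

lemma EN_nice:
  assumes "e \<in> EN n"
  shows "nice e"
proof -
  have "el (e j) + el (e j) = 0" for j
    using EN_out[OF assms] EN_conj[OF assms] conj_involution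
    by (cases "j \<in> {1..n}") (fastforce, simp)
  moreover have "red (e j) = e j" for j
  proof (cases "j \<in> {1..n}")
    case True
    then obtain c where "e j = conjw c j" using assms unfolding EN_def by blast
    then show ?thesis by (simp only: conjw_def red_red)
  next
    case False
    then have "e j = [j]" using assms unfolding EN_def by blast
    then show ?thesis by simp
  qed
  ultimately show ?thesis by (simp add: nice_def adm_def)
qed

lemma EN_I:
  assumes "nice e" "\<And>j. j \<notin> {1..n} \<Longrightarrow> el (e j) = gn j"
    "\<And>j. j \<in> {1..n} \<Longrightarrow> \<exists>c\<in>WS {1..n}. el (e j) = - c + gn j + c"
  shows "e \<in> EN n"
proof -
  have "e j = [j]" if "j \<notin> {1..n}" for j
    using nice_eq[OF assms(1), of j] assms(2)[OF that] by simp
  moreover have "\<exists>c. set c \<subseteq> {1..n} \<and> e j = conjw c j" if j: "j \<in> {1..n}" for j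
  proof -
    obtain c where c: "c \<in> WS {1..n}" "el (e j) = - c + gn j + c" using assms(3)[OF j] by blast
    then have "el (e j) = el (conjw (rep c) j)" by (simp add: el_conjw)
    then have "e j = conjw (rep c) j"
      using nice_eq[OF assms(1), of j] by (simp add: rep_el conjw_def)
    then show ?thesis using WS_rep[OF c(1)] by blast
  qed
  ultimately show ?thesis by (simp add: EN_def)
qed

lemma hm_WS:
  assumes "adm e" "\<And>j. j \<in> S \<Longrightarrow> el (e j) \<in> WS T" "x \<in> WS S"
  shows "hm e x \<in> WS T"
  using assms(3) by (induction rule: WS_induct) (auto simp: hm_add assms(1,2))

lemma EN_WS:
  assumes "e \<in> EN n" "x \<in> WS {1..n}"
  shows "hm e x \<in> WS {1..n}"
proof (rule hm_WS[OF _ _ assms(2)])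
  show "el (e j) \<in> WS {1..n}" if "j \<in> {1..n}" for j
    using EN_conj[OF assms(1) that] that by (auto intro!: WS_add WS_minus)
qed (use assms EN_nice nice_adm in blast)

lemma EN_comp:
  assumes "\<phi> \<in> EN n" "\<psi> \<in> EN n"
  shows "comp \<phi> \<psi> \<in> EN n"
proof (rule EN_I)
  show "nice (comp \<phi> \<psi>)" using assms by (simp add: EN_nice nice_comp)
  have a: "adm \<phi>" using assms by (simp add: EN_nice nice_adm)
  show "el (comp \<phi> \<psi> j) = gn j" if "j \<notin> {1..n}" for j
    using that assms by (simp add: el_comp[OF a] EN_out)
  show "\<exists>c\<in>WS {1..n}. el (comp \<phi> \<psi> j) = - c + gn j + c" if j: "j \<in> {1..n}" for j
  proof -
    obtain c d where c: "c \<in> WS {1..n}" "el (\<psi> j) = - c + gn j + c"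
      and d: "d \<in> WS {1..n}" "el (\<phi> j) = - d + gn j + d"
      using EN_conj[OF assms(1) j] EN_conj[OF assms(2) j] by blast
    have "el (comp \<phi> \<psi> j) = - (d + hm \<phi> c) + gn j + (d + hm \<phi> c)"
      by (simp add: el_comp[OF a] c d hm_add[OF a] hm_minus[OF a] minus_add add.assoc)
    moreover have "d + hm \<phi> c \<in> WS {1..n}" using c d EN_WS[OF assms(1)] by blast
    ultimately show ?thesis by blast
  qed
qed

lemma idE_EN: "idE \<in> EN n"
  by (rule EN_I) (auto intro!: bexI[of _ 0])

lemma Aut0_iff: "e \<in> Aut0 n \<longleftrightarrow> e \<in> EN n \<and> bij_betw (hm e) (WS {1..n}) (WS {1..n})"
proof -
  have "bij_betw (ext e) (Wn n) (Wn n) \<longleftrightarrow> bij_betw (hm e) (WS {1..n}) (WS {1..n})"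
    if "e \<in> EN n"
  proof -
    have a: "adm e" using that by (simp add: EN_nice nice_adm)
    have r: "bij_betw rep (WS {1..n}) (Wn n)"
      unfolding Wn_eq by (auto simp: bij_betw_def inj_on_def Rep_wgrp_inject)
    have "bij_betw (hm e) (WS {1..n}) (WS {1..n}) \<longleftrightarrow> bij_betw (rep \<circ> hm e) (WS {1..n}) (Wn n)"
      by (rule bij_betw_comp_iff2[OF r]) (use EN_WS that in blast)
    also have "rep \<circ> hm e = ext e \<circ> rep" by (auto simp: ext_eq[OF a])
    also have "bij_betw (ext e \<circ> rep) (WS {1..n}) (Wn n) \<longleftrightarrow> bij_betw (ext e) (Wn n) (Wn n)"
      by (rule bij_betw_comp_iff[OF r, symmetric])
    finally show ?thesis by simp
  qed
  moreover have "e \<in> Aut0 n \<longleftrightarrow> e \<in> EN n \<and> bij_betw (ext e) (Wn n) (Wn n)"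
    unfolding Aut0_def EN_def by blast
  ultimately show ?thesis by blast
qed

lemma Aut0_EN: "e \<in> Aut0 n \<Longrightarrow> e \<in> EN n"
  by (simp add: Aut0_iff)

lemma Aut0_nice: "e \<in> Aut0 n \<Longrightarrow> nice e"
  using Aut0_EN EN_nice by blast

lemma Aut0_adm: "e \<in> Aut0 n \<Longrightarrow> adm e"
  using Aut0_nice nice_adm by blast

lemma Aut0_comp:
  assumes "\<phi> \<in> Aut0 n" "\<psi> \<in> Aut0 n"
  shows "comp \<phi> \<psi> \<in> Aut0 n"
proof -
  have "hm (comp \<phi> \<psi>) = hm \<phi> \<circ> hm \<psi>" using assms by (auto simp: hm_comp Aut0_adm)
  moreover have "bij_betw (hm \<phi> \<circ> hm \<psi>) (WS {1..n}) (WS {1..n})"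
    using assms by (intro bij_betw_trans[of _ _ "WS {1..n}"]) (auto simp: Aut0_iff)
  ultimately show ?thesis using assms EN_comp by (metis Aut0_iff)
qed

lemma Aut0_I:
  assumes "e \<in> EN n" "l \<in> EN n" "r \<in> EN n" "comp e r = idE" "comp l e = idE"
  shows "e \<in> Aut0 n"
proof -
  have a: "adm e" "adm l" "adm r" using assms EN_nice nice_adm by blast+
  have le: "hm l (hm e x) = x" for x using hm_comp[OF a(2,1), of x] assms(5) by simp
  have er: "hm e (hm r x) = x" for x using hm_comp[OF a(1,3), of x] assms(4) by simp
  have "inj_on (hm e) (WS {1..n})" by (rule inj_on_inverseI[of _ "hm l"]) (rule le)
  moreover have "hm e ` WS {1..n} = WS {1..n}"
  proof
    show "hm e ` WS {1..n} \<subseteq> WS {1..n}" using EN_WS[OF assms(1)] by blast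
    show "WS {1..n} \<subseteq> hm e ` WS {1..n}" using EN_WS[OF assms(3)] er by (metis image_eqI subsetI)
  qed
  ultimately show ?thesis using assms(1) by (simp add: Aut0_iff bij_betw_def)
qed

lemma Aut0_inverse:
  assumes "e \<in> Aut0 n"
  shows "\<exists>e'\<in>Aut0 n. comp e e' = idE \<and> comp e' e = idE"
proof -
  let ?W = "WS {1..n}"
  have a: "adm e" and e: "e \<in> EN n" and bij: "bij_betw (hm e) ?W ?W"
    using assms by (auto simp: Aut0_iff EN_nice nice_adm)
  note inj = inj_onD[OF bij_betw_imp_inj_on[OF bij]]
  define e' where "e' j = (if j \<in> {1..n} then rep (inv_into ?W (hm e) (gn j)) else [j])" for j
  have inv: "el (e' j) \<in> ?W" "hm e (el (e' j)) = gn j" if "j \<in> {1..n}" for j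
    using that bij bij_betwE[OF bij_betw_inv_into[OF bij]]
    by (auto simp: e'_def bij_betw_inv_into_right)
  have out: "el (e' j) = gn j" if "j \<notin> {1..n}" for j using that by (simp only: e'_def gn_def if_False)
  have cj: "\<exists>c\<in>?W. el (e' j) = - c + gn j + c" if j: "j \<in> {1..n}" for j
  proof -
    obtain c where c: "c \<in> ?W" "el (e j) = - c + gn j + c" using EN_conj[OF e j] by blast
    \<comment> \<open>As \<open>c\<close> is the image of some \<open>d\<close>, the element d a_j
      d^-1 is mapped to a_j. Hence the preimage of a_j is again a conjugate of a_j.\<close>
    then obtain d where d: "d \<in> ?W" "c = hm e d" using bij by (auto simp: bij_betw_def)
    have "hm e (el (e' j)) = hm e (d + gn j + - d)"
      using inv[OF j] c d by (simp add: hm_add[OF a] hm_minus[OF a] add.assoc)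
    moreover have "d + gn j + - d \<in> ?W" using d j by (auto intro!: WS_add WS_minus)
    ultimately have "el (e' j) = - (- d) + gn j + - d"
      using inj inv(1)[OF j] by simp
    then show ?thesis using d(1) by blast
  qed
  have "adm e'"
    unfolding adm_def using out cj conj_involution gn_gn by metis
  then have ne': "nice e'" by (auto simp: nice_def e'_def)
  have e': "e' \<in> EN n" by (rule EN_I[OF ne' out cj])
  have n: "nice e" using e EN_nice by blast
  have 1: "comp e e' = idE"
  proof (rule nice_eqI)
    show "el (comp e e' j) = el (idE j)" for j
      using inv(2) out EN_out[OF e] by (cases "j \<in> {1..n}") (auto simp: el_comp[OF a])
  qed (use n ne' nice_comp in auto)
  have 2: "comp e' e = idE"
  proof (rule nice_eqI)
    show "el (comp e' e j) = el (idE j)" for j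
    proof (cases "j \<in> {1..n}")
      case True
      have "hm e (hm e' (el (e j))) = hm e (gn j)"
        using hm_comp[OF a nice_adm[OF ne']] 1 by (metis hm_gn hm_idE)
      moreover have "hm e' (el (e j)) \<in> ?W"
        using EN_WS[OF e'] EN_WS[OF e, of "gn j"] True by simp
      ultimately show ?thesis using inj True by (simp add: el_comp nice_adm[OF ne'])
    next
      case False
      then show ?thesis using EN_out[OF e] out by (simp add: el_comp nice_adm[OF ne'])
    qed
  qed (use n ne' nice_comp in auto)
  show ?thesis using Aut0_I[OF e' e e 2 1] 1 2 by blast
qed

lemma idE_Aut0: "idE \<in> Aut0 n"
  using Aut0_I[OF idE_EN idE_EN idE_EN] by simp

lemma PC_D: "(i, D) \<in> PC n \<Longrightarrow> i \<in> {1..n} \<and> D \<subseteq> {1..n} \<and> i \<notin> D \<and> D \<noteq> {}"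
  by (auto simp: PC_def)

lemma pconj_EN:
  assumes "i \<in> {1..n}" "D \<subseteq> {1..n}" "i \<notin> D"
  shows "pconj i D \<in> EN n"
proof (rule EN_I[OF nice_pconj[OF assms(3)]])
  fix j assume "j \<in> {1..n}"
  have "el (pconj i D j) = - (if j \<in> D then gn i else 0) + gn j + (if j \<in> D then gn i else 0)"
    by (simp add: el_pconj)
  moreover have "(if j \<in> D then gn i else 0) \<in> WS {1..n}" using assms by simp
  ultimately show "\<exists>c\<in>WS {1..n}. el (pconj i D j) = - c + gn j + c" by blast
qed (use assms in \<open>auto simp: el_pconj\<close>)

lemma pconj_Aut0: "i \<in> {1..n} \<Longrightarrow> D \<subseteq> {1..n} \<Longrightarrow> i \<notin> D \<Longrightarrow> pconj i D \<in> Aut0 n"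
  using Aut0_I[OF pconj_EN pconj_EN pconj_EN] pconj_involution by blast

section \<open>Carried automorphisms and vertices\<close>

definition compat :: "nat set set \<Rightarrow> nat \<Rightarrow> nat set \<Rightarrow> bool" where
  "compat \<Theta> i D \<longleftrightarrow> (\<forall>E\<in>\<Theta>. E \<inter> D = {} \<or> E \<subseteq> insert i D)"

text \<open>A hyperedge violating \<open>compat\<close> is by itself a walk out of \<open>D\<close>
  that misses \<open>i\<close>. Conversely, a walk that starts in \<open>D\<close> and misses
  \<open>i\<close> cannot leave \<open>D\<close> within any of its hyperedges. From here on single
  hyperedges replace walks in questions of carrying.\<close>

lemma carries_iff_compat:
  assumes \<Theta>: "\<And>E. E \<in> \<Theta> \<Longrightarrow> E \<subseteq> {1..n}" and i: "i \<notin> D"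
  shows "carries n \<Theta> i D \<longleftrightarrow> compat \<Theta> i D"
proof
  assume c: "carries n \<Theta> i D"
  show "compat \<Theta> i D"
    unfolding compat_def
  proof (rule ballI, rule ccontr)
    fix E assume E: "E \<in> \<Theta>" and "\<not> (E \<inter> D = {} \<or> E \<subseteq> insert i D)"
    then obtain d j where dj: "d \<in> E" "d \<in> D" "j \<in> E" "j \<noteq> i" "j \<notin> D" by auto
    then have "simple_walk \<Theta> [d, j] [E]" using E by (auto simp: simple_walk_def)
    moreover have "j \<in> {1..n} - (D \<union> {i})" using dj \<Theta>[OF E] by auto
    ultimately have "i \<in> set [d, j]"
      using c dj(2) unfolding carries_def by (metis last.simps list.sel(1) list.distinct(1))
    then show False using dj i by auto
  qed
next
  assume r: "compat \<Theta> i D"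
  show "carries n \<Theta> i D"
    unfolding carries_def
  proof (intro ballI allI impI, elim conjE, rule ccontr)
    fix d j vs es
    assume d: "d \<in> D" "j \<in> {1..n} - (D \<union> {i})" "simple_walk \<Theta> vs es" "hd vs = d" "last vs = j"
      and i: "i \<notin> set vs"
    have "m < length vs \<Longrightarrow> vs ! m \<in> D" for m
    proof (induction m)
      case 0
      then show ?case using d by (simp add: hd_conv_nth)
    next
      case (Suc m)
      then have "m < length es" using d(3) by (simp add: simple_walk_def)
      then have "es ! m \<in> \<Theta>" "vs ! m \<in> es ! m" "vs ! Suc m \<in> es ! m"
        using d(3) by (auto simp: simple_walk_def)
      moreover have "vs ! Suc m \<noteq> i" using Suc.prems i by auto
      ultimately show ?case using r Suc unfolding compat_def by fastforce
    qed
    moreover have "vs \<noteq> []" using d(3) by (auto simp: simple_walk_def)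
    ultimately have "last vs \<in> D" by (simp add: last_conv_nth)
    then show False using d by simp
  qed
qed

lemma CarG_eq:
  assumes "\<And>E. E \<in> \<Theta> \<Longrightarrow> E \<subseteq> {1..n}"
  shows "CarG n \<Theta> = gen {pconj i D | i D. (i, D) \<in> PC n \<and> compat \<Theta> i D}"
proof -
  have "carries n \<Theta> i D \<longleftrightarrow> compat \<Theta> i D" if "(i, D) \<in> PC n" for i D
    using carries_iff_compat[OF assms] PC_D[OF that] by blast
  then have "{pconj i D | i D. (i, D) \<in> PC n \<and> carries n \<Theta> i D}
      = {pconj i D | i D. (i, D) \<in> PC n \<and> compat \<Theta> i D}" by blast
  then show ?thesis by (simp only: CarG_def)
qed

lemma HT_edge: "\<Theta> \<in> HT n \<Longrightarrow> E \<in> \<Theta> \<Longrightarrow> E \<subseteq> {1..n}"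
  by (simp add: HT_def)

lemma CarG_generator_nice:
  "a \<in> {pconj i D | i D. (i, D) \<in> PC n \<and> P i D} \<Longrightarrow> nice a"
  using PC_D nice_pconj by blast

lemma CarG_nice: "\<pi> \<in> CarG n \<Theta> \<Longrightarrow> nice \<pi>"
  unfolding CarG_def by (rule gen_nice) (auto dest: PC_D intro: nice_pconj)

lemma CarG_id: "idE \<in> CarG n \<Theta>"
  unfolding CarG_def by (rule gen.gen_id)

lemma CarG_comp: "a \<in> CarG n \<Theta> \<Longrightarrow> b \<in> CarG n \<Theta> \<Longrightarrow> comp a b \<in> CarG n \<Theta>"
  unfolding CarG_def by (rule gen_comp) (auto dest: PC_D intro: nice_pconj)

lemma CarG_inverse:
  assumes "g \<in> CarG n \<Theta>"
  shows "\<exists>h\<in>CarG n \<Theta>. comp g h = idE \<and> comp h g = idE"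
  using assms unfolding CarG_def
  by (rule gen_inverse) (auto dest: PC_D intro: nice_pconj pconj_involution)

lemma CarG_pconj:
  assumes "\<And>E. E \<in> \<Theta> \<Longrightarrow> E \<subseteq> {1..n}" "(i, D) \<in> PC n" "compat \<Theta> i D"
  shows "pconj i D \<in> CarG n \<Theta>"
proof -
  have "pconj i D \<in> gen {pconj i D | i D. (i, D) \<in> PC n \<and> compat \<Theta> i D}"
    by (rule gen_incl) (use assms(2,3) PC_D nice_pconj in blast)+
  then show ?thesis using CarG_eq[of \<Theta> n] assms(1) by simp
qed

lemma CarG_EN: "\<pi> \<in> CarG n \<Theta> \<Longrightarrow> \<pi> \<in> EN n"
  unfolding CarG_def
proof (induction rule: gen.induct)
  case (gen_step a g)
  then obtain i D where "a = pconj i D" "(i, D) \<in> PC n" by blast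
  then have "a \<in> EN n" using pconj_EN[of i n D] PC_D[of i D n] by simp
  then show ?case by (rule EN_comp[OF _ gen_step.IH])
qed (rule idE_EN)

lemma CarG_Aut0: "\<pi> \<in> CarG n \<Theta> \<Longrightarrow> \<pi> \<in> Aut0 n"
proof -
  assume \<pi>: "\<pi> \<in> CarG n \<Theta>"
  then obtain h where h: "h \<in> CarG n \<Theta>" "comp \<pi> h = idE" "comp h \<pi> = idE"
    using CarG_inverse by blast
  show ?thesis by (rule Aut0_I[OF CarG_EN[OF \<pi>] CarG_EN[OF h(1)] CarG_EN[OF h(1)] h(2,3)])
qed

text \<open>On one hyperedge a carried x_{i,D} acts as conjugation by 1 or by a_i, because a_i
  commutes with itself; under composition the conjugators combine to
  \<open>u + hm a w\<close>.\<close>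

lemma CarG_edge_conj:
  assumes \<Theta>: "\<And>E. E \<in> \<Theta> \<Longrightarrow> E \<subseteq> {1..n}" and "\<pi> \<in> CarG n \<Theta>" "E \<in> \<Theta>"
  shows "\<exists>w. \<forall>j\<in>E. el (\<pi> j) = - w + gn j + w"
proof -
  have "\<pi> \<in> gen {pconj i D | i D. (i, D) \<in> PC n \<and> compat \<Theta> i D}"
    using assms(2) CarG_eq[OF \<Theta>] by simp
  then show ?thesis
  proof (induction rule: gen.induct)
    case gen_id
    show ?case by (rule exI[of _ 0]) simp
  next
    case (gen_step a g)
    then obtain i D where a: "a = pconj i D" "compat \<Theta> i D" by blast
    obtain w where w: "\<forall>j\<in>E. el (g j) = - w + gn j + w" using gen_step by blast
    define u where "u = (if E \<inter> D = {} then 0 else gn i)"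
    have u: "el (a j) = - u + gn j + u" if "j \<in> E" for j
    proof (cases "E \<inter> D = {}")
      case True
      then show ?thesis using that by (auto simp: a u_def el_pconj)
    next
      case False
      then have "j = i \<or> j \<in> D" using a(2) assms(3) that unfolding compat_def by blast
      then show ?thesis using False by (auto simp: a u_def el_pconj)
    qed
    have "adm a" by (simp add: a adm_pconj)
    then have "el (comp a g j) = - (u + hm a w) + gn j + (u + hm a w)" if "j \<in> E" for j
      using u w that by (simp add: el_comp hm_add hm_minus add.assoc minus_add)
    then show ?case by blast
  qed
qed

section \<open>Carried automorphisms under folding\<close>

lemma fold_step_compat:
  assumes "fold_step \<Lambda> \<Theta>" "compat \<Theta> i D"
  shows "compat \<Lambda> i D"
proof -
  obtain E1 E2 where E: "\<Theta> = (\<Lambda> - {E1, E2}) \<union> {E1 \<union> E2}" using assms(1) by (auto simp: fold_step_def)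
  have "(E1 \<union> E2) \<inter> D = {} \<or> E1 \<union> E2 \<subseteq> insert i D" using assms(2) E by (auto simp: compat_def)
  moreover have "F = E1 \<or> F = E2 \<or> F \<in> \<Theta>" if "F \<in> \<Lambda>" for F using that E by blast
  ultimately show ?thesis using assms(2) unfolding compat_def by blast
qed

lemma ht_le_compat: "ht_le \<Theta> \<Lambda> \<Longrightarrow> compat \<Theta> i D \<Longrightarrow> compat \<Lambda> i D"
  unfolding ht_le_def
  by (induction rule: rtranclp_induct) (auto intro: fold_step_compat)

lemma gen_mono: "S \<subseteq> T \<Longrightarrow> g \<in> gen S \<Longrightarrow> g \<in> gen T"
  by (erule gen.induct) (auto intro: gen.intros)

lemma CarG_mono:
  assumes "ht_le \<Theta> \<Lambda>" "\<Theta> \<in> HT n" "\<Lambda> \<in> HT n"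
  shows "CarG n \<Theta> \<subseteq> CarG n \<Lambda>"
proof -
  let ?S = "\<lambda>\<Theta>. {pconj i D | i D. (i, D) \<in> PC n \<and> compat \<Theta> i D}"
  have "?S \<Theta> \<subseteq> ?S \<Lambda>"
    using ht_le_compat[OF assms(1)] by blast
  then have "gen (?S \<Theta>) \<subseteq> gen (?S \<Lambda>)"
    using gen_mono by blast
  moreover have "CarG n \<Theta> = gen (?S \<Theta>)" "CarG n \<Lambda> = gen (?S \<Lambda>)"
    by (rule CarG_eq[OF HT_edge]; use assms in simp)+
  ultimately show ?thesis by simp
qed

section \<open>Vertices as cosets, their order and the action\<close>

lemma mem_cls: "(\<beta>, \<Lambda>) \<in> cls n \<alpha> \<Theta> \<longleftrightarrow> \<Lambda> = \<Theta> \<and> (\<exists>\<pi>\<in>CarG n \<Theta>. \<beta> = comp \<alpha> \<pi>)"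
  by (auto simp: cls_def)

lemma self_mem_cls: "nice \<alpha> \<Longrightarrow> (\<alpha>, \<Theta>) \<in> cls n \<alpha> \<Theta>"
  using CarG_id by (force simp: mem_cls)

lemma cls_comp_CarG:
  assumes "nice \<alpha>" "\<pi> \<in> CarG n \<Theta>"
  shows "cls n (comp \<alpha> \<pi>) \<Theta> = cls n \<alpha> \<Theta>"
proof -
  have n: "nice \<pi>" using CarG_nice assms by blast
  obtain \<pi>' where \<pi>': "\<pi>' \<in> CarG n \<Theta>" "comp \<pi> \<pi>' = idE" using CarG_inverse assms by blast
  have "comp (comp \<alpha> \<pi>) \<rho> = comp \<alpha> (comp \<pi> \<rho>)" if "\<rho> \<in> CarG n \<Theta>" for \<rho>
    using comp_assoc assms(1) n CarG_nice[OF that] by blast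
  moreover have "comp \<alpha> \<rho> = comp (comp \<alpha> \<pi>) (comp \<pi>' \<rho>)" if "\<rho> \<in> CarG n \<Theta>" for \<rho>
  proof -
    have n': "nice \<pi>'" "nice \<rho>" using CarG_nice \<pi>' that by blast+
    have "comp (comp \<alpha> \<pi>) (comp \<pi>' \<rho>) = comp \<alpha> (comp (comp \<pi> \<pi>') \<rho>)"
      using assms(1) n n' by (simp add: comp_assoc nice_comp)
    then show ?thesis using \<pi>' n' by simp
  qed
  ultimately have "(\<beta>, \<Lambda>) \<in> cls n (comp \<alpha> \<pi>) \<Theta> \<longleftrightarrow> (\<beta>, \<Lambda>) \<in> cls n \<alpha> \<Theta>" for \<beta> \<Lambda>
    unfolding mem_cls using CarG_comp assms(2) \<pi>'(1) by metis
  then show ?thesis by auto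
qed

lemma cls_eq_iff:
  assumes "nice \<alpha>" "nice \<beta>"
  shows "cls n \<alpha> \<Theta> = cls n \<beta> \<Lambda> \<longleftrightarrow> \<Theta> = \<Lambda> \<and> (\<exists>\<pi>\<in>CarG n \<Theta>. \<beta> = comp \<alpha> \<pi>)"
  using self_mem_cls[OF assms(2)] cls_comp_CarG[OF assms(1)] by (metis mem_cls)

text \<open>The order does not depend on representatives: a change of the smaller vertex is carried
  by \<Theta>, hence by \<Lambda> through \<open>CarG_mono\<close>, and is absorbed into the
  coset.\<close>

lemma leK_iff:
  assumes "\<alpha> \<in> Aut0 n" "\<beta> \<in> Aut0 n" "\<Theta> \<in> HT n" "\<Lambda> \<in> HT n"
  shows "leK n (cls n \<alpha> \<Theta>) (cls n \<beta> \<Lambda>) \<longleftrightarrow> ht_le \<Theta> \<Lambda> \<and> (\<exists>\<pi>\<in>CarG n \<Lambda>. \<beta> = comp \<alpha> \<pi>)"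
proof
  assume "leK n (cls n \<alpha> \<Theta>) (cls n \<beta> \<Lambda>)"
  then obtain \<alpha>' \<Theta>' \<beta>' \<Lambda>' \<pi> where *: "\<alpha>' \<in> Aut0 n" "\<beta>' \<in> Aut0 n"
    "cls n \<alpha> \<Theta> = cls n \<alpha>' \<Theta>'" "cls n \<beta> \<Lambda> = cls n \<beta>' \<Lambda>'" "ht_le \<Theta>' \<Lambda>'"
    "\<pi> \<in> CarG n \<Lambda>'" "\<beta>' = comp \<alpha>' \<pi>" by (auto simp: leK_def)
  have n: "nice \<alpha>" "nice \<beta>" "nice \<alpha>'" "nice \<beta>'" using assms * Aut0_nice by blast+
  obtain \<rho> where \<rho>: "\<Theta> = \<Theta>'" "\<rho> \<in> CarG n \<Theta>" "\<alpha>' = comp \<alpha> \<rho>"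
    using *(3) cls_eq_iff[OF n(1,3)] by blast
  obtain \<sigma> where \<sigma>: "\<Lambda>' = \<Lambda>" "\<sigma> \<in> CarG n \<Lambda>" "\<beta> = comp \<beta>' \<sigma>"
    using *(4) cls_eq_iff[OF n(4,2)] by metis
  have "\<rho> \<in> CarG n \<Lambda>" using CarG_mono[of \<Theta> \<Lambda> n] * \<rho> \<sigma> assms by blast
  moreover from this have "\<beta> = comp \<alpha> (comp \<rho> (comp \<pi> \<sigma>))"
    using * \<rho> \<sigma> n(1) CarG_nice by (simp add: comp_assoc nice_comp)
  ultimately show "ht_le \<Theta> \<Lambda> \<and> (\<exists>\<pi>\<in>CarG n \<Lambda>. \<beta> = comp \<alpha> \<pi>)"
    using * \<rho> \<sigma> CarG_comp by metis
next
  assume "ht_le \<Theta> \<Lambda> \<and> (\<exists>\<pi>\<in>CarG n \<Lambda>. \<beta> = comp \<alpha> \<pi>)"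
  then show "leK n (cls n \<alpha> \<Theta>) (cls n \<beta> \<Lambda>)"
    unfolding leK_def using assms by blast
qed

lemma actK_cls:
  assumes "nice \<phi>" "nice \<alpha>"
  shows "actK \<phi> (cls n \<alpha> \<Theta>) = cls n (comp \<phi> \<alpha>) \<Theta>"
proof -
  have "comp (comp \<phi> \<alpha>) \<pi> = comp \<phi> (comp \<alpha> \<pi>)" if "\<pi> \<in> CarG n \<Theta>" for \<pi>
    using assms CarG_nice that by (simp add: comp_assoc)
  then show ?thesis unfolding actK_def cls_def by force
qed

lemma VK_D: "v \<in> VK n \<Longrightarrow> \<exists>\<alpha>\<in>Aut0 n. \<exists>\<Theta>\<in>HT n. v = cls n \<alpha> \<Theta>"
  by (auto simp: VK_def)

section \<open>The embedding of automorphisms\<close>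

lemma iota_conj:
  assumes "\<alpha> \<in> EN 4"
  obtains C where "C \<in> WS {1..4}" "el (\<alpha> 1) = - C + gn 1 + C"
    "\<And>j. el (iota n \<alpha> j) = (if j \<in> {5..n} then - C + gn j + C else el (\<alpha> j))"
proof -
  have "(1::nat) \<in> {1..4}" by simp
  then obtain c where c: "set c \<subseteq> {1..4}" "\<alpha> 1 = conjw c 1"
    using assms unfolding EN_def by blast
  then obtain d where d: "set d \<subseteq> {1..4}" "\<alpha> 1 = rev d @ [1] @ d"
    using conj_reduced_form[of 1 c] by (metis order_trans)
  \<comment> \<open>The palindrome has length \<open>2 * length d + 1\<close>, so cutting off half
    of it, rounded down, and the middle letter leaves \<open>d\<close>.\<close>
  then have "drop (length (\<alpha> 1) div 2 + 1) (\<alpha> 1) = d" by simp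
  then have "el (iota n \<alpha> j) = (if j \<in> {5..n} then - el d + gn j + el d else el (\<alpha> j))" for j
    by (simp add: iota_def el_conjw)
  moreover have "el (\<alpha> 1) = - el d + gn 1 + el d"
    unfolding d(2) by (simp add: el_append el_rev el_Cons add.assoc)
  ultimately show ?thesis using that el_in_WS[OF d(1)] by blast
qed

lemma iota_EN:
  assumes "\<alpha> \<in> EN 4" "n \<ge> 5"
  shows "iota n \<alpha> \<in> EN n"
proof -
  obtain C where C: "C \<in> WS {1..4}" 
    "\<And>j. el (iota n \<alpha> j) = (if j \<in> {5..n} then - C + gn j + C else el (\<alpha> j))"
    using iota_conj[OF assms(1)] by metis
  have sub: "WS {1..4} \<subseteq> WS {1..n}" using assms(2) by (intro WS_mono) auto
  have n: "nice \<alpha>" using assms EN_nice by blast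
  have "adm (iota n \<alpha>)"
    unfolding adm_def C(2) using nice_adm[OF n] conj_involution by (simp add: adm_def)
  moreover have "red (iota n \<alpha> j) = iota n \<alpha> j" for j
    using n by (simp add: iota_def conjw_def nice_def)
  ultimately have "nice (iota n \<alpha>)" by (simp add: nice_def)
  then show ?thesis
  proof (rule EN_I)
    show "el (iota n \<alpha> j) = gn j" if "j \<notin> {1..n}" for j
      using that assms(2) EN_out[OF assms(1), of j] by (auto simp: C(2))
    show "\<exists>c\<in>WS {1..n}. el (iota n \<alpha> j) = - c + gn j + c" if j: "j \<in> {1..n}" for j
    proof (cases "j \<in> {5..n}")
      case True
      then show ?thesis using C sub by auto
    next
      case False
      then have "j \<in> {1..4}" using j by auto
      then obtain c where "c \<in> WS {1..4}" "el (\<alpha> j) = - c + gn j + c"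
        using EN_conj[OF assms(1)] by blast
      then show ?thesis using False sub by (auto simp: C(2))
    qed
  qed
qed

lemma hm_iota:
  assumes "\<alpha> \<in> EN 4" "n \<ge> 5" "x \<in> WS {1..4}"
  shows "hm (iota n \<alpha>) x = hm \<alpha> x"
proof (rule additive_eqI[OF _ _ _ _ assms(3)])
  show "hm (iota n \<alpha>) (gn j) = hm \<alpha> (gn j)" if "j \<in> {1..4}" for j
    using that by (simp add: iota_def)
qed (simp_all add: hm_add nice_adm[OF EN_nice[OF iota_EN[OF assms(1,2)]]]
    nice_adm[OF EN_nice[OF assms(1)]])

lemma iota_idE: "iota n idE = idE"
  by (rule HOL.ext) (simp add: iota_def idE_def conjw_def)

text \<open>The product conjugates the leaves by \<open>A + hm \<alpha> B\<close>, whereas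
  \<open>iota\<close> of the composite uses the shortest conjugator \<open>C\<close>. Both send a_1
  to the same element, so by the centralizer of a_1 they agree up to a left factor a_1, which on the
  leaves amounts to x_{1,F}.\<close>

lemma iota_comp:
  assumes "\<alpha> \<in> EN 4" "\<beta> \<in> EN 4" "n \<ge> 5"
  shows "\<exists>\<epsilon>\<in>{idE, pconj 1 {5..n}}. comp (iota n \<alpha>) (iota n \<beta>) = comp (iota n (comp \<alpha> \<beta>)) \<epsilon>"
proof -
  have ab: "comp \<alpha> \<beta> \<in> EN 4" using assms EN_comp by blast
  have a: "adm \<alpha>" "adm (iota n \<alpha>)" "adm (iota n (comp \<alpha> \<beta>))"
    using assms ab iota_EN EN_nice nice_adm by blast+
  obtain A where A: "A \<in> WS {1..4}" "el (\<alpha> 1) = - A + gn 1 + A"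
    "\<And>j. el (iota n \<alpha> j) = (if j \<in> {5..n} then - A + gn j + A else el (\<alpha> j))"
    using iota_conj[OF assms(1)] by metis
  obtain B where B: "B \<in> WS {1..4}" "el (\<beta> 1) = - B + gn 1 + B"
    "\<And>j. el (iota n \<beta> j) = (if j \<in> {5..n} then - B + gn j + B else el (\<beta> j))"
    using iota_conj[OF assms(2)] by metis
  obtain C where C: "C \<in> WS {1..4}" "el (comp \<alpha> \<beta> 1) = - C + gn 1 + C"
    "\<And>j. el (iota n (comp \<alpha> \<beta>) j) = (if j \<in> {5..n} then - C + gn j + C else el (comp \<alpha> \<beta> j))"
    using iota_conj[OF ab] by metis
  define X where "X = A + hm \<alpha> B"
  have "- X + gn 1 + X = - C + gn 1 + C"
    unfolding C(2)[symmetric] using a A B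
    by (simp add: X_def el_comp hm_add hm_minus minus_add add.assoc)
  then have XC: "X + - C = 0 \<or> X + - C = gn 1" by (rule conj_gn_eqD)
  define \<epsilon> where "\<epsilon> = (if X + - C = 0 then idE else pconj 1 {5..n})"
  have n\<epsilon>: "nice \<epsilon>" by (simp add: \<epsilon>_def nice_pconj)
  have eq: "X = (if X + - C = 0 then C else gn 1 + C)"
  proof -
    have "X = (X + - C) + C" by (simp add: add.assoc)
    then show ?thesis using XC by auto
  qed
  have "el (comp (iota n \<alpha>) (iota n \<beta>) j) = el (comp (iota n (comp \<alpha> \<beta>)) \<epsilon> j)" for j
  proof (cases "j \<in> {5..n}")
    case True
    have "el (comp (iota n \<alpha>) (iota n \<beta>) j) = - X + gn j + X"
      using True a A(3) B hm_iota[OF assms(1,3) B(1)]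
      by (simp add: X_def el_comp hm_add hm_minus minus_add add.assoc)
    moreover have "el (comp (iota n (comp \<alpha> \<beta>)) \<epsilon> j)
        = - (if X + - C = 0 then C else gn 1 + C) + gn j + (if X + - C = 0 then C else gn 1 + C)"
      using True a C by (simp add: \<epsilon>_def el_comp hm_add hm_minus minus_add add.assoc el_pconj)
    ultimately show ?thesis using eq by simp
  next
    case F: False
    have "el (comp (iota n \<alpha>) (iota n \<beta>) j) = el (comp \<alpha> \<beta> j)"
    proof (cases "j \<in> {1..4}")
      case True
      then have "el (\<beta> j) \<in> WS {1..4}" using EN_WS[OF assms(2), of "gn j"] by simp
      then show ?thesis
        by (simp only: el_comp a B(3) F if_False hm_iota[OF assms(1,3)])
    next
      case False
      then have "el (iota n \<beta> j) = gn j" "el (\<beta> j) = gn j" "el (iota n \<alpha> j) = gn j" "el (\<alpha> j) = gn j"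
        by (simp_all only: A(3) B(3) F if_False EN_out[OF assms(1) False] EN_out[OF assms(2) False])
      then show ?thesis using a by (simp add: el_comp)
    qed
    moreover have "el (\<epsilon> j) = gn j" using F by (auto simp: \<epsilon>_def el_pconj)
    then have "el (comp (iota n (comp \<alpha> \<beta>)) \<epsilon> j) = el (comp \<alpha> \<beta> j)"
      by (simp only: el_comp[OF a(3)] hm_gn C(3) F if_False)
    ultimately show ?thesis by simp
  qed
  then have "comp (iota n \<alpha>) (iota n \<beta>) = comp (iota n (comp \<alpha> \<beta>)) \<epsilon>"
    using assms ab n\<epsilon> iota_EN EN_nice nice_comp by (intro nice_eqI) blast+
  moreover have "\<epsilon> \<in> {idE, pconj 1 {5..n}}" by (simp add: \<epsilon>_def)
  ultimately show ?thesis by blast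
qed

lemma twist_EN: "n \<ge> 5 \<Longrightarrow> \<epsilon> \<in> {idE, pconj 1 {5..n}} \<Longrightarrow> \<epsilon> \<in> EN n"
  using idE_EN pconj_EN[of 1 n "{5..n}"] by auto

lemma twist_involution: "\<epsilon> \<in> {idE, pconj 1 {5..n}} \<Longrightarrow> comp \<epsilon> \<epsilon> = idE"
  using pconj_involution[of 1 "{5..n}"] by auto

text \<open>The image of the inverse automorphism inverts \<open>iota n \<alpha>\<close> up to a
  twist on either side; the twists are involutions, so composing with them once more yields a right
  and a left inverse.\<close>

lemma iota_Aut0:
  assumes "\<alpha> \<in> Aut0 4" "n \<ge> 5"
  shows "iota n \<alpha> \<in> Aut0 n"
proof -
  obtain \<alpha>' where \<alpha>': "\<alpha>' \<in> Aut0 4" "comp \<alpha> \<alpha>' = idE" "comp \<alpha>' \<alpha> = idE"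
    using Aut0_inverse[OF assms(1)] by blast
  note en = Aut0_EN[OF assms(1)] Aut0_EN[OF \<alpha>'(1)]
  note ien = iota_EN[OF en(1) assms(2)] iota_EN[OF en(2) assms(2)]
  obtain \<epsilon> where \<epsilon>: "\<epsilon> \<in> {idE, pconj 1 {5..n}}" "comp (iota n \<alpha>) (iota n \<alpha>') = comp idE \<epsilon>"
    using iota_comp[OF en assms(2)] \<alpha>' iota_idE by metis
  obtain \<delta> where \<delta>: "\<delta> \<in> {idE, pconj 1 {5..n}}" "comp (iota n \<alpha>') (iota n \<alpha>) = comp idE \<delta>"
    using iota_comp[OF en(2,1) assms(2)] \<alpha>' iota_idE by metis
  note tw = twist_EN[OF assms(2) \<epsilon>(1)] twist_EN[OF assms(2) \<delta>(1)]
  note n = EN_nice[OF ien(1)] EN_nice[OF ien(2)] EN_nice[OF tw(1)] EN_nice[OF tw(2)]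
  show ?thesis
  proof (rule Aut0_I[OF ien(1) EN_comp[OF tw(2) ien(2)] EN_comp[OF ien(2) tw(1)]])
    show "comp (iota n \<alpha>) (comp (iota n \<alpha>') \<epsilon>) = idE"
      using \<epsilon> n twist_involution[OF \<epsilon>(1)] by (simp flip: comp_assoc)
    show "comp (comp \<delta> (iota n \<alpha>')) (iota n \<alpha>) = idE"
      using \<delta> n twist_involution[OF \<delta>(1)] by (simp add: comp_assoc)
  qed
qed

section \<open>Extended hypertrees and the automorphisms they carry\<close>

lemma tildeHT_edge:
  "E \<in> tildeHT n \<Theta> \<longleftrightarrow> E \<in> \<Theta> \<or> (\<exists>f\<in>{5..n}. E = {1, f})"
  by (auto simp: tildeHT_def)

lemma tildeHT_subset:
  assumes "\<And>E. E \<in> \<Theta> \<Longrightarrow> E \<subseteq> {1..4}" "n \<ge> 5" "E \<in> tildeHT n \<Theta>"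
  shows "E \<subseteq> {1..n}"
proof (cases "E \<in> \<Theta>")
  case True
  then have "E \<subseteq> {1..4}" using assms(1) by blast
  also have "\<dots> \<subseteq> {1..n}" using assms(2) by auto
  finally show ?thesis .
qed (use assms(2,3) in \<open>auto simp: tildeHT_edge\<close>)

text \<open>The only hyperedge at a leaf \<open>f\<close> is \<open>{1, f}\<close>, so any set of
  leaves may be conjugated by a_1 independently of the rest.\<close>

lemma leaf_twist_CarG:
  assumes \<Theta>: "\<And>E. E \<in> \<Theta> \<Longrightarrow> E \<subseteq> {1..4}" and "n \<ge> 5" "D \<subseteq> {5..n}" "D \<noteq> {}"
  shows "pconj 1 D \<in> CarG n (tildeHT n \<Theta>)"
proof (rule CarG_pconj[OF tildeHT_subset[OF \<Theta> assms(2)]])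
  show "(1, D) \<in> PC n" using assms by (auto simp: PC_def)
  show "compat (tildeHT n \<Theta>) 1 D"
    unfolding compat_def
  proof
    fix E assume "E \<in> tildeHT n \<Theta>"
    then consider "E \<in> \<Theta>" | f where "E = {1, f}" "f \<in> {5..n}" by (auto simp: tildeHT_edge)
    then show "E \<inter> D = {} \<or> E \<subseteq> insert 1 D"
    proof cases
      case 1
      then have "E \<inter> {5..n} = {}" using \<Theta> by force
      then show ?thesis using assms(3) by blast
    next
      case 2
      then show ?thesis using assms(3) by force
    qed
  qed
qed

lemma twist_CarG:
  assumes "\<And>E. E \<in> \<Theta> \<Longrightarrow> E \<subseteq> {1..4}" "n \<ge> 5" "\<epsilon> \<in> {idE, pconj 1 {5..n}}"
  shows "\<epsilon> \<in> CarG n (tildeHT n \<Theta>)"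
  using assms(3) CarG_id leaf_twist_CarG[of \<Theta> n "{5..n}"] assms(1,2) by auto

text \<open>The leaves follow the vertex 1 to which they are attached: for \<open>1 \<in> D\<close>
  the conjugator of a_1 is a_i, and \<open>iota\<close> applies it to every leaf as well.\<close>

lemma iota_pconj:
  assumes "(i, D) \<in> PC 4"
  shows "iota n (pconj i D) = pconj i (if 1 \<in> D then D \<union> {5..n} else D)"
proof (rule HOL.ext)
  fix j
  have *: "i \<in> {1..4}" "D \<subseteq> {1..4}" using PC_D[OF assms] by auto
  have "j \<notin> D" if "j \<in> {5..n}" using * that by auto
  moreover have "i \<noteq> j" if "j \<in> {5..n}" using * that by auto
  ultimately show "iota n (pconj i D) j = pconj i (if 1 \<in> D then D \<union> {5..n} else D) j"
    by (auto simp: iota_def pconj_def conjw_def)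
qed

lemma iota_pconj_CarG:
  assumes \<Theta>: "\<And>E. E \<in> \<Theta> \<Longrightarrow> E \<subseteq> {1..4}" and "n \<ge> 5" "(i, D) \<in> PC 4" "compat \<Theta> i D"
  shows "iota n (pconj i D) \<in> CarG n (tildeHT n \<Theta>)"
  unfolding iota_pconj[OF assms(3)]
proof (rule CarG_pconj[OF tildeHT_subset[OF \<Theta> assms(2)]])
  let ?D = "if 1 \<in> D then D \<union> {5..n} else D"
  have *: "i \<in> {1..4}" "D \<subseteq> {1..4}" "i \<notin> D" "D \<noteq> {}" using PC_D[OF assms(3)] by auto
  then show "(i, ?D) \<in> PC n" using assms(2) by (auto simp: PC_def subset_iff)
  show "compat (tildeHT n \<Theta>) i ?D"
    unfolding compat_def
  proof
    fix E assume "E \<in> tildeHT n \<Theta>"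
    then consider "E \<in> \<Theta>" | f where "E = {1, f}" "f \<in> {5..n}" by (auto simp: tildeHT_edge)
    then show "E \<inter> ?D = {} \<or> E \<subseteq> insert i ?D"
    proof cases
      case 1
      then have "E \<inter> {5..n} = {}" using \<Theta> by force
      moreover have "E \<inter> D = {} \<or> E \<subseteq> insert i D" using assms(4) 1 by (auto simp: compat_def)
      ultimately show ?thesis by auto
    next
      case 2
      then have "f \<notin> D" using * by auto
      then show ?thesis using 2 by auto
    qed
  qed
qed

lemma iota_comp':
  assumes "\<alpha> \<in> EN 4" "\<beta> \<in> EN 4" "n \<ge> 5"
  obtains \<epsilon> where "\<epsilon> \<in> {idE, pconj 1 {5..n}}"
    "iota n (comp \<alpha> \<beta>) = comp (iota n \<alpha>) (comp (iota n \<beta>) \<epsilon>)"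
    "comp (iota n \<alpha>) (iota n \<beta>) = comp (iota n (comp \<alpha> \<beta>)) \<epsilon>"
proof -
  obtain \<epsilon> where \<epsilon>: "\<epsilon> \<in> {idE, pconj 1 {5..n}}"
    "comp (iota n \<alpha>) (iota n \<beta>) = comp (iota n (comp \<alpha> \<beta>)) \<epsilon>"
    using iota_comp[OF assms] by blast
  have n: "nice (iota n \<alpha>)" "nice (iota n \<beta>)" "nice (iota n (comp \<alpha> \<beta>))" "nice \<epsilon>"
    using iota_EN[OF assms(1,3)] iota_EN[OF assms(2,3)] iota_EN[OF EN_comp[OF assms(1,2)] assms(3)]
      twist_EN[OF assms(3) \<epsilon>(1)] EN_nice by blast+
  have "comp (iota n \<alpha>) (comp (iota n \<beta>) \<epsilon>) = comp (comp (iota n \<alpha>) (iota n \<beta>)) \<epsilon>"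
    using n by (simp add: comp_assoc)
  also have "\<dots> = comp (iota n (comp \<alpha> \<beta>)) (comp \<epsilon> \<epsilon>)"
    unfolding \<epsilon>(2) using n by (simp add: comp_assoc)
  also have "\<dots> = iota n (comp \<alpha> \<beta>)" using n twist_involution[OF \<epsilon>(1)] by simp
  finally show ?thesis using that[OF \<epsilon>(1)] \<epsilon>(2) by simp
qed

lemma iota_CarG:
  assumes \<Theta>: "\<And>E. E \<in> \<Theta> \<Longrightarrow> E \<subseteq> {1..4}" and n: "n \<ge> 5" and "\<pi> \<in> CarG 4 \<Theta>"
  shows "iota n \<pi> \<in> CarG n (tildeHT n \<Theta>)"
proof -
  have "\<pi> \<in> gen {pconj i D | i D. (i, D) \<in> PC 4 \<and> compat \<Theta> i D}"
    using assms(3) CarG_eq[OF \<Theta>] by simp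
  then show ?thesis
  proof (induction rule: gen.induct)
    case gen_id
    then show ?case by (simp add: iota_idE CarG_id)
  next
    case (gen_step a g)
    then obtain i D where a: "a = pconj i D" "(i, D) \<in> PC 4" "compat \<Theta> i D" by blast
    have "a \<in> EN 4" using pconj_EN[of i 4 D] PC_D[OF a(2)] a(1) by simp
    moreover have "g \<in> EN 4" using gen_step(2) CarG_eq[OF \<Theta>] CarG_EN by blast
    ultimately obtain \<epsilon> where \<epsilon>: "\<epsilon> \<in> {idE, pconj 1 {5..n}}"
      "iota n (comp a g) = comp (iota n a) (comp (iota n g) \<epsilon>)"
      using iota_comp'[OF _ _ n] by metis
    have "iota n a \<in> CarG n (tildeHT n \<Theta>)" using iota_pconj_CarG[OF \<Theta> n a(2,3)] a(1) by simp
    moreover have "\<epsilon> \<in> CarG n (tildeHT n \<Theta>)" by (rule twist_CarG[OF \<Theta> n \<epsilon>(1)])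
    ultimately show ?case unfolding \<epsilon>(2) using gen_step.IH CarG_comp by blast
  qed
qed

subsection \<open>Killing generators\<close>

text \<open>The retraction onto the subgroup on \<open>S\<close>. A killed generator has the empty
  word as image, which \<open>adm\<close> permits.\<close>

definition restr :: "nat set \<Rightarrow> endo" where "restr S = (\<lambda>j. if j \<in> S then [j] else [])"

lemma el_restr: "el (restr S j) = (if j \<in> S then gn j else 0)"
  by (simp add: restr_def gn_def)

lemma adm_restr: "adm (restr S)"
  by (simp add: adm_def el_restr)

lemma hm_restr_id: "x \<in> WS S \<Longrightarrow> hm (restr S) x = x"
  by (induction rule: WS_induct) (auto simp: hm_add adm_restr el_restr)

lemma hm_restr_WS: "hm (restr S) x \<in> WS S"
  by (induction x rule: wgrp_induct) (auto simp: hm_add adm_restr el_restr)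

lemma restr_pconj:
  assumes "i \<in> S"
  shows "hm (restr S) (hm (pconj i D) x) = hm (pconj i (D \<inter> S)) (hm (restr S) x)"
  by (rule additive_eqI[OF _ _ _ _ in_WS_UNIV])
    (use assms in \<open>auto simp: hm_add adm_restr adm_pconj el_restr el_pconj\<close>)

lemma restr_pconj_out:
  assumes "i \<notin> S"
  shows "hm (restr S) (hm (pconj i D) x) = hm (restr S) x"
  by (rule additive_eqI[OF _ _ _ _ in_WS_UNIV])
    (use assms in \<open>auto simp: hm_add adm_restr adm_pconj el_restr el_pconj\<close>)

lemma pconj_empty: "pconj i {} = idE"
  by (simp add: pconj_def idE_def)

text \<open>Under the retraction to W_4, x_{i,D} becomes trivial for \<open>i > 4\<close>. Otherwise
  \<open>D\<close> is cut down to \<open>D \<inter> {1..4}\<close>, and compatibility with the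
  smaller hypertree is inherited. Products follow by chaining the intertwining relations.\<close>

lemma restr_CarG:
  assumes \<Theta>: "\<And>E. E \<in> \<Theta> \<Longrightarrow> E \<subseteq> {1..4}" and n: "n \<ge> 5" and "\<pi> \<in> CarG n (tildeHT n \<Theta>)"
  shows "\<exists>\<pi>'\<in>CarG 4 \<Theta>. \<forall>x. hm (restr {1..4}) (hm \<pi> x) = hm \<pi>' (hm (restr {1..4}) x)"
proof -
  have "\<pi> \<in> gen {pconj i D | i D. (i, D) \<in> PC n \<and> compat (tildeHT n \<Theta>) i D}"
    using assms(3) CarG_eq[OF tildeHT_subset[OF \<Theta> n]] by simp
  then show ?thesis
  proof (induction rule: gen.induct)
    case gen_id
    then show ?case using CarG_id[of 4 \<Theta>] by (intro bexI[of _ idE]) auto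
  next
    case (gen_step a g)
    then obtain i D where a: "a = pconj i D" "(i, D) \<in> PC n" "compat (tildeHT n \<Theta>) i D" by blast
    obtain g' where g': "g' \<in> CarG 4 \<Theta>"
      "\<And>x. hm (restr {1..4}) (hm g x) = hm g' (hm (restr {1..4}) x)"
      using gen_step.IH by blast
    have na: "nice a" using a PC_D nice_pconj by blast
    have ng: "nice g" by (rule gen_nice[OF gen_step(2) CarG_generator_nice])
    have "\<exists>a'\<in>CarG 4 \<Theta>. \<forall>x. hm (restr {1..4}) (hm a x) = hm a' (hm (restr {1..4}) x)"
    proof (cases "i \<in> {1..4}")
      case True
      have "pconj i (D \<inter> {1..4}) \<in> CarG 4 \<Theta>"
      proof (cases "D \<inter> {1..4} = {}")
        case True
        then show ?thesis by (simp only: pconj_empty CarG_id)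
      next
        case False
        show ?thesis
        proof -
          have pc: "(i, D \<inter> {1..4}) \<in> PC 4"
          proof -
            have "i \<notin> D" using PC_D[OF a(2)] by blast
            then have "D \<inter> {1..4} \<subseteq> {1..4} - {i}" by blast
            then show ?thesis using \<open>i \<in> {1..4}\<close> False unfolding PC_def by blast
          qed
          have cp: "compat \<Theta> i (D \<inter> {1..4})"
            unfolding compat_def
          proof
            fix E assume E: "E \<in> \<Theta>"
            then have "E \<in> tildeHT n \<Theta>" by (simp add: tildeHT_edge)
            with a(3)[unfolded compat_def] have "E \<inter> D = {} \<or> E \<subseteq> insert i D"
              by (rule bspec)
            then show "E \<inter> (D \<inter> {1..4}) = {} \<or> E \<subseteq> insert i (D \<inter> {1..4})"
              using \<Theta>[OF E] by blast
          qed
          show ?thesis by (rule CarG_pconj[OF \<Theta> pc cp])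
        qed
      qed
      then show ?thesis using restr_pconj[OF True] a(1) by blast
    next
      case False
      then show ?thesis using restr_pconj_out[OF False] a(1) CarG_id[of 4 \<Theta>]
        by (intro bexI[of _ idE]) auto
    qed
    then obtain a' where a': "a' \<in> CarG 4 \<Theta>"
      "\<And>x. hm (restr {1..4}) (hm a x) = hm a' (hm (restr {1..4}) x)" by blast
    have "hm (restr {1..4}) (hm (comp a g) x) = hm (comp a' g') (hm (restr {1..4}) x)" for x
      using na ng a' g' CarG_nice by (simp add: hm_comp nice_adm)
    then show ?case using CarG_comp[OF a'(1) g'(1)] by blast
  qed
qed

text \<open>On W_4 the retraction undoes \<open>iota\<close>, so the automorphism that
  \<open>restr_CarG\<close> provides for \<open>iota n \<gamma>\<close> can only be
  \<gamma>.\<close>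

lemma iota_CarG_D:
  assumes \<Theta>: "\<And>E. E \<in> \<Theta> \<Longrightarrow> E \<subseteq> {1..4}" and n: "n \<ge> 5" and \<gamma>: "\<gamma> \<in> EN 4"
    and "iota n \<gamma> \<in> CarG n (tildeHT n \<Theta>)"
  shows "\<gamma> \<in> CarG 4 \<Theta>"
proof -
  obtain \<pi> where \<pi>: "\<pi> \<in> CarG 4 \<Theta>"
    "\<And>x. hm (restr {1..4}) (hm (iota n \<gamma>) x) = hm \<pi> (hm (restr {1..4}) x)"
    using restr_CarG[OF \<Theta> n assms(4)] by blast
  have "\<gamma> = \<pi>"
  proof (rule nice_eqI)
    fix j
    show "el (\<gamma> j) = el (\<pi> j)"
    proof (cases "j \<in> {1..4}")
      case True
      then have j: "gn j \<in> WS {1..4}" by simp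
      have "hm \<gamma> (gn j) = hm (restr {1..4}) (hm (iota n \<gamma>) (gn j))"
        by (simp only: hm_iota[OF \<gamma> n j] hm_restr_id[OF EN_WS[OF \<gamma> j]])
      also have "\<dots> = hm \<pi> (gn j)" by (simp only: \<pi>(2) hm_restr_id[OF j])
      finally have "hm \<gamma> (gn j) = hm \<pi> (gn j)" .
      then show ?thesis by simp
    next
      case False
      then show ?thesis using EN_out[OF \<gamma>] EN_out[OF CarG_EN[OF \<pi>(1)]] by simp
    qed
  qed (use \<gamma> \<pi> EN_nice CarG_nice in blast)+
  then show ?thesis using \<pi> by simp
qed

lemma iota_coset_iff:
  assumes \<Theta>: "\<And>E. E \<in> \<Theta> \<Longrightarrow> E \<subseteq> {1..4}" and n: "n \<ge> 5" and "\<alpha> \<in> Aut0 4" "\<beta> \<in> Aut0 4"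
  shows "(\<exists>\<pi>\<in>CarG n (tildeHT n \<Theta>). iota n \<beta> = comp (iota n \<alpha>) \<pi>)
    \<longleftrightarrow> (\<exists>\<pi>\<in>CarG 4 \<Theta>. \<beta> = comp \<alpha> \<pi>)"
proof
  assume "\<exists>\<pi>\<in>CarG 4 \<Theta>. \<beta> = comp \<alpha> \<pi>"
  then obtain \<pi> where \<pi>: "\<pi> \<in> CarG 4 \<Theta>" "\<beta> = comp \<alpha> \<pi>" by blast
  then obtain \<epsilon> where \<epsilon>: "\<epsilon> \<in> {idE, pconj 1 {5..n}}"
    "iota n \<beta> = comp (iota n \<alpha>) (comp (iota n \<pi>) \<epsilon>)"
    using iota_comp'[OF Aut0_EN[OF assms(3)] CarG_EN n] by metis
  then show "\<exists>\<pi>\<in>CarG n (tildeHT n \<Theta>). iota n \<beta> = comp (iota n \<alpha>) \<pi>"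
    using CarG_comp[OF iota_CarG[OF \<Theta> n \<pi>(1)] twist_CarG[OF \<Theta> n \<epsilon>(1)]] by blast
next
  assume "\<exists>\<pi>\<in>CarG n (tildeHT n \<Theta>). iota n \<beta> = comp (iota n \<alpha>) \<pi>"
  then obtain \<pi> where \<pi>: "\<pi> \<in> CarG n (tildeHT n \<Theta>)" "iota n \<beta> = comp (iota n \<alpha>) \<pi>" by blast
  obtain \<alpha>' where \<alpha>': "\<alpha>' \<in> Aut0 4" "comp \<alpha> \<alpha>' = idE" using Aut0_inverse[OF assms(3)] by blast
  \<comment> \<open>This is \<alpha>^-1 \<beta>. Multiplicativity up to a twist turns the hypothesis
    into \<open>iota n \<gamma> = comp \<pi> \<epsilon>\<close>, a product of two carried
    automorphisms.\<close>
  define \<gamma> where "\<gamma> = comp \<alpha>' \<beta>"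
  have \<gamma>: "\<gamma> \<in> Aut0 4" unfolding \<gamma>_def by (rule Aut0_comp[OF \<alpha>'(1) assms(4)])
  have "comp \<alpha> \<gamma> = comp (comp \<alpha> \<alpha>') \<beta>"
    unfolding \<gamma>_def using assms \<alpha>'(1) Aut0_nice by (simp add: comp_assoc)
  then have \<beta>: "\<beta> = comp \<alpha> \<gamma>" using \<alpha>'(2) Aut0_nice[OF assms(4)] by simp
  obtain \<epsilon> where \<epsilon>: "\<epsilon> \<in> {idE, pconj 1 {5..n}}"
    "comp (iota n \<alpha>) (iota n \<gamma>) = comp (iota n \<beta>) \<epsilon>"
    using iota_comp'[OF Aut0_EN[OF assms(3)] Aut0_EN[OF \<gamma>] n] \<beta> by metis
  obtain A where A: "A \<in> Aut0 n" "comp A (iota n \<alpha>) = idE"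
    using Aut0_inverse[OF iota_Aut0[OF assms(3) n]] by blast
  note \<epsilon>C = twist_CarG[OF \<Theta> n \<epsilon>(1)]
  have nc: "nice A" "nice (iota n \<alpha>)" "nice (iota n \<gamma>)" "nice \<pi>" "nice \<epsilon>"
    using A iota_Aut0[OF assms(3) n] iota_Aut0[OF \<gamma> n] Aut0_nice CarG_nice \<pi>(1) \<epsilon>C by blast+
  have "comp (iota n \<alpha>) (iota n \<gamma>) = comp (iota n \<alpha>) (comp \<pi> \<epsilon>)"
    using \<epsilon>(2) \<pi>(2) nc by (simp add: comp_assoc)
  then have "comp (comp A (iota n \<alpha>)) (iota n \<gamma>) = comp (comp A (iota n \<alpha>)) (comp \<pi> \<epsilon>)"
    using nc by (simp add: comp_assoc nice_comp)
  then have "iota n \<gamma> = comp \<pi> \<epsilon>" using A nc by (simp add: nice_comp)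
  then have "iota n \<gamma> \<in> CarG n (tildeHT n \<Theta>)" using CarG_comp[OF \<pi>(1) \<epsilon>C] by simp
  then have "\<gamma> \<in> CarG 4 \<Theta>" using iota_CarG_D[OF \<Theta> n Aut0_EN[OF \<gamma>]] by blast
  then show "\<exists>\<pi>\<in>CarG 4 \<Theta>. \<beta> = comp \<alpha> \<pi>" using \<beta> by blast
qed

section \<open>Hypertrees with additional leaves\<close>

definition joined :: "nat set set \<Rightarrow> nat \<Rightarrow> nat \<Rightarrow> bool" where
  "joined \<Theta> u w \<longleftrightarrow> (\<exists>!p. simple_walk \<Theta> (fst p) (snd p) \<and> hd (fst p) = u \<and> last (fst p) = w)"

text \<open>Formulated over an arbitrary vertex set, so that leaves can be attached one at a
  time.\<close>

definition hypertree :: "nat set \<Rightarrow> nat set set \<Rightarrow> bool" where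
  "hypertree V \<Theta> \<longleftrightarrow> (\<forall>E\<in>\<Theta>. E \<subseteq> V \<and> card E \<ge> 2) \<and> (\<forall>u\<in>V. \<forall>w\<in>V. joined \<Theta> u w)"

lemma HT_iff: "\<Theta> \<in> HT n \<longleftrightarrow> hypertree {1..n} \<Theta>"
  by (simp add: HT_def hypertree_def joined_def)

section \<open>Simple walks and the attachment of a leaf\<close>

lemma simple_walk_nonempty: "simple_walk \<Theta> vs es \<Longrightarrow> vs \<noteq> []"
  by (auto simp: simple_walk_def)

lemma simple_walk_single: "simple_walk \<Theta> [x] es \<longleftrightarrow> es = []"
  by (auto simp: simple_walk_def)

lemma simple_walk_Cons_Cons:
  "simple_walk \<Theta> (x # y # vs) es \<longleftrightarrow> (\<exists>e es'. es = e # es' \<and> x \<notin> set (y # vs) \<and> e \<notin> set es'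
     \<and> e \<in> \<Theta> \<and> x \<in> e \<and> y \<in> e \<and> simple_walk \<Theta> (y # vs) es')"
proof (cases es)
  case Nil
  then show ?thesis by (simp add: simple_walk_def)
next
  case (Cons e es')
  have "(\<forall>m < length (e # es'). (x # y # vs) ! m \<in> (e # es') ! m \<and> (x # y # vs) ! Suc m \<in> (e # es') ! m)
    \<longleftrightarrow> x \<in> e \<and> y \<in> e \<and> (\<forall>m < length es'. (y # vs) ! m \<in> es' ! m \<and> (y # vs) ! Suc m \<in> es' ! m)"
    by (simp add: All_less_Suc2)
  then show ?thesis unfolding Cons simple_walk_def by auto
qed

lemma simple_walk_rev:
  assumes "simple_walk \<Theta> vs es"
  shows "simple_walk \<Theta> (rev vs) (rev es)"
proof -
  have "rev vs ! m \<in> rev es ! m \<and> rev vs ! Suc m \<in> rev es ! m" if m: "m < length es" for m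
  proof -
    have "length vs = Suc (length es)" using assms by (simp add: simple_walk_def)
    then have "rev vs ! m = vs ! Suc (length es - Suc m)" "rev vs ! Suc m = vs ! (length es - Suc m)"
      "rev es ! m = es ! (length es - Suc m)"
      using m by (simp_all add: rev_nth Suc_diff_Suc)
    moreover have "length es - Suc m < length es" using m by simp
    ultimately show ?thesis using assms by (simp add: simple_walk_def)
  qed
  then show ?thesis using assms by (simp add: simple_walk_def)
qed

lemma joined_sym: "joined \<Theta> u w \<Longrightarrow> joined \<Theta> w u"
  unfolding joined_def
proof (elim ex1E conjE)
  fix p
  assume p: "simple_walk \<Theta> (fst p) (snd p)" "hd (fst p) = u" "last (fst p) = w"
    and unique: "\<forall>q. simple_walk \<Theta> (fst q) (snd q) \<and> hd (fst q) = u \<and> last (fst q) = w \<longrightarrow> q = p"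
  show "\<exists>!q. simple_walk \<Theta> (fst q) (snd q) \<and> hd (fst q) = w \<and> last (fst q) = u"
  proof (rule ex1I[of _ "(rev (fst p), rev (snd p))"])
    show "simple_walk \<Theta> (fst (rev (fst p), rev (snd p))) (snd (rev (fst p), rev (snd p)))
        \<and> hd (fst (rev (fst p), rev (snd p))) = w \<and> last (fst (rev (fst p), rev (snd p))) = u"
      using p simple_walk_rev[OF p(1)] by (simp add: hd_rev last_rev)
  next
    fix q assume q: "simple_walk \<Theta> (fst q) (snd q) \<and> hd (fst q) = w \<and> last (fst q) = u"
    then have "(rev (fst q), rev (snd q)) = p"
      using unique simple_walk_rev[of \<Theta> "fst q" "snd q"]
      by (simp add: hd_rev last_rev)
    then show "q = (rev (fst p), rev (snd p))" by (metis fst_conv prod.collapse rev_rev_ident snd_conv)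
  qed
qed

lemma joined_self: "joined \<Theta> u u"
  unfolding joined_def
proof (rule ex1I[of _ "([u], [])"])
  fix p assume p: "simple_walk \<Theta> (fst p) (snd p) \<and> hd (fst p) = u \<and> last (fst p) = u"
  obtain vs where vs: "fst p = u # vs" using p simple_walk_nonempty by (metis list.exhaust_sel)
  have "vs = []"
  proof (rule ccontr)
    assume "vs \<noteq> []"
    then have "u \<in> set vs" using p vs by (metis last_ConsR last_in_set)
    then show False using p vs by (simp add: simple_walk_def)
  qed
  then have "fst p = [u]" "snd p = []" using p vs simple_walk_single by auto
  then show "p = ([u], [])" by (simp add: prod_eq_iff)
qed (simp add: simple_walk_single)

lemma simple_walk_mono: "simple_walk \<Theta> vs es \<Longrightarrow> \<Theta> \<subseteq> \<Lambda> \<Longrightarrow> simple_walk \<Lambda> vs es"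
  by (auto simp: simple_walk_def)

text \<open>The leaf \<open>f\<close> lies on one hyperedge only. Visiting \<open>f\<close> in the
  interior would use this hyperedge twice in succession, and using it without visiting
  \<open>f\<close> would repeat \<open>v\<close>; simplicity excludes both.\<close>

lemma simple_walk_avoid_leaf:
  assumes \<Theta>: "\<forall>E\<in>\<Theta>. f \<notin> E" and w: "simple_walk (insert {v, f} \<Theta>) vs es"
    and "hd vs \<noteq> f" "last vs \<noteq> f"
  shows "simple_walk \<Theta> vs es"
proof -
  have len: "length vs = Suc (length es)" and dist: "distinct vs" "distinct es"
    and sub: "set es \<subseteq> insert {v, f} \<Theta>"
    and inc: "\<And>m. m < length es \<Longrightarrow> vs ! m \<in> es ! m \<and> vs ! Suc m \<in> es ! m"
    using w by (auto simp: simple_walk_def)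
  have leaf: "es ! m = {v, f}" if "m < length es" "f \<in> es ! m" for m
    using that \<Theta> sub nth_mem[OF that(1)] by blast
  have f: "vs ! m \<noteq> f" if m: "m < length vs" for m
  proof
    assume *: "vs ! m = f"
    have "vs \<noteq> []" using len by auto
    then have "vs ! 0 \<noteq> f" "vs ! length es \<noteq> f"
      using assms(3,4) len by (simp_all add: hd_conv_nth last_conv_nth)
    then have "m \<noteq> 0" "m \<noteq> length es" using * by metis+
    then have i: "m - 1 < length es" "m < length es" "Suc (m - 1) = m" using m len by auto
    then have "f \<in> es ! (m - 1)" "f \<in> es ! m" using inc[OF i(1)] inc[OF i(2)] * by simp_all
    then have "es ! (m - 1) = es ! m" using leaf[OF i(1)] leaf[OF i(2)] by (simp only:)
    then show False using dist(2) i nth_eq_iff_index_eq[of es "m - 1" m] by simp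
  qed
  have "e \<in> \<Theta>" if e: "e \<in> set es" for e
  proof (rule ccontr)
    assume "e \<notin> \<Theta>"
    then have "e = {v, f}" using sub e by blast
    moreover obtain m where m: "m < length es" "e = es ! m" using e by (metis in_set_conv_nth)
    ultimately have "vs ! m \<in> {v, f}" "vs ! Suc m \<in> {v, f}" using inc by auto
    then have "vs ! m = vs ! Suc m" using f[of m] f[of "Suc m"] m len by auto
    then show False using dist(1) m len nth_eq_iff_index_eq[of vs m "Suc m"] by simp
  qed
  then show ?thesis using w by (auto simp: simple_walk_def)
qed

lemma joined_leaf_iff:
  assumes "\<forall>E\<in>\<Theta>. f \<notin> E" "u \<noteq> f" "w \<noteq> f"
  shows "joined (insert {v, f} \<Theta>) u w \<longleftrightarrow> joined \<Theta> u w"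
proof -
  have "simple_walk (insert {v, f} \<Theta>) vs es \<and> hd vs = u \<and> last vs = w
      \<longleftrightarrow> simple_walk \<Theta> vs es \<and> hd vs = u \<and> last vs = w" for vs es
    using simple_walk_avoid_leaf[OF assms(1)] simple_walk_mono[of \<Theta> _ _ "insert {v, f} \<Theta>"] assms(2,3)
    by blast
  then show ?thesis unfolding joined_def by simp
qed

text \<open>A simple walk out of the leaf must begin with \<open>{v, f}\<close> and step to
  \<open>v\<close>; its remainder never returns to the leaf and so is the unique walk of \<Theta>
  from \<open>v\<close>.\<close>

lemma joined_leaf:
  assumes \<Theta>: "\<forall>E\<in>\<Theta>. f \<notin> E" and "v \<noteq> f" "w \<noteq> f" "joined \<Theta> v w"
  shows "joined (insert {v, f} \<Theta>) f w"
proof -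
  let ?T = "insert {v, f} \<Theta>"
  obtain vs es where p: "simple_walk \<Theta> vs es" "hd vs = v" "last vs = w"
    and unique: "\<And>vs' es'. simple_walk \<Theta> vs' es' \<Longrightarrow> hd vs' = v \<Longrightarrow> last vs' = w \<Longrightarrow> vs' = vs \<and> es' = es"
    using assms(4) unfolding joined_def by (metis fst_conv snd_conv)
  obtain vs1 where vs: "vs = v # vs1" using p simple_walk_nonempty by (metis list.exhaust_sel)
  have f: "f \<notin> set vs"
  proof
    assume "f \<in> set vs"
    then obtain m where m: "m < length vs" "vs ! m = f" by (metis in_set_conv_nth)
    then have "m \<noteq> 0" using vs assms(2) by (cases m) auto
    then have "m - 1 < length es" "Suc (m - 1) = m" using m p(1) by (auto simp: simple_walk_def)
    then have "f \<in> es ! (m - 1)" "es ! (m - 1) \<in> \<Theta>"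
      using p(1) m(2) nth_mem[of "m - 1" es] unfolding simple_walk_def by (metis, blast)
    then show False using \<Theta> by blast
  qed
  have "{v, f} \<notin> set es" using \<Theta> p(1) unfolding simple_walk_def by blast
  then have new: "simple_walk ?T (f # vs) ({v, f} # es)"
    using f simple_walk_mono[OF p(1), of ?T] by (auto simp: vs simple_walk_Cons_Cons)
  show ?thesis
    unfolding joined_def
  proof (rule ex1I[of _ "(f # vs, {v, f} # es)"])
    show "simple_walk ?T (fst (f # vs, {v, f} # es)) (snd (f # vs, {v, f} # es))
      \<and> hd (fst (f # vs, {v, f} # es)) = f \<and> last (fst (f # vs, {v, f} # es)) = w"
      using new p vs by simp
  next
    fix q assume q: "simple_walk ?T (fst q) (snd q) \<and> hd (fst q) = f \<and> last (fst q) = w"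
    obtain y us where us: "fst q = f # y # us"
      using q simple_walk_nonempty assms(3)
      by (metis last_ConsL list.exhaust_sel)
    obtain e es' where e: "snd q = e # es'" "f \<notin> set (y # us)" "e \<in> ?T" "f \<in> e" "y \<in> e"
      "simple_walk ?T (y # us) es'"
      using q unfolding us simple_walk_Cons_Cons by blast
    have "e = {v, f}" using e(3,4) \<Theta> by blast
    then have "y = v" using e by auto
    have "last (y # us) = w" using q us by simp
    have "simple_walk \<Theta> (y # us) es'"
      by (rule simple_walk_avoid_leaf[OF \<Theta> e(6)]) (use \<open>y = v\<close> \<open>last (y # us) = w\<close> assms in auto)
    then have "y # us = vs \<and> es' = es"
      by (rule unique) (use \<open>y = v\<close> \<open>last (y # us) = w\<close> in auto)
    then show "q = (f # vs, {v, f} # es)" using us e(1) \<open>e = {v, f}\<close> by (simp add: prod_eq_iff)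
  qed
qed

lemma hypertree_leaf_iff:
  assumes "f \<notin> V" "v \<in> V" "\<forall>E\<in>\<Theta>. E \<subseteq> V"
  shows "hypertree (insert f V) (insert {v, f} \<Theta>) \<longleftrightarrow> hypertree V \<Theta>"
proof -
  have \<Theta>: "\<forall>E\<in>\<Theta>. f \<notin> E" and vf: "v \<noteq> f" using assms by auto
  have in_iff: "joined (insert {v, f} \<Theta>) u w \<longleftrightarrow> joined \<Theta> u w" if "u \<in> V" "w \<in> V" for u w
    by (rule joined_leaf_iff[OF \<Theta>]) (use that assms in auto)
  show ?thesis
  proof
    assume h: "hypertree (insert f V) (insert {v, f} \<Theta>)"
    then show "hypertree V \<Theta>" using assms(3) in_iff by (simp add: hypertree_def)
  next
    assume h: "hypertree V \<Theta>"
    have leaf: "joined (insert {v, f} \<Theta>) f w" if "w \<in> V" for w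
    proof (rule joined_leaf[OF \<Theta> vf])
      show "w \<noteq> f" using that assms(1) by auto
      show "joined \<Theta> v w" using h assms(2) that by (simp add: hypertree_def)
    qed
    have "\<forall>u\<in>insert f V. \<forall>w\<in>insert f V. joined (insert {v, f} \<Theta>) u w"
    proof (intro ballI)
      fix u w assume uw: "u \<in> insert f V" "w \<in> insert f V"
      then consider "u = w" | "u = f" "w \<in> V" | "u \<in> V" "w = f" | "u \<in> V" "w \<in> V" by blast
      then show "joined (insert {v, f} \<Theta>) u w"
      proof cases
        case 4
        then show ?thesis using h in_iff by (simp add: hypertree_def)
      qed (simp_all add: joined_self leaf joined_sym)
    qed
    moreover have "card {v, f} = 2" using vf by simp
    ultimately show "hypertree (insert f V) (insert {v, f} \<Theta>)"
      using h assms(2) unfolding hypertree_def by auto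
  qed
qed

lemma tildeHT_image: "tildeHT n \<Theta> = \<Theta> \<union> (\<lambda>f. {1, f}) ` {5..n}"
  unfolding tildeHT_def setcompr_eq_image Collect_mem_eq ..

lemma tildeHT_4: "tildeHT 4 \<Theta> = \<Theta>"
  by (simp add: tildeHT_def)

lemma tildeHT_Suc: "n \<ge> 4 \<Longrightarrow> tildeHT (Suc n) \<Theta> = insert {1, Suc n} (tildeHT n \<Theta>)"
proof -
  assume "n \<ge> 4"
  then have "{5..Suc n} = insert (Suc n) {5..n}" by auto
  then show ?thesis unfolding tildeHT_image by simp
qed

text \<open>For \<open>n = 4\<close> nothing is attached; each further vertex is one application of
  \<open>hypertree_leaf_iff\<close> at the vertex 1.\<close>

lemma tildeHT_HT_iff:
  assumes "\<And>E. E \<in> \<Theta> \<Longrightarrow> E \<subseteq> {1..4}" "n \<ge> 4"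
  shows "tildeHT n \<Theta> \<in> HT n \<longleftrightarrow> \<Theta> \<in> HT 4"
  using assms(2)
proof (induction n rule: dec_induct)
  case base
  show ?case by (simp only: tildeHT_4)
next
  case (step n)
  have ins: "{1..Suc n} = insert (Suc n) {1..n}" by auto
  have "\<forall>E\<in>tildeHT n \<Theta>. E \<subseteq> {1..n}"
  proof
    fix E assume "E \<in> tildeHT n \<Theta>"
    then consider "E \<in> \<Theta>" | f where "E = {1, f}" "f \<in> {5..n}" by (auto simp: tildeHT_edge)
    then show "E \<subseteq> {1..n}"
    proof cases
      case 1
      then have "E \<subseteq> {1..4}" by (rule assms(1))
      also have "\<dots> \<subseteq> {1..n}" using step by auto
      finally show ?thesis .
    qed auto
  qed
  then show ?case
    unfolding tildeHT_Suc[OF step(1)] HT_iff[of _ "Suc n"] ins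
    using hypertree_leaf_iff[of "Suc n" "{1..n}" 1 "tildeHT n \<Theta>"] step by (simp add: HT_iff)
qed

section \<open>The folding order on extended hypertrees\<close>

lemma tildeHT_inj:
  assumes "\<And>E. E \<in> \<Theta> \<Longrightarrow> E \<subseteq> {1..4}" "\<And>E. E \<in> \<Lambda> \<Longrightarrow> E \<subseteq> {1..4}"
  shows "tildeHT n \<Theta> = tildeHT n \<Lambda> \<longleftrightarrow> \<Theta> = \<Lambda>"
proof -
  have "{E \<in> tildeHT n M. E \<subseteq> {1..4}} = M" if "\<And>E. E \<in> M \<Longrightarrow> E \<subseteq> {1..4}" for M
    using that by (auto simp: tildeHT_def)
  then show ?thesis using assms by metis
qed

lemma tildeHT_fold:
  assumes "\<And>f. f \<in> {5..n} \<Longrightarrow> E1 \<noteq> {1, f} \<and> E2 \<noteq> {1, f}"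
  shows "tildeHT n (\<Lambda> - {E1, E2} \<union> {E1 \<union> E2}) = tildeHT n \<Lambda> - {E1, E2} \<union> {E1 \<union> E2}"
  unfolding tildeHT_def using assms by blast

text \<open>Each fold lifts literally, because along the sequence all hyperedges stay inside
  \<open>{1..4}\<close> and so differ from the leaf hyperedges; the induction carries this along as
  an invariant.\<close>

lemma ht_le_tildeI:
  assumes "\<And>E. E \<in> \<Lambda> \<Longrightarrow> E \<subseteq> {1..4}" "ht_le \<Theta> \<Lambda>"
  shows "ht_le (tildeHT n \<Theta>) (tildeHT n \<Lambda>)"
proof -
  have "fold_step\<^sup>*\<^sup>* (tildeHT n \<Lambda>) (tildeHT n \<Theta>) \<and> (\<forall>E\<in>\<Theta>. E \<subseteq> {1..4})"
    using assms(2) unfolding ht_le_def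
  proof (induction rule: rtranclp_induct)
    case base
    then show ?case using assms(1) by simp
  next
    case (step M N)
    then obtain E1 E2 where E: "E1 \<in> M" "E2 \<in> M" "E1 \<noteq> E2" "E1 \<inter> E2 \<noteq> {}"
      "N = M - {E1, E2} \<union> {E1 \<union> E2}" unfolding fold_step_def by blast
    have sub: "E1 \<subseteq> {1..4}" "E2 \<subseteq> {1..4}" using step.IH E by auto
    then have "tildeHT n N = tildeHT n M - {E1, E2} \<union> {E1 \<union> E2}"
      unfolding E(5) by (intro tildeHT_fold) auto
    moreover have "E1 \<in> tildeHT n M" "E2 \<in> tildeHT n M" using E by (auto simp: tildeHT_edge)
    ultimately have "fold_step (tildeHT n M) (tildeHT n N)"
      unfolding fold_step_def using E(3,4) by blast
    moreover have "\<forall>E\<in>N. E \<subseteq> {1..4}" using step.IH sub E(5) by blast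
    ultimately show ?case using step.IH by (meson rtranclp.rtrancl_into_rtrancl)
  qed
  then show ?thesis by (simp add: ht_le_def)
qed

lemma card_Un_distinct:
  assumes "finite E1" "finite E2" "card E1 \<ge> 2" "card E2 \<ge> 2" "E1 \<noteq> E2"
  shows "card (E1 \<union> E2) \<ge> 3"
proof (rule ccontr)
  assume "\<not> card (E1 \<union> E2) \<ge> 3"
  then have "card (E1 \<union> E2) \<le> card E1" "card (E1 \<union> E2) \<le> card E2" using assms by auto
  then have "E1 = E1 \<union> E2" "E2 = E1 \<union> E2"
    using assms card_seteq[of "E1 \<union> E2"] by auto
  then show False using assms(5) by simp
qed

text \<open>A hyperedge of size at least 3 containing a vertex \<open>f > 4\<close> is never destroyed by folding,
  so the folds between two extended hypertrees do not touch the leaves.\<close>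

definition big_at_leaf :: "nat set set \<Rightarrow> bool" where
  "big_at_leaf M \<longleftrightarrow> (\<exists>E\<in>M. \<exists>f\<in>E. f > 4 \<and> card E \<ge> 3)"

lemma fold_big_at_leaf:
  assumes "fold_step M N" "\<forall>E\<in>M. finite E" "big_at_leaf M"
  shows "big_at_leaf N"
proof -
  obtain E1 E2 where E: "E1 \<in> M" "E2 \<in> M" "N = M - {E1, E2} \<union> {E1 \<union> E2}"
    using assms(1) unfolding fold_step_def by blast
  obtain G f where G: "G \<in> M" "f \<in> G" "f > 4" "card G \<ge> 3" using assms(3) by (auto simp: big_at_leaf_def)
  show ?thesis
  proof (cases "G = E1 \<or> G = E2")
    case True
    have "finite (E1 \<union> E2)" using assms(2) E by simp
    moreover have sub: "G \<subseteq> E1 \<union> E2" using True by blast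
    ultimately have "card G \<le> card (E1 \<union> E2)" by (rule card_mono)
    then have "card (E1 \<union> E2) \<ge> 3" using G(4) by simp
    moreover have "E1 \<union> E2 \<in> N" using E(3) by simp
    moreover have "f \<in> E1 \<union> E2" using sub G(2) by blast
    ultimately show ?thesis using G(3) unfolding big_at_leaf_def by blast
  next
    case False
    then have "G \<in> N" using E(3) G(1) by simp
    then show ?thesis using G unfolding big_at_leaf_def by blast
  qed
qed

lemma fold_edges:
  assumes "fold_step M N" "\<forall>E\<in>M. finite E \<and> card E \<ge> 2"
  shows "\<forall>E\<in>N. finite E \<and> card E \<ge> 2"
proof
  fix E assume E: "E \<in> N"
  obtain E1 E2 where E12: "E1 \<in> M" "E2 \<in> M" "N = M - {E1, E2} \<union> {E1 \<union> E2}"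
    using assms(1) unfolding fold_step_def by blast
  show "finite E \<and> card E \<ge> 2"
  proof (cases "E = E1 \<union> E2")
    case True
    moreover have "finite (E1 \<union> E2)" using E12 assms(2) by simp
    moreover have "card E1 \<le> card (E1 \<union> E2)" by (rule card_mono) (use calculation in auto)
    ultimately show ?thesis using E12 assms(2) by fastforce
  next
    case False
    then show ?thesis using E E12 assms(2) by blast
  qed
qed

lemma folds_big_at_leaf:
  assumes "fold_step\<^sup>*\<^sup>* M N" "\<forall>E\<in>M. finite E \<and> card E \<ge> 2" "big_at_leaf M"
  shows "big_at_leaf N"
proof -
  have "big_at_leaf N \<and> (\<forall>E\<in>N. finite E \<and> card E \<ge> 2)"
    using assms(1)
  proof (induction rule: rtranclp_induct)
    case base
    then show ?case using assms by simp
  next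
    case (step M N)
    then show ?case using fold_big_at_leaf[OF step(2)] fold_edges[OF step(2)] by blast
  qed
  then show ?thesis by simp
qed

lemma tildeHT_not_big:
  assumes "\<And>E. E \<in> \<Theta> \<Longrightarrow> E \<subseteq> {1..4}"
  shows "\<not> big_at_leaf (tildeHT n \<Theta>)"
proof
  assume "big_at_leaf (tildeHT n \<Theta>)"
  then obtain E f where E: "E \<in> tildeHT n \<Theta>" "f \<in> E" "f > 4" "card E \<ge> 3" by (auto simp: big_at_leaf_def)
  then have "E \<notin> \<Theta>" using assms by force
  then obtain g where "E = {1, g}" using E(1) by (auto simp: tildeHT_edge)
  then have "card E \<le> 2" by (simp add: card_insert_if)
  then show False using E by simp
qed

lemma ht_le_tildeD:
  assumes \<Theta>: "\<And>E. E \<in> \<Theta> \<Longrightarrow> E \<subseteq> {1..4}"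
    and \<Lambda>: "\<forall>E\<in>\<Lambda>. E \<subseteq> {1..4} \<and> card E \<ge> 2"
    and "ht_le (tildeHT n \<Theta>) (tildeHT n \<Lambda>)"
  shows "ht_le \<Theta> \<Lambda>"
proof -
  \<comment> \<open>The induction strips off the first fold and continues from another hyperedge
    set, so the start is any \<open>X\<close> that extends some \<Lambda>.\<close>
  have "X = tildeHT n \<Lambda> \<Longrightarrow> \<forall>E\<in>\<Lambda>. E \<subseteq> {1..4} \<and> card E \<ge> 2 \<Longrightarrow> fold_step\<^sup>*\<^sup>* \<Lambda> \<Theta>"
    if "fold_step\<^sup>*\<^sup>* X (tildeHT n \<Theta>)" for X \<Lambda>
    using that
  proof (induction arbitrary: \<Lambda> rule: converse_rtranclp_induct)
    case base
    then have "\<Theta> = \<Lambda>" using tildeHT_inj[of \<Theta> \<Lambda> n] \<Theta> by blast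
    then show ?case by simp
  next
    case (step X Y)
    have X: "\<forall>E\<in>X. finite E \<and> card E \<ge> 2"
    proof
      fix E assume "E \<in> X"
      then consider "E \<in> \<Lambda>" | f where "E = {1, f}" "f \<in> {5..n}"
        using step.prems(1) by (auto simp: tildeHT_edge)
      then show "finite E \<and> card E \<ge> 2"
      proof cases
        case 1
        then show ?thesis using step.prems(2) finite_subset by blast
      qed auto
    qed
    \<comment> \<open>A large hyperedge at a leaf would survive all remaining folds, but the final
      \<open>tildeHT n \<Theta>\<close> has none.\<close>
    have nb: "\<not> big_at_leaf Y"
      using folds_big_at_leaf[OF step(2) fold_edges[OF step(1) X]] tildeHT_not_big[of \<Theta> n] \<Theta> by blast
    obtain E1 E2 where E: "E1 \<in> X" "E2 \<in> X" "E1 \<noteq> E2" "E1 \<inter> E2 \<noteq> {}"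
      "Y = X - {E1, E2} \<union> {E1 \<union> E2}" using step(1) unfolding fold_step_def by blast
    have "card (E1 \<union> E2) \<ge> 3" using X E card_Un_distinct by blast
    then have small: "\<not> f > 4" if "f \<in> E1 \<union> E2" for f
      using nb that E(5) unfolding big_at_leaf_def by blast
    have leaf: "E1 \<noteq> {1, f} \<and> E2 \<noteq> {1, f}" if "f \<in> {5..n}" for f
      using small[of f] that by auto
    define \<Lambda>' where "\<Lambda>' = \<Lambda> - {E1, E2} \<union> {E1 \<union> E2}"
    have in\<Lambda>: "E1 \<in> \<Lambda>" "E2 \<in> \<Lambda>" using E(1,2) leaf step.prems(1) by (auto simp: tildeHT_edge)
    then have fs: "fold_step \<Lambda> \<Lambda>'" unfolding fold_step_def \<Lambda>'_def using E(3,4) by blast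
    have "Y = tildeHT n \<Lambda>'" unfolding E(5) \<Lambda>'_def step.prems(1) by (rule tildeHT_fold[OF leaf, symmetric])
    moreover have "\<forall>E\<in>\<Lambda>'. E \<subseteq> {1..4} \<and> card E \<ge> 2"
    proof -
      have "\<forall>E\<in>\<Lambda>. finite E \<and> card E \<ge> 2" using step.prems(2) finite_subset by blast
      then have "\<forall>E\<in>\<Lambda>'. card E \<ge> 2" using fold_edges[OF fs] by blast
      then show ?thesis using step.prems(2) in\<Lambda> \<Lambda>'_def by blast
    qed
    ultimately have "fold_step\<^sup>*\<^sup>* \<Lambda>' \<Theta>" by (rule step.IH)
    then show ?case using fs by (meson converse_rtranclp_into_rtranclp)
  qed
  then show ?thesis using assms(2,3) unfolding ht_le_def by blast
qed

section \<open>Connectedness of hypertrees\<close>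

lemma HT_edge_card: "\<Theta> \<in> HT n \<Longrightarrow> E \<in> \<Theta> \<Longrightarrow> card E \<ge> 2"
  by (simp add: HT_def)

lemma HT_walk:
  assumes "\<Theta> \<in> HT n" "u \<in> {1..n}" "w \<in> {1..n}"
  obtains vs es where "simple_walk \<Theta> vs es" "hd vs = u" "last vs = w"
proof -
  have "joined \<Theta> u w" using assms unfolding HT_iff hypertree_def by blast
  then show ?thesis using that unfolding joined_def by blast
qed

lemma HT_edge_at:
  assumes "\<Theta> \<in> HT n" "u \<in> {1..n}" "w \<in> {1..n}" "u \<noteq> w"
  shows "\<exists>E\<in>\<Theta>. u \<in> E"
proof -
  obtain vs es where w: "simple_walk \<Theta> vs es" "hd vs = u" "last vs = w"
    using HT_walk[OF assms(1-3)] by blast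
  then obtain y us where "vs = u # y # us"
    using simple_walk_nonempty assms(4) by (metis last_ConsL list.exhaust_sel)
  then show ?thesis using w simple_walk_Cons_Cons by metis
qed

lemma HT_connected_induct:
  assumes "\<Theta> \<in> HT n" "u \<in> {1..n}" "j \<in> {1..n}" "P u"
    "\<And>E i k. E \<in> \<Theta> \<Longrightarrow> i \<in> E \<Longrightarrow> k \<in> E \<Longrightarrow> P i \<Longrightarrow> P k"
  shows "P j"
proof -
  obtain vs es where w: "simple_walk \<Theta> vs es" "hd vs = u" "last vs = j"
    using HT_walk[OF assms(1-3)] by blast
  have ne: "vs \<noteq> []" using w simple_walk_nonempty by blast
  have "m < length vs \<Longrightarrow> P (vs ! m)" for m
  proof (induction m)
    case 0
    then show ?case using w ne assms(4) by (simp add: hd_conv_nth)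
  next
    case (Suc m)
    then have m: "m < length es" using w(1) by (simp add: simple_walk_def)
    then have "es ! m \<in> \<Theta>" "vs ! m \<in> es ! m" "vs ! Suc m \<in> es ! m"
      using w(1) by (auto simp: simple_walk_def)
    then show ?case using Suc assms(5) by (metis Suc_lessD)
  qed
  then show ?thesis using w(3) ne by (metis last_conv_nth diff_less length_greater_0_conv zero_less_one)
qed

section \<open>Vertices fixed by the leaf involutions\<close>

text \<open>Write \<tau> for \<open>pconj i {f}\<close>. Being fixed means \<tau> \<alpha> =
  \<alpha> \<pi> with \<pi> carried; on \<open>E\<close> the map \<pi> is conjugation by some
  \<open>w\<close>, and \<open>hm \<alpha> w\<close> serves as \<open>v\<close>.\<close>

lemma fixed_edge_conj:
  assumes \<alpha>: "\<alpha> \<in> Aut0 n" and \<Lambda>: "\<Lambda> \<in> HT n" and "i \<noteq> f"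
    and "actK (pconj i {f}) (cls n \<alpha> \<Lambda>) = cls n \<alpha> \<Lambda>" and E: "E \<in> \<Lambda>"
  obtains v where "\<And>j. j \<in> E \<Longrightarrow> hm (pconj i {f}) (el (\<alpha> j)) = - v + el (\<alpha> j) + v"
proof -
  have n: "nice (pconj i {f})" "nice \<alpha>" using assms Aut0_nice nice_pconj by auto
  have "cls n \<alpha> \<Lambda> = cls n (comp (pconj i {f}) \<alpha>) \<Lambda>"
    using assms(4) actK_cls[OF n] by simp
  from iffD1[OF cls_eq_iff[OF n(2) nice_comp[OF n]] this]
  obtain \<pi> where \<pi>: "\<pi> \<in> CarG n \<Lambda>" "comp (pconj i {f}) \<alpha> = comp \<alpha> \<pi>" by (elim conjE bexE)
  obtain w where w: "\<And>j. j \<in> E \<Longrightarrow> el (\<pi> j) = - w + gn j + w"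
    using CarG_edge_conj[OF HT_edge[OF \<Lambda>] \<pi>(1) E] by blast
  have a: "adm (pconj i {f})" "adm \<alpha>" using n nice_adm by blast+
  have "hm (pconj i {f}) (el (\<alpha> j)) = - hm \<alpha> w + el (\<alpha> j) + hm \<alpha> w" if "j \<in> E" for j
  proof -
    have "hm (pconj i {f}) (el (\<alpha> j)) = el (comp \<alpha> \<pi> j)"
      unfolding \<pi>(2)[symmetric] by (simp add: el_comp a)
    also have "\<dots> = - hm \<alpha> w + el (\<alpha> j) + hm \<alpha> w"
      by (simp add: el_comp a w[OF that] hm_add hm_minus)
    finally show ?thesis .
  qed
  then show ?thesis using that by blast
qed

text \<open>Since \<tau>(a_f) = a_i a_f a_i, both a_i \<tau>(c) and c v conjugate a_f to \<tau>(r),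
  so they differ at most by a left factor a_f. As \<tau> preserves all parities, the additional a_i
  must be balanced by \<open>v\<close>.\<close>

lemma twisted_parity_moved:
  assumes "i \<noteq> f" "r = - c + gn f + c" "hm (pconj i {f}) r = - v + r + v"
  shows "(gn i + hm (pconj i {f}) c) + - (c + v) = 0 \<or> (gn i + hm (pconj i {f}) c) + - (c + v) = gn f"
    and "par i v"
proof -
  let ?h = "hm (pconj i {f})"
  have "- (gn i + ?h c) + gn f + (gn i + ?h c) = ?h r"
    using assms(2) by (simp add: hm_add hm_minus adm_pconj el_pconj minus_add add.assoc)
  also have "\<dots> = - (c + v) + gn f + (c + v)"
    using assms(2,3) by (simp add: minus_add add.assoc)
  finally show *: "(gn i + ?h c) + - (c + v) = 0 \<or> (gn i + ?h c) + - (c + v) = gn f"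
    by (rule conj_gn_eqD)
  have "par i ((gn i + ?h c) + - (c + v)) \<longleftrightarrow> \<not> par i v"
    by (auto simp: par_hm_pconj)
  then show "par i v" using * assms(1) by (metis par_0 par_gn)
qed

text \<open>The same comparison for a generator fixed by \<tau> has no additional factor a_i; only
  the letter \<open>k\<close>, coming from the centralizer, can be odd in \<open>v\<close>.\<close>

lemma twisted_parity_unmoved:
  assumes "k \<noteq> f" "r = - d + gn k + d" "hm (pconj i {f}) r = - v + r + v" "p \<noteq> k"
  shows "\<not> par p v"
proof -
  let ?h = "hm (pconj i {f})"
  have "- (?h d) + gn k + ?h d = ?h r"
    using assms(1,2) by (simp add: hm_add hm_minus adm_pconj el_pconj)
  also have "\<dots> = - (d + v) + gn k + (d + v)"
    using assms(2,3) by (simp add: minus_add add.assoc)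
  finally have *: "?h d + - (d + v) = 0 \<or> ?h d + - (d + v) = gn k"
    by (rule conj_gn_eqD)
  have "par p (?h d + - (d + v)) \<longleftrightarrow> par p v"
    by (auto simp: par_hm_pconj)
  then show ?thesis using * assms(4) by (metis par_0 par_gn)
qed

text \<open>As \<tau> fixes \<open>s\<close>, the element \<open>v\<close> commutes with
  \<open>s\<close>, so it is 1 or \<open>s\<close>. The latter is odd in \<open>j\<close>, which the
  parity statement for \<open>k\<close> excludes. Hence \<tau> fixes \<open>r\<close> too, and fixed
  words avoid \<open>f\<close>.\<close>

lemma twisted_unmoved_propagates:
  assumes "k \<noteq> f" "j \<noteq> k" "s = - d + gn j + d" "r = - c + gn k + c" "s \<in> WS (- {f})" "i \<noteq> f"
    and "hm (pconj i {f}) s = - v + s + v" "hm (pconj i {f}) r = - v + r + v"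
  shows "r \<in> WS (- {f})"
proof -
  have "\<not> par j v" by (rule twisted_parity_unmoved[OF assms(1,4,8,2)])
  have "- (d + v) + gn j + (d + v) = - d + gn j + d"
    using assms(3,7) hm_pconj_fix[OF assms(5)] by (simp add: minus_add add.assoc)
  then have "d + v + - d = 0 \<or> d + v + - d = gn j" by (rule conj_gn_eqD)
  moreover have "\<not> par j (d + v + - d)" using \<open>\<not> par j v\<close> by auto
  ultimately have "d + v + - d = 0" by (metis par_gn)
  then have "- d + (d + v + - d) + d = - d + 0 + d" by simp
  then have "v = 0" by (simp add: add.assoc)
  then have "hm (pconj i {f}) r = r" using assms(8) by simp
  then show ?thesis using hm_pconj_fixD assms(6) by blast
qed

text \<open>At the vertex \<open>i\<close> the element \<open>v\<close> centralizes a_i, and at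
  \<open>f\<close> it is odd in \<open>i\<close>; so it is a_i. The comparison at \<open>f\<close>,
  together with the parity of \<open>f\<close>, then gives a_i \<tau>(c) a_i = c.\<close>

lemma twisted_leaf:
  assumes "i \<noteq> f" "r = - c + gn f + c" "hm (pconj i {f}) r = - v + r + v"
    and "hm (pconj i {f}) (gn i) = - v + gn i + v"
  shows "c \<in> WS {i, f}"
proof -
  let ?h = "hm (pconj i {f})"
  have "- v + gn i + v = - 0 + gn i + 0" using assms(1,4) by (simp add: el_pconj)
  then have "v + - 0 = 0 \<or> v + - 0 = gn i" by (rule conj_gn_eqD)
  then have v: "v = gn i" using twisted_parity_moved(2)[OF assms(1-3)] by (metis add.right_neutral minus_zero par_0)
  have "par f ((gn i + ?h c) + - (c + v)) \<longleftrightarrow> False"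
    using assms(1) v by (auto simp: par_hm_pconj)
  then have "(gn i + ?h c) + - (c + gn i) = 0"
    using twisted_parity_moved(1)[OF assms(1-3)] v by (metis par_gn)
  then have "(gn i + ?h c) + - (c + gn i) + c + gn i + gn i = 0 + c + gn i + gn i" by simp
  then have *: "gn i + ?h c + gn i = c" by (simp add: add.assoc minus_add)
  \<comment> \<open>Conjugation by a_i after \<tau> fixes a_i and a_f and conjugates every other
    generator: it is again a partial conjugation, whose fixed words are known.\<close>
  have "hm (pconj i (- {i, f})) x = gn i + ?h x + gn i" for x
    by (rule additive_eqI[OF _ _ _ _ in_WS_UNIV])
      (use assms(1) in \<open>auto simp: hm_add adm_pconj el_pconj add.assoc\<close>)
  then have "c \<in> WS (- (- {i, f}))" using * by (intro hm_pconj_fixD[of i]) simp_all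
  then show ?thesis by simp
qed

subsection \<open>An action of the group on the integers\<close>

text \<open>The letters \<open>i\<close> and \<open>f\<close> act as the reflections of the integers in \<open>0\<close> and \<open>1/2\<close>,
  all other letters act trivially.\<close>

definition lact :: "nat \<Rightarrow> nat \<Rightarrow> nat \<Rightarrow> int \<Rightarrow> int" where
  "lact i f j z = (if j = i then - z else if j = f then 1 - z else z)"

definition act :: "nat \<Rightarrow> nat \<Rightarrow> wgrp \<Rightarrow> int \<Rightarrow> int" where
  "act i f x = foldr (lact i f) (rep x)"

lemma lact_simps [simp]:
  "lact i f i z = - z" "i \<noteq> f \<Longrightarrow> lact i f f z = 1 - z" "j \<noteq> i \<Longrightarrow> j \<noteq> f \<Longrightarrow> lact i f j z = z"
  by (simp_all add: lact_def)

lemma lact_lact [simp]: "lact i f j (lact i f j z) = z"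
  by (simp add: lact_def)

lemma foldr_lact_red: "foldr (lact i f) (red w) z = foldr (lact i f) w z"
proof (induction w)
  case (Cons x w)
  have "foldr (lact i f) (red (x # w)) z = lact i f x (foldr (lact i f) (red w) z)"
    by (auto split: list.split)
  then show ?case using Cons.IH by simp
qed simp

lemma act_el: "act i f (el w) z = foldr (lact i f) w z"
  by (simp add: act_def rep_el foldr_lact_red)

lemma act_add: "act i f (x + y) z = act i f x (act i f y z)"
  using act_el[of i f "rep x @ rep y" z] by (simp add: el_append) (simp add: act_def)

lemma act_0 [simp]: "act i f 0 z = z"
  by (simp add: act_def)

lemma act_gn [simp]: "act i f (gn j) z = lact i f j z"
  by (simp add: act_def)

lemma act_minus_cancel: "act i f (- x) (act i f x z) = z"
  by (simp flip: act_add)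

lemma act_affine: "\<exists>e t. (e = 1 \<or> e = -1) \<and> (\<forall>z. act i f x z = e * z + t)"
proof (induction x rule: wgrp_induct)
  case zero
  show ?case by (rule exI[of _ 1], rule exI[of _ 0]) simp
next
  case (gen j x)
  then obtain e t where et: "e = 1 \<or> e = -1" "\<And>z. act i f x z = e * z + t" by blast
  consider "j = i" | "j \<noteq> i" "j = f" | "j \<noteq> i" "j \<noteq> f" by blast
  then show ?case
  proof cases
    case 1
    then show ?thesis using et by (intro exI[of _ "- e"] exI[of _ "- t"]) (auto simp: act_add lact_def)
  next
    case 2
    then show ?thesis using et by (intro exI[of _ "- e"] exI[of _ "1 - t"]) (auto simp: act_add lact_def)
  next
    case 3
    then show ?thesis using et by (intro exI[of _ e] exI[of _ t]) (auto simp: act_add lact_def)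
  qed
qed

text \<open>Ping-pong: the reflection in 0 sends nonnegative integers to nonpositive ones, and the
  reflection in 1/2 sends nonpositive integers to positive ones.\<close>

lemma dihedral_word_bounds:
  assumes "i \<noteq> f" "distinct_adj d" "set d \<subseteq> {i, f}"
  shows "(d = [] \<or> hd d = i \<longrightarrow> foldr (lact i f) d 0 \<le> 0) \<and> (d \<noteq> [] \<and> hd d = f \<longrightarrow> foldr (lact i f) d 0 \<ge> 1)"
  using assms(2,3)
proof (induction d)
  case (Cons x d)
  have IH: "d = [] \<or> hd d = i \<Longrightarrow> foldr (lact i f) d 0 \<le> 0" "d \<noteq> [] \<Longrightarrow> hd d = f \<Longrightarrow> foldr (lact i f) d 0 \<ge> 1"
    using Cons by (auto simp: distinct_adj_Cons)
  have hd: "d = [] \<or> (hd d \<in> {i, f} \<and> hd d \<noteq> x)" using Cons.prems by (cases d) auto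
  have "x = i \<or> x = f" using Cons.prems by auto
  then show ?case
  proof
    assume x: "x = i"
    then have "foldr (lact i f) d 0 \<ge> 0" using hd IH by (cases "d = []") auto
    then show ?thesis using x assms(1) by simp
  next
    assume x: "x = f"
    then have "foldr (lact i f) d 0 \<le> 0" using hd IH by blast
    then show ?thesis using x assms(1) by simp
  qed
qed simp

text \<open>The image of a_f acts as a reflection that, like the one in 0, preserves the multiples
  of \<open>1 - 2 * t\<close>; the images of generators other than a_i and a_f act trivially. As
  \<alpha> is onto, a_f preserves these multiples as well, yet it moves 0 to 1. So
  \<open>1 - 2 * t\<close> is 1 or -1.\<close>

lemma dihedral_reflection_generates:
  assumes \<alpha>: "\<alpha> \<in> Aut0 n" and f: "f \<in> {1..n}" "f \<noteq> i" and i: "el (\<alpha> i) = gn i"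
    and c: "el (\<alpha> f) = - c + gn f + c" "c \<in> WS {i, f}"
  shows "el (\<alpha> f) = gn f \<or> el (\<alpha> f) = gn i + gn f + gn i"
proof -
  have a: "adm \<alpha>" using \<alpha> Aut0_adm by blast
  obtain d where d: "distinct_adj (rev d @ [f] @ d)" "set d \<subseteq> set (rep c)"
    "conjw (rep c) f = rev d @ [f] @ d" using conj_reduced_form by blast
  have "el (\<alpha> f) = el (conjw (rep c) f)" using c(1) by (simp add: el_conjw)
  then have r: "el (\<alpha> f) = - el d + gn f + el d"
    unfolding d(3) by (simp add: el_append el_rev el_Cons add.assoc)
  obtain e t where et: "e = 1 \<or> e = -1" "\<And>z. act i f (el d) z = e * z + t"
    using act_affine[of i f "el d"] by blast
  have inv: "act i f (- el d) y = e * (y - t)" for y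
  proof -
    have "act i f (el d) (e * (y - t)) = y" unfolding et(2) using et(1) by auto
    then show ?thesis using act_minus_cancel[of i f "el d" "e * (y - t)"] by simp
  qed
  have rf: "act i f (el (\<alpha> f)) z = e * (1 - 2 * t) - z" for z
    unfolding r act_add act_gn et(2) inv using f(2) et(1) by auto
  have gens: "(1 - 2 * t) dvd act i f (el (\<alpha> j)) z" if "(1 - 2 * t) dvd z" for j z
  proof -
    consider "j = i" | "j = f" | "j \<noteq> i" "j \<noteq> f" "j \<in> {1..n}" | "j \<noteq> i" "j \<noteq> f" "j \<notin> {1..n}" by blast
    then show ?thesis
    proof cases
      case 1
      then show ?thesis using that i by simp
    next
      case 2
      then show ?thesis using that rf by simp
    next
      case 3
      obtain b where "el (\<alpha> j) = - b + gn j + b" using EN_conj[OF Aut0_EN[OF \<alpha>] 3(3)] by blast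
      then have "act i f (el (\<alpha> j)) z = z" using 3 by (simp add: act_add act_minus_cancel)
      then show ?thesis using that by simp
    next
      case 4
      then have "el (\<alpha> j) = gn j" using EN_out[OF Aut0_EN[OF \<alpha>]] by blast
      then have "act i f (el (\<alpha> j)) z = z" using 4 by simp
      then show ?thesis using that by simp
    qed
  qed
  have all: "(1 - 2 * t) dvd act i f (hm \<alpha> x) 0" for x
    by (induction x rule: wgrp_induct) (simp_all add: hm_add[OF a] act_add gens)
  obtain x where "hm \<alpha> x = gn f"
    using \<alpha> f(1) unfolding Aut0_iff bij_betw_def by (metis WS_gn imageE)
  then have "(1 - 2 * t) dvd 1" using all[of x] f(2) by simp
  then have "1 - 2 * t = 1 \<or> 1 - 2 * t = -1" by (simp add: zdvd1_eq) linarith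
  then have t: "t = 0 \<or> t = 1" by auto
  \<comment> \<open>Since \<open>t\<close> is where the conjugator \<open>d\<close> sends 0,
    ping-pong leaves only the empty word and \<open>[i]\<close>: a longer \<open>d\<close> would
    begin with \<open>i\<close> and \<open>f\<close>, which gives \<open>t < 0\<close>.\<close>
  have t0: "foldr (lact i f) d 0 = t" using et(2)[of 0] by (simp add: act_el)
  have set: "set d \<subseteq> {i, f}" using d(2) WS_rep[OF c(2)] by blast
  have dd: "distinct_adj d" "d = [] \<or> hd d \<noteq> f"
    using d(1) by (auto simp: distinct_adj_append_iff distinct_adj_Cons)
  show ?thesis
  proof (cases d)
    case Nil
    then show ?thesis using r by simp
  next
    case (Cons x d')
    then have x: "x = i" using dd set by auto
    have "d' = []"
    proof (rule ccontr)
      assume "d' \<noteq> []"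
      then have "hd d' = f" using Cons dd(1) set x by (cases d') auto
      then have "foldr (lact i f) d' 0 \<ge> 1"
        using dihedral_word_bounds[of i f d'] f(2) \<open>d' \<noteq> []\<close> dd(1) set Cons by (auto simp: distinct_adj_Cons)
      then show False using t t0 Cons x by auto
    qed
    then show ?thesis using r Cons x by (simp add: el_Cons)
  qed
qed

subsection \<open>Normalizing the representative of a fixed vertex\<close>

text \<open>Conjugation by a_i is x_{i,D} with \<open>D\<close> all other letters, which no
  hyperedge obstructs. Thus a representative may be changed by any inner automorphism within its
  vertex.\<close>

lemma inner_CarG:
  assumes \<Lambda>: "\<And>E. E \<in> \<Lambda> \<Longrightarrow> E \<subseteq> {1..n}" and "n \<ge> 2" "w \<in> WS {1..n}"
  shows "\<exists>\<pi>\<in>CarG n \<Lambda>. \<forall>j\<in>{1..n}. el (\<pi> j) = w + gn j + - w"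
  using assms(3)
proof (induction rule: WS_induct)
  case zero
  show ?case by (rule bexI[OF _ CarG_id]) simp
next
  case (gen i x)
  let ?p = "pconj i ({1..n} - {i})"
  obtain \<pi> where \<pi>: "\<pi> \<in> CarG n \<Lambda>" "\<And>j. j \<in> {1..n} \<Longrightarrow> el (\<pi> j) = x + gn j + - x"
    using gen.IH by blast
  have ne: "{1..n} - {i} \<noteq> {}"
  proof -
    have "card {1..n} \<le> card {i}" if "{1..n} \<subseteq> {i}" by (rule card_mono[OF _ that]) simp
    then show ?thesis using assms(2) by auto
  qed
  have pc: "(i, {1..n} - {i}) \<in> PC n" using gen(1) ne unfolding PC_def by blast
  have cp: "compat \<Lambda> i ({1..n} - {i})" unfolding compat_def using \<Lambda> by blast
  have p: "?p \<in> CarG n \<Lambda>" by (rule CarG_pconj[OF \<Lambda> pc cp])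
  have conj: "hm ?p y = gn i + y + gn i" if "y \<in> WS {1..n}" for y
    using that
  proof (induction rule: WS_induct)
    case (gen j y)
    then show ?case by (cases "j = i") (simp_all add: hm_add adm_pconj el_pconj add.assoc)
  qed simp
  have "el (comp ?p \<pi> j) = gn i + x + gn j + - (gn i + x)" if j: "j \<in> {1..n}" for j
  proof -
    have "x + gn j + - x \<in> WS {1..n}" using gen(2) j by (intro WS_add WS_minus) simp_all
    then have "el (comp ?p \<pi> j) = gn i + (x + gn j + - x) + gn i"
      using conj by (simp only: el_comp[OF adm_pconj] \<pi>(2)[OF j])
    then show ?thesis by (simp add: minus_add add.assoc)
  qed
  then show ?case using CarG_comp[OF p \<pi>(1)] by blast
qed

text \<open>On a hyperedge through a leaf \<open>f\<close> the conjugator is odd in the letter 1,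
  whereas a vertex other than 1 and \<open>f\<close> would force it to be even there. So the
  hyperedge is \<open>{1, f}\<close>, and the remaining ones lie in \<open>{1..4}\<close>.\<close>

lemma fixed_hypertree:
  assumes n: "n \<ge> 5" and \<alpha>: "\<alpha> \<in> Aut0 n" and \<Lambda>: "\<Lambda> \<in> HT n"
    and fixed: "\<And>f. f \<in> {5..n} \<Longrightarrow> actK (pconj 1 {f}) (cls n \<alpha> \<Lambda>) = cls n \<alpha> \<Lambda>"
  obtains \<Theta> where "\<Theta> \<in> HT 4" "\<Lambda> = tildeHT n \<Theta>"
proof -
  note en = Aut0_EN[OF \<alpha>]
  have leaf: "E = {1, f}" if E: "E \<in> \<Lambda>" "f \<in> E" and f: "f \<in> {5..n}" for E f
  proof -
    have f1: "1 \<noteq> f" using f by auto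
    obtain v where v: "\<And>j. j \<in> E \<Longrightarrow> hm (pconj 1 {f}) (el (\<alpha> j)) = - v + el (\<alpha> j) + v"
      using fixed_edge_conj[OF \<alpha> \<Lambda> f1 fixed[OF f] E(1)] by blast
    have E_sub: "E \<subseteq> {1..n}" by (rule HT_edge[OF \<Lambda> E(1)])
    have "k = 1 \<or> k = f" if k: "k \<in> E" for k
    proof (rule ccontr)
      assume kk: "\<not> (k = 1 \<or> k = f)"
      obtain c where c: "el (\<alpha> f) = - c + gn f + c" using EN_conj[OF en] E E_sub by blast
      obtain d where d: "el (\<alpha> k) = - d + gn k + d" using EN_conj[OF en] k E_sub by blast
      have "par 1 v" by (rule twisted_parity_moved(2)[OF f1 c v[OF E(2)]])
      moreover have "\<not> par 1 v"
        by (rule twisted_parity_unmoved[OF _ d v[OF k]]) (use kk in auto)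
      ultimately show False by simp
    qed
    then have sub: "E \<subseteq> {1, f}" by blast
    have "card {1, f} \<le> card E" using HT_edge_card[OF \<Lambda> E(1)] f1 by simp
    then show ?thesis using card_seteq[OF _ sub] by simp
  qed
  define \<Theta> where "\<Theta> = {E \<in> \<Lambda>. E \<subseteq> {1..4}}"
  have \<Theta>: "\<And>E. E \<in> \<Theta> \<Longrightarrow> E \<subseteq> {1..4}" by (simp add: \<Theta>_def)
  have leaf_in: "{1, f} \<in> \<Lambda>" if f: "f \<in> {5..n}" for f
  proof -
    have "f \<in> {1..n}" "1 \<in> {1..n}" "f \<noteq> 1" using f by auto
    then obtain E where "E \<in> \<Lambda>" "f \<in> E" using HT_edge_at[OF \<Lambda>, of f 1] by blast
    then show ?thesis using leaf[OF _ _ f] by metis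
  qed
  have "E \<in> tildeHT n \<Theta>" if E: "E \<in> \<Lambda>" for E
  proof (cases "E \<subseteq> {1..4}")
    case True
    then show ?thesis using E by (simp add: tildeHT_edge \<Theta>_def)
  next
    case False
    then obtain f where f: "f \<in> E" "f \<notin> {1..4}" by blast
    have "f \<in> {1..n}" using HT_edge[OF \<Lambda> E] f(1) by blast
    then have "f \<in> {5..n}" using f(2) by auto
    then show ?thesis using leaf[OF E f(1)] unfolding tildeHT_edge by blast
  qed
  moreover have "E \<in> \<Lambda>" if "E \<in> tildeHT n \<Theta>" for E
    using that leaf_in unfolding tildeHT_edge \<Theta>_def by blast
  ultimately have eq: "\<Lambda> = tildeHT n \<Theta>" by blast
  have "\<Theta> \<in> HT 4" using tildeHT_HT_iff[OF \<Theta>, where n = n] n \<Lambda> eq by simp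
  then show ?thesis using eq that by blast
qed

text \<open>Injectivity on W_4 is inherited from W_n. For surjectivity, a preimage in W_n is pushed
  into W_4 by the retraction, which intertwines \<alpha> with \<beta> because the leaves are
  fixed.\<close>

lemma restrict_to_Aut0:
  assumes n: "n \<ge> 5" and \<alpha>: "\<alpha> \<in> Aut0 n" and one: "el (\<alpha> 1) = gn 1"
    and leaves: "\<And>f. f \<in> {5..n} \<Longrightarrow> el (\<alpha> f) = gn f"
    and inner: "\<And>j. j \<in> {1..4} \<Longrightarrow> el (\<alpha> j) \<in> WS {1..4}"
  obtains \<beta> where "\<beta> \<in> Aut0 4" "\<alpha> = iota n \<beta>"
proof -
  let ?K = "hm (restr {1..4})"
  note en = Aut0_EN[OF \<alpha>] and na = Aut0_nice[OF \<alpha>] and aa = Aut0_adm[OF \<alpha>]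
  define \<beta> where "\<beta> j = (if j \<in> {1..4} then \<alpha> j else [j])" for j
  have el\<beta>: "el (\<beta> j) = (if j \<in> {1..4} then el (\<alpha> j) else gn j)" for j
    by (simp add: \<beta>_def gn_def)
  have "nice \<beta>"
    using na unfolding nice_def adm_def el\<beta> by (simp add: \<beta>_def)
  then have \<beta>: "\<beta> \<in> EN 4"
  proof (rule EN_I)
    show "\<exists>c\<in>WS {1..4}. el (\<beta> j) = - c + gn j + c" if j: "j \<in> {1..4}" for j
    proof -
      have "j \<in> {1..n}" using j n by auto
      then obtain c where c: "el (\<alpha> j) = - c + gn j + c" using EN_conj[OF en] by blast
      have "el (\<alpha> j) = ?K (el (\<alpha> j))" by (rule hm_restr_id[OF inner[OF j], symmetric])
      also have "\<dots> = - ?K c + ?K (gn j) + ?K c" unfolding c by (simp add: hm_add hm_minus adm_restr)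
      also have "?K (gn j) = gn j" using j by (intro hm_restr_id) simp
      finally show ?thesis using j hm_restr_WS by (auto simp: el\<beta>)
    qed
  qed (simp only: el\<beta> if_False)
  have ab: "adm \<beta>" using \<beta> EN_nice nice_adm by blast
  have agree: "hm \<beta> x = hm \<alpha> x" if "x \<in> WS {1..4}" for x
    by (rule additive_eqI[OF _ _ _ _ that]) (simp_all only: hm_0 hm_add[OF ab] hm_add[OF aa] hm_gn el\<beta> if_True)
  have bij: "bij_betw (hm \<alpha>) (WS {1..n}) (WS {1..n})" using \<alpha> by (simp add: Aut0_iff)
  have sub: "WS {1..4} \<subseteq> WS {1..n}" using n by (intro WS_mono) auto
  have killed: "?K (hm \<alpha> x) = hm \<beta> (?K x)" if "x \<in> WS {1..n}" for x
  proof (rule additive_eqI[OF _ _ _ _ that])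
    fix j assume j: "j \<in> {1..n}"
    show "?K (hm \<alpha> (gn j)) = hm \<beta> (?K (gn j))"
    proof (cases "j \<in> {1..4}")
      case True
      have "?K (gn j) = gn j" using True by (intro hm_restr_id) simp
      moreover have "?K (hm \<alpha> (gn j)) = hm \<alpha> (gn j)" using inner[OF True] by (intro hm_restr_id) simp
      moreover have "hm \<beta> (gn j) = hm \<alpha> (gn j)" using True by (intro agree) simp
      ultimately show ?thesis by simp
    next
      case False
      then have "el (\<alpha> j) = gn j" using leaves j by auto
      then show ?thesis by (simp only: hm_gn el_restr False if_False hm_0)
    qed
  qed (simp_all add: hm_add ab aa adm_restr)
  have "inj_on (hm \<beta>) (WS {1..4})"
  proof -
    have "inj_on (hm \<alpha>) (WS {1..4})" 
      by (rule inj_on_subset[OF bij_betw_imp_inj_on[OF bij] sub])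
    then show ?thesis using agree by (simp add: inj_on_def)
  qed
  moreover have "hm \<beta> ` WS {1..4} = WS {1..4}"
  proof
    show "hm \<beta> ` WS {1..4} \<subseteq> WS {1..4}" using EN_WS[OF \<beta>] by blast
    show "WS {1..4} \<subseteq> hm \<beta> ` WS {1..4}"
    proof
      fix y assume y: "y \<in> WS {1..4}"
      then have "y \<in> hm \<alpha> ` WS {1..n}" using bij sub by (auto simp: bij_betw_def)
      then obtain x where x: "x \<in> WS {1..n}" "y = hm \<alpha> x" by blast
      have "y = hm \<beta> (?K x)" using hm_restr_id[OF y] killed[OF x(1)] x(2) by simp
      then show "y \<in> hm \<beta> ` WS {1..4}" using hm_restr_WS by blast
    qed
  qed
  ultimately have \<beta>A: "\<beta> \<in> Aut0 4" using \<beta> by (simp add: Aut0_iff bij_betw_def)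
  \<comment> \<open>The word for the image of a_1 has an empty second half, so \<open>iota\<close>
    gives the leaves the trivial conjugator, in accordance with \<alpha>.\<close>
  have b1: "\<beta> 1 = [1]" using nice_eq[OF na, of 1] one by (simp add: \<beta>_def)
  have "\<alpha> = iota n \<beta>"
  proof (rule HOL.ext)
    fix j
    consider "j \<in> {5..n}" | "j \<in> {1..4}" "j \<notin> {5..n}" | "j \<notin> {1..n}" "j \<notin> {1..4}" "j \<notin> {5..n}"
      using n by fastforce
    then show "\<alpha> j = iota n \<beta> j"
    proof cases
      case 1
      then have "\<alpha> j = [j]" using nice_eq[OF na, of j] leaves by simp
      then show ?thesis using 1 by (simp only: iota_def b1 if_True) (simp add: conjw_def)
    next
      case 2
      then show ?thesis by (simp only: iota_def \<beta>_def if_True if_False)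
    next
      case 3
      then have "\<alpha> j = [j]" using nice_eq[OF na, of j] EN_out[OF en 3(1)] by simp
      then show ?thesis using 3 by (simp only: iota_def \<beta>_def if_True if_False)
    qed
  qed
  then show ?thesis using \<beta>A that by blast
qed

lemma fixed_vertex_in_Vsub:
  assumes n: "n \<ge> 5" and v: "v \<in> VK n" and fixed: "\<And>f. f \<in> {5..n} \<Longrightarrow> actK (pconj 1 {f}) v = v"
  shows "v \<in> Vsub n"
proof -
  obtain \<alpha>0 \<Lambda> where \<alpha>0: "\<alpha>0 \<in> Aut0 n" and \<Lambda>: "\<Lambda> \<in> HT n" and v0: "v = cls n \<alpha>0 \<Lambda>"
    using VK_D[OF v] by blast
  obtain \<Theta> where \<Theta>: "\<Theta> \<in> HT 4" and eq: "\<Lambda> = tildeHT n \<Theta>"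
    using fixed_hypertree[OF n \<alpha>0 \<Lambda>] fixed v0 by blast
  have \<Theta>_sub: "\<And>E. E \<in> \<Theta> \<Longrightarrow> E \<subseteq> {1..4}" using HT_edge[OF \<Theta>] by blast
  have one: "1 \<in> {1..n}" using n by auto
  obtain c where c: "c \<in> WS {1..n}" "el (\<alpha>0 1) = - c + gn 1 + c"
    using EN_conj[OF Aut0_EN[OF \<alpha>0] one] by blast
  have "hm \<alpha>0 ` WS {1..n} = WS {1..n}" using \<alpha>0 by (simp add: Aut0_iff bij_betw_def)
  \<comment> \<open>Conjugating by a preimage of \<open>c\<close> before applying \<alpha>0 makes
    the image of a_1 equal to a_1; this change is inner, hence stays within the vertex.\<close>
  then obtain w where w: "w \<in> WS {1..n}" "hm \<alpha>0 w = c" using c(1) by (metis imageE)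
  have "n \<ge> 2" using n by simp
  have "\<exists>\<pi>\<in>CarG n \<Lambda>. \<forall>j\<in>{1..n}. el (\<pi> j) = w + gn j + - w"
    by (rule inner_CarG[OF HT_edge[OF \<Lambda>] \<open>n \<ge> 2\<close> w(1)])
  then obtain \<pi> where \<pi>: "\<pi> \<in> CarG n \<Lambda>" "\<And>j. j \<in> {1..n} \<Longrightarrow> el (\<pi> j) = w + gn j + - w"
    by blast
  define \<alpha>1 where "\<alpha>1 = comp \<alpha>0 \<pi>"
  have \<alpha>1: "\<alpha>1 \<in> Aut0 n" unfolding \<alpha>1_def by (rule Aut0_comp[OF \<alpha>0 CarG_Aut0[OF \<pi>(1)]])
  have v1: "v = cls n \<alpha>1 \<Lambda>"
    unfolding v0 \<alpha>1_def by (rule cls_comp_CarG[OF Aut0_nice[OF \<alpha>0] \<pi>(1), symmetric])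
  have \<alpha>1_1: "el (\<alpha>1 1) = gn 1"
    unfolding \<alpha>1_def el_comp[OF Aut0_adm[OF \<alpha>0]] \<pi>(2)[OF one]
    using c(2) w(2) by (simp add: hm_add hm_minus Aut0_adm[OF \<alpha>0] add.assoc)
  have leaf1: "el (\<alpha>1 f) = gn f \<or> el (\<alpha>1 f) = gn 1 + gn f + gn 1" if f: "f \<in> {5..n}" for f
  proof -
    have f': "f \<in> {1..n}" "1 \<noteq> f" "{1, f} \<in> \<Lambda>" using f eq by (auto simp: tildeHT_edge)
    obtain u where u: "\<And>j. j \<in> {1, f} \<Longrightarrow> hm (pconj 1 {f}) (el (\<alpha>1 j)) = - u + el (\<alpha>1 j) + u"
      using fixed_edge_conj[OF \<alpha>1 \<Lambda> f'(2) _ f'(3)] fixed[OF f] v1 by blast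
    obtain d where d: "el (\<alpha>1 f) = - d + gn f + d" using EN_conj[OF Aut0_EN[OF \<alpha>1] f'(1)] by blast
    have "d \<in> WS {1, f}"
    proof (rule twisted_leaf[OF f'(2) d])
      show "hm (pconj 1 {f}) (el (\<alpha>1 f)) = - u + el (\<alpha>1 f) + u" by (rule u) simp
      show "hm (pconj 1 {f}) (gn 1) = - u + gn 1 + u" using u[of 1] unfolding \<alpha>1_1 by simp
    qed
    then show ?thesis using dihedral_reflection_generates[OF \<alpha>1 f'(1) _ \<alpha>1_1 d] f'(2) by simp
  qed
  \<comment> \<open>The leaves with image a_1 a_f a_1; the carried x_{1,D} corrects all of them at
    once and leaves a_1 alone.\<close>
  define D where "D = {f \<in> {5..n}. el (\<alpha>1 f) \<noteq> gn f}"
  have D: "D \<subseteq> {5..n}" by (auto simp: D_def)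
  have D1: "1 \<notin> D" by (auto simp: D_def)
  have \<rho>: "pconj 1 D \<in> CarG n \<Lambda>"
  proof (cases "D = {}")
    case True
    then show ?thesis by (simp add: pconj_empty CarG_id)
  next
    case False
    then show ?thesis unfolding eq using leaf_twist_CarG[of \<Theta> n D] \<Theta>_sub n D by blast
  qed
  define \<alpha> where "\<alpha> = comp \<alpha>1 (pconj 1 D)"
  have \<alpha>: "\<alpha> \<in> Aut0 n" unfolding \<alpha>_def by (rule Aut0_comp[OF \<alpha>1 CarG_Aut0[OF \<rho>]])
  have v2: "v = cls n \<alpha> \<Lambda>"
    unfolding v1 \<alpha>_def by (rule cls_comp_CarG[OF Aut0_nice[OF \<alpha>1] \<rho>, symmetric])
  have el\<alpha>: "el (\<alpha> j) = (if j \<in> D then gn 1 + el (\<alpha>1 j) + gn 1 else el (\<alpha>1 j))" for j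
    by (simp add: \<alpha>_def el_comp Aut0_adm[OF \<alpha>1] el_pconj hm_add \<alpha>1_1 del: One_nat_def)
  have \<alpha>_1: "el (\<alpha> 1) = gn 1" using D1 \<alpha>1_1 by (simp add: el\<alpha>)
  have \<alpha>_f: "el (\<alpha> f) = gn f" if f: "f \<in> {5..n}" for f
  proof (cases "f \<in> D")
    case True
    then have "el (\<alpha>1 f) = gn 1 + gn f + gn 1" using leaf1[OF f] by (auto simp: D_def)
    then show ?thesis using True by (simp add: el\<alpha> add.assoc)
  next
    case False
    then show ?thesis using f by (simp add: el\<alpha> D_def)
  qed
  \<comment> \<open>The property holds at the vertex 1, whose generator is fixed, and is passed on
    within every hyperedge of \<Theta>, all of which are hyperedges of \<Lambda>.\<close>
  have avoid: "el (\<alpha> j) \<in> WS (- {f})" if f: "f \<in> {5..n}" and j: "j \<in> {1..4}" for f j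
  proof (rule HT_connected_induct[OF \<Theta>, of 1 j])
    show "el (\<alpha> 1) \<in> WS (- {f})" using \<alpha>_1 f by auto
  next
    fix E i k assume E: "E \<in> \<Theta>" "i \<in> E" "k \<in> E" and i: "el (\<alpha> i) \<in> WS (- {f})"
    show "el (\<alpha> k) \<in> WS (- {f})"
    proof (cases "i = k")
      case True
      then show ?thesis using i by simp
    next
      case False
      have ik: "i \<in> {1..4}" "k \<in> {1..4}" using \<Theta>_sub[OF E(1)] E by blast+
      then have ikn: "i \<in> {1..n}" "k \<in> {1..n}" "k \<noteq> f" using n f by auto
      have f1: "1 \<noteq> f" using f by auto
      have "E \<in> \<Lambda>" using E(1) eq by (simp add: tildeHT_edge)
      then obtain u where u: "\<And>j. j \<in> E \<Longrightarrow> hm (pconj 1 {f}) (el (\<alpha> j)) = - u + el (\<alpha> j) + u"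
        using fixed_edge_conj[OF \<alpha> \<Lambda> f1] fixed[OF f] v2 by blast
      obtain d where d: "el (\<alpha> i) = - d + gn i + d" using EN_conj[OF Aut0_EN[OF \<alpha>] ikn(1)] by blast
      obtain b where b: "el (\<alpha> k) = - b + gn k + b" using EN_conj[OF Aut0_EN[OF \<alpha>] ikn(2)] by blast
      show ?thesis
        by (rule twisted_unmoved_propagates[OF ikn(3) False d b i f1 u[OF E(2)] u[OF E(3)]])
    qed
  qed (use j in auto)
  have in_n: "el (\<alpha> j) \<in> WS {1..n}" if j: "j \<in> {1..4}" for j
    using EN_WS[OF Aut0_EN[OF \<alpha>], of "gn j"] j n by auto
  have inner: "el (\<alpha> j) \<in> WS {1..4}" if j: "j \<in> {1..4}" for j
  proof -
    have "x \<in> {1..4}" if x: "x \<in> set (rep (el (\<alpha> j)))" for x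
    proof (rule ccontr)
      assume "x \<notin> {1..4}"
      moreover have "x \<in> {1..n}" using WS_rep[OF in_n[OF j]] x by blast
      ultimately have "x \<in> {5..n}" by auto
      then show False using WS_rep[OF avoid[OF _ j]] x by blast
    qed
    then show ?thesis unfolding WS_def by blast
  qed
  obtain \<beta> where "\<beta> \<in> Aut0 4" "\<alpha> = iota n \<beta>"
    using restrict_to_Aut0[OF n \<alpha> \<alpha>_1 \<alpha>_f inner] by blast
  then show ?thesis using v2 eq \<Theta> unfolding Vsub_def by blast
qed

text \<open>The conjugator \<open>C\<close> contains no leaf letter and is applied to a_1 and a_f
  alike, so conjugating a_f by a_1 before or after makes no difference. The other generators have
  images without \<open>f\<close>, which the involution fixes.\<close>

lemma iota_commutes_leaf:
  assumes n: "n \<ge> 5" and \<alpha>: "\<alpha> \<in> Aut0 4" and f: "f \<in> {5..n}"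
  shows "comp (pconj 1 {f}) (iota n \<alpha>) = comp (iota n \<alpha>) (pconj 1 {f})"
proof -
  have en: "\<alpha> \<in> EN 4" by (rule Aut0_EN[OF \<alpha>])
  have f1: "1 \<notin> {f}" using f by auto
  have ni: "nice (iota n \<alpha>)" "nice (pconj 1 {f})"
    using iota_Aut0[OF \<alpha> n] Aut0_nice nice_pconj[OF f1] by blast+
  note a = nice_adm[OF ni(1)] nice_adm[OF ni(2)]
  obtain C where C: "C \<in> WS {1..4}" "el (\<alpha> 1) = - C + gn 1 + C"
    "\<And>j. el (iota n \<alpha> j) = (if j \<in> {5..n} then - C + gn j + C else el (\<alpha> j))"
    using iota_conj[OF en] by metis
  have sub: "WS {1..4} \<subseteq> WS (- {f})" using f by (intro WS_mono) auto
  then have C': "C \<in> WS (- {f})" using C(1) by blast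
  have i1: "el (iota n \<alpha> 1) = - C + gn 1 + C" using C(2) C(3)[of 1] by simp
  show ?thesis
  proof (rule nice_eqI)
    fix j
    show "el (comp (pconj 1 {f}) (iota n \<alpha>) j) = el (comp (iota n \<alpha>) (pconj 1 {f}) j)"
    proof (cases "j = f")
      case True
      then have j: "el (iota n \<alpha> j) = - C + gn j + C" using C(3) f by simp
      have "el (comp (pconj 1 {f}) (iota n \<alpha>) j) = - C + (gn 1 + gn j + gn 1) + C"
        unfolding el_comp[OF a(2)] j using True
        by (simp add: hm_add hm_minus a hm_pconj_fix[OF C'] el_pconj del: One_nat_def)
      moreover have "el (comp (iota n \<alpha>) (pconj 1 {f}) j)
          = (- C + gn 1 + C) + (- C + gn j + C) + (- C + gn 1 + C)"
        unfolding el_comp[OF a(1)] using True i1 j by (simp add: hm_add a el_pconj del: One_nat_def)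
      ultimately show ?thesis by (simp add: add.assoc)
    next
      case False
      have "el (iota n \<alpha> j) \<in> WS (- {f})"
      proof (cases "j \<in> {5..n}")
        case True
        then have "el (iota n \<alpha> j) = - C + gn j + C" using C(3) by simp
        then show ?thesis using C' False by (auto intro!: WS_add WS_minus)
      next
        case j: False
        then have ij: "el (iota n \<alpha> j) = el (\<alpha> j)" using C(3)[of j] by (simp only: if_False)
        show ?thesis
        proof (cases "j \<in> {1..4}")
          case True
          then show ?thesis using EN_WS[OF en, of "gn j"] sub ij by auto
        next
          case F: False
          then show ?thesis using EN_out[OF en F] ij False by simp
        qed
      qed
      then show ?thesis using False by (simp add: el_comp a hm_pconj_fix el_pconj del: One_nat_def)
    qed
  qed (use ni nice_comp in blast)+
qed

text \<open>Moving the involution past \<open>iota n \<alpha>\<close> turns the left action into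
  right multiplication by x_{1,{f}}, which \<open>tildeHT n \<Theta>\<close> carries.\<close>

lemma Vsub_fixed:
  assumes n: "n \<ge> 5" and v: "v \<in> Vsub n" and f: "f \<in> {5..n}"
  shows "actK (pconj 1 {f}) v = v"
proof -
  obtain \<alpha> \<Theta> where \<alpha>: "\<alpha> \<in> Aut0 4" and \<Theta>: "\<Theta> \<in> HT 4" and v: "v = cls n (iota n \<alpha>) (tildeHT n \<Theta>)"
    using v unfolding Vsub_def by blast
  have ni: "nice (iota n \<alpha>)" by (rule Aut0_nice[OF iota_Aut0[OF \<alpha> n]])
  have "1 \<notin> {f}" using f by auto
  then have "actK (pconj 1 {f}) v = cls n (comp (iota n \<alpha>) (pconj 1 {f})) (tildeHT n \<Theta>)"
    unfolding v iota_commutes_leaf[OF n \<alpha> f, symmetric] by (intro actK_cls nice_pconj ni)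
  also have "\<dots> = v"
    unfolding v using f by (intro cls_comp_CarG[OF ni] leaf_twist_CarG[OF HT_edge[OF \<Theta>] n]) auto
  finally show ?thesis .
qed

section \<open>The fixed point set and the isomorphism\<close>

lemma vertex_eq_iff:
  assumes n: "n \<ge> 5" and "\<alpha> \<in> Aut0 4" "\<beta> \<in> Aut0 4" "\<Theta> \<in> HT 4" "\<Lambda> \<in> HT 4"
  shows "cls n (iota n \<alpha>) (tildeHT n \<Theta>) = cls n (iota n \<beta>) (tildeHT n \<Lambda>)
    \<longleftrightarrow> cls 4 \<alpha> \<Theta> = cls 4 \<beta> \<Lambda>"
proof -
  have ni: "nice (iota n \<alpha>)" "nice (iota n \<beta>)" "nice \<alpha>" "nice \<beta>"
    using iota_Aut0[OF assms(2) n] iota_Aut0[OF assms(3) n] assms Aut0_nice by auto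
  have "tildeHT n \<Theta> = tildeHT n \<Lambda> \<longleftrightarrow> \<Theta> = \<Lambda>"
    by (rule tildeHT_inj[OF HT_edge[OF assms(4)] HT_edge[OF assms(5)]])
  moreover have "(\<exists>\<pi>\<in>CarG n (tildeHT n \<Theta>). iota n \<beta> = comp (iota n \<alpha>) \<pi>)
      \<longleftrightarrow> (\<exists>\<pi>\<in>CarG 4 \<Theta>. \<beta> = comp \<alpha> \<pi>)"
    by (rule iota_coset_iff[OF HT_edge[OF assms(4)] n assms(2,3)])
  ultimately show ?thesis
    unfolding cls_eq_iff[OF ni(1,2)] cls_eq_iff[OF ni(3,4)] by (simp only:)
qed

lemma tildeHT_HT: "n \<ge> 5 \<Longrightarrow> \<Theta> \<in> HT 4 \<Longrightarrow> tildeHT n \<Theta> \<in> HT n"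
  using tildeHT_HT_iff[of \<Theta> n] HT_edge[of \<Theta> 4] by simp

lemma vertex_le_iff:
  assumes n: "n \<ge> 5" and "\<alpha> \<in> Aut0 4" "\<beta> \<in> Aut0 4" "\<Theta> \<in> HT 4" "\<Lambda> \<in> HT 4"
  shows "leK n (cls n (iota n \<alpha>) (tildeHT n \<Theta>)) (cls n (iota n \<beta>) (tildeHT n \<Lambda>))
    \<longleftrightarrow> leK 4 (cls 4 \<alpha> \<Theta>) (cls 4 \<beta> \<Lambda>)"
proof -
  have ht: "ht_le (tildeHT n \<Theta>) (tildeHT n \<Lambda>) \<longleftrightarrow> ht_le \<Theta> \<Lambda>"
  proof
    assume t: "ht_le (tildeHT n \<Theta>) (tildeHT n \<Lambda>)"
    have edges: "\<forall>E\<in>\<Lambda>. E \<subseteq> {1..4} \<and> card E \<ge> 2"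
      using HT_edge[OF assms(5)] HT_edge_card[OF assms(5)] by simp
    show "ht_le \<Theta> \<Lambda>" by (rule ht_le_tildeD[OF HT_edge[OF assms(4)] edges t])
  next
    assume le: "ht_le \<Theta> \<Lambda>"
    show "ht_le (tildeHT n \<Theta>) (tildeHT n \<Lambda>)"
      by (rule ht_le_tildeI[OF HT_edge[OF assms(5)] le])
  qed
  have "(\<exists>\<pi>\<in>CarG n (tildeHT n \<Lambda>). iota n \<beta> = comp (iota n \<alpha>) \<pi>)
      \<longleftrightarrow> (\<exists>\<pi>\<in>CarG 4 \<Lambda>. \<beta> = comp \<alpha> \<pi>)"
    by (rule iota_coset_iff[OF HT_edge[OF assms(5)] n assms(2,3)])
  with ht show ?thesis
    unfolding leK_iff[OF assms(2-5)]
      leK_iff[OF iota_Aut0[OF assms(2) n] iota_Aut0[OF assms(3) n]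
        tildeHT_HT[OF n assms(4)] tildeHT_HT[OF n assms(5)]] by (simp only:)
qed

section \<open>The action on vertices and the fixed points of the realization\<close>

lemma actK_VK:
  assumes "\<phi> \<in> Aut0 n" "v \<in> VK n"
  shows "actK \<phi> v \<in> VK n"
proof -
  obtain \<alpha> \<Theta> where "\<alpha> \<in> Aut0 n" "\<Theta> \<in> HT n" and v: "v = cls n \<alpha> \<Theta>" using VK_D[OF assms(2)] by blast
  moreover from this have "actK \<phi> v = cls n (comp \<phi> \<alpha>) \<Theta>"
    unfolding v using assms(1) by (intro actK_cls Aut0_nice)
  ultimately show ?thesis unfolding VK_def using Aut0_comp[OF assms(1)] by blast
qed

lemma actK_comp:
  assumes "\<phi> \<in> Aut0 n" "\<psi> \<in> Aut0 n" "v \<in> VK n"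
  shows "actK (comp \<phi> \<psi>) v = actK \<phi> (actK \<psi> v)"
proof -
  obtain \<alpha> \<Theta> where \<alpha>: "\<alpha> \<in> Aut0 n" and v: "v = cls n \<alpha> \<Theta>" using VK_D[OF assms(3)] by blast
  note n = Aut0_nice[OF assms(1)] Aut0_nice[OF assms(2)] Aut0_nice[OF \<alpha>]
  show ?thesis
    unfolding v using n by (simp add: actK_cls nice_comp comp_assoc)
qed

lemma actK_idE: "v \<in> VK n \<Longrightarrow> actK idE v = v"
  using VK_D[of v n] by (auto simp: actK_cls Aut0_nice)

text \<open>The action preserves hypertrees, and two comparable vertices with the same hypertree coincide.\<close>

lemma comparable_translate_eq:
  assumes \<phi>: "\<phi> \<in> Aut0 n" and v: "v \<in> VK n"
    and "leK n v (actK \<phi> v) \<or> leK n (actK \<phi> v) v"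
  shows "actK \<phi> v = v"
proof -
  obtain \<alpha> \<Theta> where \<alpha>: "\<alpha> \<in> Aut0 n" and \<Theta>: "\<Theta> \<in> HT n" and v: "v = cls n \<alpha> \<Theta>"
    using VK_D[OF v] by blast
  have a: "actK \<phi> v = cls n (comp \<phi> \<alpha>) \<Theta>"
    unfolding v using \<phi> \<alpha> by (intro actK_cls Aut0_nice)
  have \<phi>\<alpha>: "comp \<phi> \<alpha> \<in> Aut0 n" by (rule Aut0_comp[OF \<phi> \<alpha>])
  from assms(3) show ?thesis
  proof
    assume "leK n v (actK \<phi> v)"
    then have "\<exists>\<pi>\<in>CarG n \<Theta>. comp \<phi> \<alpha> = comp \<alpha> \<pi>"
      unfolding a unfolding v leK_iff[OF \<alpha> \<phi>\<alpha> \<Theta> \<Theta>] by (rule conjunct2)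
    then have "cls n \<alpha> \<Theta> = cls n (comp \<phi> \<alpha>) \<Theta>"
      unfolding cls_eq_iff[OF Aut0_nice[OF \<alpha>] Aut0_nice[OF \<phi>\<alpha>]] by simp
    then show ?thesis unfolding a unfolding v by simp
  next
    assume "leK n (actK \<phi> v) v"
    then have "\<exists>\<pi>\<in>CarG n \<Theta>. \<alpha> = comp (comp \<phi> \<alpha>) \<pi>"
      unfolding a unfolding v leK_iff[OF \<phi>\<alpha> \<alpha> \<Theta> \<Theta>] by (rule conjunct2)
    then have "cls n (comp \<phi> \<alpha>) \<Theta> = cls n \<alpha> \<Theta>"
      unfolding cls_eq_iff[OF Aut0_nice[OF \<phi>\<alpha>] Aut0_nice[OF \<alpha>]] by simp
    then show ?thesis unfolding a unfolding v .
  qed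
qed

lemma leaf_involution_Aut0: "f \<in> {5..n} \<Longrightarrow> pconj 1 {f} \<in> Aut0 n"
  by (rule pconj_Aut0) auto

text \<open>Invariant coordinates put a vertex of the support and its translate into one simplex, so
  they are comparable and therefore equal. Each leaf involution thus fixes the support vertex by
  vertex.\<close>

lemma fixed_point_support:
  assumes n: "n \<ge> 5" and p: "p \<in> realiz (VK n) (leK n)"
    and fixed: "\<forall>g\<in>Gsub n. \<forall>v\<in>VK n. p (actK g v) = p v" and v: "p v \<noteq> 0"
  shows "v \<in> Vsub n"
proof -
  have supp: "u \<in> VK n" "leK n u w \<or> leK n w u" if "p u \<noteq> 0" "p w \<noteq> 0" for u w
    using p that unfolding realiz_def is_simplex_def by blast+
  note vK = supp(1)[OF v v]
  show ?thesis
  proof (rule fixed_vertex_in_Vsub[OF n vK])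
    fix f assume f: "f \<in> {5..n}"
    let ?t = "pconj 1 {f}"
    have t: "?t \<in> Aut0 n" by (rule leaf_involution_Aut0[OF f])
    have "?t \<in> Gsub n"
      unfolding Gsub_def by (rule gen_incl) (use f t Aut0_nice in blast)+
    then have "p (actK ?t v) \<noteq> 0" using fixed vK v by simp
    then show "actK ?t v = v"
      by (intro comparable_translate_eq[OF t vK] supp(2)[OF v])
  qed
qed

text \<open>An involution that fixes \<open>Vsub n\<close> pointwise cannot move another vertex into
  it, and off \<open>Vsub n\<close> the coordinates vanish. So invariance under a generator holds on
  all of \<open>VK n\<close>, and it passes to products.\<close>

lemma supported_point_fixed:
  assumes n: "n \<ge> 5" and p: "{v. p v \<noteq> 0} \<subseteq> Vsub n" and "g \<in> Gsub n" "v \<in> VK n"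
  shows "p (actK g v) = p v"
proof -
  have leaf: "p (actK (pconj 1 {f}) u) = p u" if f: "f \<in> {5..n}" and u: "u \<in> VK n" for f u
  proof (cases "u \<in> Vsub n")
    case True
    then show ?thesis using Vsub_fixed[OF n _ f] by simp
  next
    case False
    let ?t = "pconj 1 {f}"
    have t: "?t \<in> Aut0 n" by (rule leaf_involution_Aut0[OF f])
    have "1 \<notin> {f}" using f by auto
    then have "actK ?t (actK ?t u) = u"
      using actK_comp[OF t t u] pconj_involution[of 1 "{f}"] actK_idE[OF u] by simp
    then have "actK ?t u \<notin> Vsub n" using Vsub_fixed[OF n _ f] False by metis
    then have "p (actK ?t u) = 0" "p u = 0" using p False by blast+
    then show ?thesis by simp
  qed
  have "g \<in> Aut0 n \<and> (\<forall>u\<in>VK n. p (actK g u) = p u)"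
    using assms(3) unfolding Gsub_def
  proof (induction rule: gen.induct)
    case gen_id
    then show ?case using idE_Aut0 actK_idE by simp
  next
    case (gen_step a g)
    then obtain f where f: "f \<in> {5..n}" "a = pconj 1 {f}" by blast
    have a: "a \<in> Aut0 n" unfolding f(2) by (rule leaf_involution_Aut0[OF f(1)])
    have g: "g \<in> Aut0 n" "\<And>u. u \<in> VK n \<Longrightarrow> p (actK g u) = p u" using gen_step.IH by blast+
    have "p (actK (comp a g) u) = p u" if u: "u \<in> VK n" for u
      unfolding actK_comp[OF a g(1) u]
      using leaf[OF f(1) actK_VK[OF g(1) u]] g(2)[OF u] by (simp only: f(2))
    then show ?case using Aut0_comp[OF a g(1)] by blast
  qed
  then show ?thesis using assms(4) by blast
qed

section \<open>The isomorphism with K_4\<close>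

definition extend_vertex :: "nat \<Rightarrow> (endo \<times> nat set set) set \<Rightarrow> (endo \<times> nat set set) set" where
  "extend_vertex n v = (THE u. \<exists>\<alpha>\<in>Aut0 4. \<exists>\<Theta>\<in>HT 4. v = cls 4 \<alpha> \<Theta> \<and> u = cls n (iota n \<alpha>) (tildeHT n \<Theta>))"

text \<open>By \<open>vertex_eq_iff\<close> representatives of the same vertex of K_4 have the same
  extension, so the description in \<open>extend_vertex\<close> has exactly one solution.\<close>

lemma extend_vertex_cls:
  assumes "n \<ge> 5" "\<alpha> \<in> Aut0 4" "\<Theta> \<in> HT 4"
  shows "extend_vertex n (cls 4 \<alpha> \<Theta>) = cls n (iota n \<alpha>) (tildeHT n \<Theta>)"
  unfolding extend_vertex_def
proof (rule the_equality)
  fix u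
  assume "\<exists>\<beta>\<in>Aut0 4. \<exists>\<Lambda>\<in>HT 4. cls 4 \<alpha> \<Theta> = cls 4 \<beta> \<Lambda> \<and> u = cls n (iota n \<beta>) (tildeHT n \<Lambda>)"
  then obtain \<beta> \<Lambda> where *: "\<beta> \<in> Aut0 4" "\<Lambda> \<in> HT 4" "cls 4 \<alpha> \<Theta> = cls 4 \<beta> \<Lambda>"
    and u: "u = cls n (iota n \<beta>) (tildeHT n \<Lambda>)" by blast
  show "u = cls n (iota n \<alpha>) (tildeHT n \<Theta>)"
    unfolding u using iffD2[OF vertex_eq_iff[OF assms(1,2) *(1) assms(3) *(2)] *(3)] by (rule sym)
qed (use assms in blast)

lemma extend_vertex_bij:
  assumes n: "n \<ge> 5"
  shows "bij_betw (extend_vertex n) (VK 4) (Vsub n)"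
  unfolding bij_betw_def
proof
  show "inj_on (extend_vertex n) (VK 4)"
  proof (rule inj_onI)
    fix u v assume "u \<in> VK 4" "v \<in> VK 4" and eq: "extend_vertex n u = extend_vertex n v"
    then obtain \<alpha> \<Theta> \<beta> \<Lambda> where *: "\<alpha> \<in> Aut0 4" "\<Theta> \<in> HT 4" "\<beta> \<in> Aut0 4" "\<Lambda> \<in> HT 4"
      and uv: "u = cls 4 \<alpha> \<Theta>" "v = cls 4 \<beta> \<Lambda>" by (meson VK_D)
    show "u = v"
      using eq unfolding uv extend_vertex_cls[OF n *(1,2)] extend_vertex_cls[OF n *(3,4)]
        vertex_eq_iff[OF n *(1,3,2,4)] .
  qed
  show "extend_vertex n ` VK 4 = Vsub n"
  proof
    show "extend_vertex n ` VK 4 \<subseteq> Vsub n"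
    proof
      fix u assume "u \<in> extend_vertex n ` VK 4"
      then obtain v where v: "v \<in> VK 4" "u = extend_vertex n v" by blast
      obtain \<alpha> \<Theta> where *: "\<alpha> \<in> Aut0 4" "\<Theta> \<in> HT 4" "v = cls 4 \<alpha> \<Theta>" using VK_D[OF v(1)] by blast
      then have "u = cls n (iota n \<alpha>) (tildeHT n \<Theta>)" using v(2) extend_vertex_cls[OF n] by simp
      then show "u \<in> Vsub n" using * unfolding Vsub_def by blast
    qed
    show "Vsub n \<subseteq> extend_vertex n ` VK 4"
    proof
      fix u assume "u \<in> Vsub n"
      then obtain \<alpha> \<Theta> where *: "\<alpha> \<in> Aut0 4" "\<Theta> \<in> HT 4" "u = cls n (iota n \<alpha>) (tildeHT n \<Theta>)"
        unfolding Vsub_def by blast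
      have "u = extend_vertex n (cls 4 \<alpha> \<Theta>)" using *(3) extend_vertex_cls[OF n *(1,2)] by simp
      moreover have "cls 4 \<alpha> \<Theta> \<in> VK 4" using *(1,2) unfolding VK_def by blast
      ultimately show "u \<in> extend_vertex n ` VK 4" by blast
    qed
  qed
qed

lemma extend_vertex_le:
  assumes n: "n \<ge> 5" and "u \<in> VK 4" "v \<in> VK 4"
  shows "leK n (extend_vertex n u) (extend_vertex n v) \<longleftrightarrow> leK 4 u v"
proof -
  obtain \<alpha> \<Theta> \<beta> \<Lambda> where *: "\<alpha> \<in> Aut0 4" "\<Theta> \<in> HT 4" "\<beta> \<in> Aut0 4" "\<Lambda> \<in> HT 4"
    and uv: "u = cls 4 \<alpha> \<Theta>" "v = cls 4 \<beta> \<Lambda>" using assms(2,3) by (meson VK_D)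
  show ?thesis
    unfolding uv extend_vertex_cls[OF n *(1,2)] extend_vertex_cls[OF n *(3,4)]
    by (rule vertex_le_iff[OF n *(1,3,2,4)])
qed

lemma extend_vertex_simplex:
  assumes n: "n \<ge> 5" and S: "S \<subseteq> VK 4"
  shows "is_simplex (VK 4) (leK 4) S \<longleftrightarrow> is_simplex (Vsub n) (leK n) (extend_vertex n ` S)"
proof -
  note bij = extend_vertex_bij[OF n]
  have "finite (extend_vertex n ` S) \<longleftrightarrow> finite S"
    by (rule finite_image_iff[OF inj_on_subset[OF bij_betw_imp_inj_on[OF bij] S]])
  moreover have "extend_vertex n ` S \<subseteq> Vsub n"
    using S bij_betw_imp_surj_on[OF bij] by blast
  moreover have "(\<forall>u\<in>extend_vertex n ` S. \<forall>w\<in>extend_vertex n ` S. leK n u w \<or> leK n w u)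
      \<longleftrightarrow> (\<forall>u\<in>S. \<forall>w\<in>S. leK 4 u w \<or> leK 4 w u)"
  proof -
    have "leK n (extend_vertex n u) (extend_vertex n w) \<longleftrightarrow> leK 4 u w" if "u \<in> S" "w \<in> S" for u w
      using extend_vertex_le[OF n] S that by (meson subsetD)
    then show ?thesis by simp
  qed
  ultimately show ?thesis using S unfolding is_simplex_def by simp
qed

text \<open>The twist by which \<open>iota\<close> fails to be multiplicative is carried by every
  extended hypertree, so it disappears in the vertex.\<close>

lemma extend_vertex_equivariant:
  assumes n: "n \<ge> 5" and \<beta>: "\<beta> \<in> Aut0 4" and "v \<in> VK 4"
  shows "extend_vertex n (actK \<beta> v) = actK (iota n \<beta>) (extend_vertex n v)"
proof -
  obtain \<alpha> \<Theta> where \<alpha>: "\<alpha> \<in> Aut0 4" and \<Theta>: "\<Theta> \<in> HT 4" and v: "v = cls 4 \<alpha> \<Theta>"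
    using VK_D[OF assms(3)] by blast
  have ba: "comp \<beta> \<alpha> \<in> Aut0 4" by (rule Aut0_comp[OF \<beta> \<alpha>])
  obtain \<epsilon> where \<epsilon>: "\<epsilon> \<in> {idE, pconj 1 {5..n}}"
    "comp (iota n \<beta>) (iota n \<alpha>) = comp (iota n (comp \<beta> \<alpha>)) \<epsilon>"
    using iota_comp[OF Aut0_EN[OF \<beta>] Aut0_EN[OF \<alpha>] n] by blast
  have \<epsilon>C: "\<epsilon> \<in> CarG n (tildeHT n \<Theta>)" by (rule twist_CarG[OF HT_edge[OF \<Theta>] n \<epsilon>(1)])
  have "extend_vertex n (actK \<beta> v) = cls n (iota n (comp \<beta> \<alpha>)) (tildeHT n \<Theta>)"
    unfolding v actK_cls[OF Aut0_nice[OF \<beta>] Aut0_nice[OF \<alpha>]] by (rule extend_vertex_cls[OF n ba \<Theta>])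
  also have "\<dots> = cls n (comp (iota n \<beta>) (iota n \<alpha>)) (tildeHT n \<Theta>)"
    unfolding \<epsilon>(2) by (rule cls_comp_CarG[OF Aut0_nice[OF iota_Aut0[OF ba n]] \<epsilon>C, symmetric])
  also have "\<dots> = actK (iota n \<beta>) (extend_vertex n v)"
    unfolding v extend_vertex_cls[OF n \<alpha> \<Theta>]
    by (rule actK_cls[OF Aut0_nice[OF iota_Aut0[OF \<beta> n]] Aut0_nice[OF iota_Aut0[OF \<alpha> n]], symmetric])
  finally show ?thesis .
qed

theorem theorem6p15:
  fixes n :: nat
  assumes "n \<ge> 5"
  shows "{p \<in> realiz (VK n) (leK n). \<forall>g\<in>Gsub n. \<forall>v\<in>VK n. p (actK g v) = p v}
           = {p \<in> realiz (VK n) (leK n). {v. p v \<noteq> 0} \<subseteq> Vsub n}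
         \<and> (\<exists>\<Psi>. (\<forall>\<alpha>\<in>Aut0 4. \<forall>\<Theta>\<in>HT 4.
                    \<Psi> (cls 4 \<alpha> \<Theta>) = cls n (iota n \<alpha>) (tildeHT n \<Theta>))
              \<and> bij_betw \<Psi> (VK 4) (Vsub n)
              \<and> (\<forall>S \<subseteq> VK 4. is_simplex (VK 4) (leK 4) S
                              \<longleftrightarrow> is_simplex (Vsub n) (leK n) (\<Psi> ` S))
              \<and> (\<forall>\<beta>\<in>Aut0 4. \<forall>v\<in>VK 4. \<Psi> (actK \<beta> v) = actK (iota n \<beta>) (\<Psi> v)))"
proof (intro conjI exI[of _ "extend_vertex n"] ballI allI impI)
  show "{p \<in> realiz (VK n) (leK n). \<forall>g\<in>Gsub n. \<forall>v\<in>VK n. p (actK g v) = p v}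
      = {p \<in> realiz (VK n) (leK n). {v. p v \<noteq> 0} \<subseteq> Vsub n}" (is "?F = ?S")
  proof
    show "?F \<subseteq> ?S" using fixed_point_support[OF assms] by auto
    show "?S \<subseteq> ?F" using supported_point_fixed[OF assms] by blast
  qed
qed (simp_all only: assms extend_vertex_cls extend_vertex_bij extend_vertex_simplex
    extend_vertex_equivariant)

end
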